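(* Let $\{\psi^{(\infty)}_{\alpha}\}_{\alpha\in\mathbb Z\times\mathbb Z}$ be the real Haar wavelet basis of $L^2(\mathbb R)$, and for every prime $p$ let $\psi^{(p)}_1,\dots,\psi^{(p)}_{p-1}$ be compactly supported wavelet functions for the $p$-adic Haar multiresolution analysis, with associated modified Haar basis $\{\psi^{(p)}_{\alpha_p}\}_{\alpha_p\in\mathbb I_p}$ of $L^2(\mathbb Q_p)$, consisting of the functions $\phi^{(p)}(x_p-a)$, $a\in I_p$, and $p^{j/2}\psi^{(p)}_k(p^{-j}x_p-a)$, $k\in\{1,\dots,p-1\}$, $j\in\{0,1,2,\dots\}$, $a\in I_p$. Then the functions $$\Psi_\alpha(x)=\psi^{(\infty)}_{\alpha_\infty}(x_\infty)\prod_{q\ \mathrm{prime}}\psi^{(q)}_{\alpha_q}(x_q),\qquad x\in\mathbb A,$$ where $\alpha=(\alpha_\infty,\alpha_2,\alpha_3,\dots)$ runs over all multi-indices with $\alpha_\infty\in\mathbb Z\times\mathbb Z$, $\alpha_q\in\mathbb I_q$, and $\psi^{(q)}_{\alpha_q}=\phi^{(q)}$ for all sufficiently large primes $q$ (depending on $\alpha$), form an orthonormal basis of $L^2(\mathbb A,dx)$; and the functions $$\widetilde\Psi_\alpha(x')=\prod_{q\ \mathrm{prime}}\psi^{(q)}_{\alpha_q}(x_q),\qquad x'\in\widetilde{\mathbb A},$$ where $\alpha=(\alpha_2,\alpha_3,\dots)$ runs over all multi-indices with $\alpha_q\in\mathbb I_q$ and $\psi^{(q)}_{\alpha_q}=\phi^{(q)}$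 for all sufficiently large $q$, form an orthonormal basis of $L^2(\widetilde{\mathbb A},dx')$.
   Context: For a prime $p$, $\mathbb Q_p$ is the field of $p$-adic numbers with norm $|\cdot|_p$, $\mathbb Z_p$ its unit ball, and $dx_p$ Haar measure with $\mathbb Z_p$ of measure $1$. $\mathbb A$ is the adele ring of $\mathbb Q$: sequences $(x_\infty,x_2,x_3,x_5,\dots)$ with $x_\infty\in\mathbb R$, $x_p\in\mathbb Q_p$, and $x_p\in\mathbb Z_p$ for all but finitely many $p$, with Haar measure $dx=dx_\infty dx_2dx_3\cdots$ ($dx_\infty$ Lebesgue; $[0,1]\times\prod_p\mathbb Z_p$ has measure 1). $\widetilde{\mathbb A}$ is its non-Archimedean part (sequences $x'=(x_2,x_3,x_5,\dots)$ with $x_p\in\mathbb Z_p$ for almost all $p$) with Haar measure $dx'$ for which $\prod_p\mathbb Z_p$ has measure 1. $\phi^{(p)}(x_p)=\Omega(|x_p|_p)$, where $\Omega$ is the characteristic function of $[0,1]$, i.e. $\phi^{(p)}$ is the characteristic function of $\mathbb Z_p$. Real Haar basis: $\psi^{(\infty)}_{(j,n)}(t)=2^{j/2}\psi^H(2^jt-n)$, $j,n\in\mathbb Z$, with $\psi^H=\chi_{[0,1/2)}-\chi_{[1/2,1)}$. $I_p=\{a\in\mathbb Q_p:\{a\}_p=a\}$ is the set of all finite sums $a=a_{-\gamma}p^{-\gamma}+\dots+a_{-1}p^{-1}$ with $a_i\in\{0,1,\dots,p-1\}$ (including $0$). $p$-adic Haar multiresolution analysis: $V_j\subset L^2(\mathbb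 Q_p)$, $j\in\mathbb Z$, is the closed linear span of $\{p^{j/2}\phi^{(p)}(p^{-j}x-a):a\in I_p\}$; $W_j=V_{j+1}\ominus V_j$. Compactly supported wavelet functions for it are compactly supported functions $\psi_1,\dots,\psi_{p-1}\in W_0$ such that $\{\psi_k(x-a):1\le k\le p-1,\ a\in I_p\}$ is an orthonormal basis of $W_0$ (for example $\psi_k(x)=e^{2\pi i\{kx/p\}_p}\phi^{(p)}(x)$, where $\{\cdot\}_p$ is the $p$-adic fractional part). *)

theory Defs
  imports
    "HOL-Analysis.Analysis"
    "HOL-Computational_Algebra.Primes"
    "HOL-Library.Groups_Big_Fun"
    "HOL-Algebra.QuotRing"
begin

section \<open>The field of p-adic numbers\<close>

text \<open>
  The p-adic numbers are the completion of the rationals: the ring of p-adic Cauchy sequences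
  modulo the ideal of p-adic null sequences. One type of elements serves all primes, so that
  families indexed by the primes can be formed; the field itself is a ring in the sense
  of HOL-Algebra.
\<close>

definition padic_abs :: "nat \<Rightarrow> rat \<Rightarrow> real" where
  "padic_abs p r =
     (if r = 0 then 0
      else real p powi (int (multiplicity (int p) (snd (quotient_of r)))
                        - int (multiplicity (int p) (fst (quotient_of r)))))"

definition padic_cauchy_ring :: "nat \<Rightarrow> (nat \<Rightarrow> rat) ring" where
  "padic_cauchy_ring p =
     \<lparr>carrier = {s. \<forall>e>0. \<exists>N. \<forall>m\<ge>N. \<forall>n\<ge>N. padic_abs p (s m - s n) < e},
      monoid.mult = (\<lambda>s t n. s n * t n),
      one = (\<lambda>n. 1),
      zero = (\<lambda>n. 0),
      add = (\<lambda>s t n. s n + t n)\<rparr>"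

definition padic_null :: "nat \<Rightarrow> (nat \<Rightarrow> rat) set" where
  "padic_null p = {s. (\<lambda>n. padic_abs p (s n)) \<longlonglongrightarrow> 0}"

type_synonym padic = "(nat \<Rightarrow> rat) set"

definition Qp :: "nat \<Rightarrow> padic ring" where
  "Qp p = padic_cauchy_ring p Quot padic_null p"

definition padic_of_rat :: "nat \<Rightarrow> rat \<Rightarrow> padic" where
  "padic_of_rat p r = padic_null p +>\<^bsub>padic_cauchy_ring p\<^esub> (\<lambda>n. r)"

definition padic_norm :: "nat \<Rightarrow> padic \<Rightarrow> real" where
  "padic_norm p x = (THE l. \<forall>s\<in>x. (\<lambda>n. padic_abs p (s n)) \<longlonglongrightarrow> l)"

text \<open>The value 0 off the carrier is what the axioms of the locale for metric spaces require.\<close>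

definition padic_dist :: "nat \<Rightarrow> padic \<Rightarrow> padic \<Rightarrow> real" where
  "padic_dist p x y =
     (if x \<in> carrier (Qp p) \<and> y \<in> carrier (Qp p) then padic_norm p (x \<ominus>\<^bsub>Qp p\<^esub> y) else 0)"

definition Qp_topology :: "nat \<Rightarrow> padic topology" where
  "Qp_topology p = Metric_space.mtopology (carrier (Qp p)) (padic_dist p)"

definition Zp :: "nat \<Rightarrow> padic set" where
  "Zp p = {x \<in> carrier (Qp p). padic_norm p x \<le> 1}"

definition Ip :: "nat \<Rightarrow> padic set" where
  "Ip p = {padic_of_rat p (\<Sum>i=1..g. of_nat (d i) / of_nat p ^ i) | g d. \<forall>i. d i < p}"


section \<open>Adeles\<close>

definition finite_adele_ring :: "(nat \<Rightarrow> padic) ring" where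
  "finite_adele_ring =
     \<lparr>carrier = {x \<in> (\<Pi>\<^sub>E q\<in>{q. prime q}. carrier (Qp q)). finite {q. prime q \<and> x q \<notin> Zp q}},
      monoid.mult = (\<lambda>x y. \<lambda>q\<in>{q. prime q}. x q \<otimes>\<^bsub>Qp q\<^esub> y q),
      one = (\<lambda>q\<in>{q. prime q}. \<one>\<^bsub>Qp q\<^esub>),
      zero = (\<lambda>q\<in>{q. prime q}. \<zero>\<^bsub>Qp q\<^esub>),
      add = (\<lambda>x y. \<lambda>q\<in>{q. prime q}. x q \<oplus>\<^bsub>Qp q\<^esub> y q)\<rparr>"

definition adele_ring :: "(real \<times> (nat \<Rightarrow> padic)) ring" where
  "adele_ring =
     \<lparr>carrier = UNIV \<times> carrier finite_adele_ring,
      monoid.mult = (\<lambda>x y. (fst x * fst y, snd x \<otimes>\<^bsub>finite_adele_ring\<^esub> snd y)),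
      one = (1, \<one>\<^bsub>finite_adele_ring\<^esub>),
      zero = (0, \<zero>\<^bsub>finite_adele_ring\<^esub>),
      add = (\<lambda>x y. (fst x + fst y, snd x \<oplus>\<^bsub>finite_adele_ring\<^esub> snd y))\<rparr>"

text \<open>The restricted product topology.\<close>

definition finite_adele_topology :: "(nat \<Rightarrow> padic) topology" where
  "finite_adele_topology =
     topology_generated_by
       {(\<Pi>\<^sub>E q\<in>{q. prime q}. U q) | U.
          (\<forall>q. prime q \<longrightarrow> openin (Qp_topology q) (U q)) \<and> finite {q. prime q \<and> U q \<noteq> Zp q}}"

definition adele_topology :: "(real \<times> (nat \<Rightarrow> padic)) topology" where
  "adele_topology = prod_topology euclidean finite_adele_topology"

definition Z_hat :: "(nat \<Rightarrow> padic) set" where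
  "Z_hat = (\<Pi>\<^sub>E q\<in>{q. prime q}. Zp q)"


section \<open>Haar measure on the additive group of a topological ring\<close>

text \<open>
  Regularity is not required explicitly: the groups considered here are locally compact,
  Hausdorff and second countable, so Borel measures finite on compact sets are regular.
\<close>

definition haar_measure :: "('a, 'b) ring_scheme \<Rightarrow> 'a topology \<Rightarrow> 'a measure \<Rightarrow> bool" where
  "haar_measure R X M \<longleftrightarrow>
     space M = carrier R \<and>
     sets M = sigma_sets (carrier R) {U. openin X U} \<and>
     (\<forall>K. compactin X K \<longrightarrow> emeasure M K < \<infinity>) \<and>
     (\<forall>U. openin X U \<and> U \<noteq> {} \<longrightarrow> emeasure M U > 0) \<and>
     (\<forall>g\<in>carrier R. \<forall>A\<in>sets M. emeasure M ((\<lambda>x. g \<oplus>\<^bsub>R\<^esub> x) ` A) = emeasure M A)"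


section \<open>Square-integrable functions\<close>

text \<open>
  Elements of the Hilbert space of square-integrable functions are represented by functions
  rather than by classes modulo almost-everywhere equality; the subspaces below are saturated
  under almost-everywhere equality.
\<close>

definition L2 :: "'a measure \<Rightarrow> ('a \<Rightarrow> complex) set" where
  "L2 M = {f \<in> borel_measurable M. integrable M (\<lambda>x. (cmod (f x))\<^sup>2)}"

definition l2_inner :: "'a measure \<Rightarrow> ('a \<Rightarrow> complex) \<Rightarrow> ('a \<Rightarrow> complex) \<Rightarrow> complex" where
  "l2_inner M f g = (LINT x|M. f x * cnj (g x))"

definition l2_norm :: "'a measure \<Rightarrow> ('a \<Rightarrow> complex) \<Rightarrow> real" where
  "l2_norm M f = sqrt (LINT x|M. (cmod (f x))\<^sup>2)"

definition fun_span :: "('a \<Rightarrow> complex) set \<Rightarrow> ('a \<Rightarrow> complex) set" where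
  "fun_span S = {\<lambda>x. \<Sum>b\<in>B. c b * b x | B c. finite B \<and> B \<subseteq> S}"

definition closed_span :: "'a measure \<Rightarrow> ('a \<Rightarrow> complex) set \<Rightarrow> ('a \<Rightarrow> complex) set" where
  "closed_span M S =
     {f \<in> L2 M. \<forall>e>0. \<exists>g\<in>fun_span S. l2_norm M (\<lambda>x. f x - g x) < e}"

definition orthonormal_basis ::
    "'a measure \<Rightarrow> ('a \<Rightarrow> complex) set \<Rightarrow> 'i set \<Rightarrow> ('i \<Rightarrow> 'a \<Rightarrow> complex) \<Rightarrow> bool" where
  "orthonormal_basis M H I e \<longleftrightarrow>
     (\<forall>i\<in>I. e i \<in> L2 M) \<and>
     (\<forall>i\<in>I. \<forall>j\<in>I. l2_inner M (e i) (e j) = (if i = j then 1 else 0)) \<and>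
     closed_span M (e ` I) = H"


section \<open>The Haar multiresolution analysis of the p-adic numbers\<close>

definition phi :: "nat \<Rightarrow> padic \<Rightarrow> complex" where
  "phi p x = indicator {0..1} (padic_norm p x)"

definition padic_shift :: "nat \<Rightarrow> (padic \<Rightarrow> complex) \<Rightarrow> padic \<Rightarrow> padic \<Rightarrow> complex" where
  "padic_shift p f a x = f (x \<ominus>\<^bsub>Qp p\<^esub> a)"

definition padic_dilate_shift ::
    "nat \<Rightarrow> (padic \<Rightarrow> complex) \<Rightarrow> int \<Rightarrow> padic \<Rightarrow> padic \<Rightarrow> complex" where
  "padic_dilate_shift p f j a x =
     of_real (real p powr (real_of_int j / 2)) *
     f ((padic_of_rat p (of_nat p powi (- j)) \<otimes>\<^bsub>Qp p\<^esub> x) \<ominus>\<^bsub>Qp p\<^esub> a)"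

definition padic_V :: "nat \<Rightarrow> padic measure \<Rightarrow> int \<Rightarrow> (padic \<Rightarrow> complex) set" where
  "padic_V p M j = closed_span M {padic_dilate_shift p (phi p) j a | a. a \<in> Ip p}"

definition padic_W :: "nat \<Rightarrow> padic measure \<Rightarrow> int \<Rightarrow> (padic \<Rightarrow> complex) set" where
  "padic_W p M j = {f \<in> padic_V p M (j + 1). \<forall>g\<in>padic_V p M j. l2_inner M f g = 0}"

definition padic_compact_support :: "nat \<Rightarrow> (padic \<Rightarrow> complex) \<Rightarrow> bool" where
  "padic_compact_support p f \<longleftrightarrow>
     compactin (Qp_topology p) (Qp_topology p closure_of {x \<in> carrier (Qp p). f x \<noteq> 0})"

definition compactly_supported_wavelets ::
    "nat \<Rightarrow> padic measure \<Rightarrow> (nat \<Rightarrow> padic \<Rightarrow> complex) \<Rightarrow> bool" where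
  "compactly_supported_wavelets p M \<psi> \<longleftrightarrow>
     (\<forall>k\<in>{1..p-1}. padic_compact_support p (\<psi> k) \<and> \<psi> k \<in> padic_W p M 0) \<and>
     orthonormal_basis M (padic_W p M 0) ({1..p-1} \<times> Ip p) (\<lambda>(k, a). padic_shift p (\<psi> k) a)"


section \<open>Wavelet bases\<close>

definition haar_mother :: "real \<Rightarrow> real" where
  "haar_mother t = indicator {0..<1/2} t - indicator {1/2..<1} t"

definition real_haar :: "int \<times> int \<Rightarrow> real \<Rightarrow> real" where
  "real_haar = (\<lambda>(j, n) t. 2 powr (real_of_int j / 2) * haar_mother (2 powi j * t - of_int n))"

datatype haar_index = Scaling padic | Wavelet nat nat padic

definition haar_indices :: "nat \<Rightarrow> haar_index set" where
  "haar_indices p =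
     {Scaling a | a. a \<in> Ip p} \<union> {Wavelet k j a | k j a. k \<in> {1..p-1} \<and> a \<in> Ip p}"

primrec modified_haar ::
    "nat \<Rightarrow> (nat \<Rightarrow> padic \<Rightarrow> complex) \<Rightarrow> haar_index \<Rightarrow> padic \<Rightarrow> complex" where
  "modified_haar p \<psi> (Scaling a) = padic_shift p (phi p) a"
| "modified_haar p \<psi> (Wavelet k j a) = padic_dilate_shift p (\<psi> k) (int j) a"

definition finite_adelic_indices ::
    "(nat \<Rightarrow> nat \<Rightarrow> padic \<Rightarrow> complex) \<Rightarrow> (nat \<Rightarrow> haar_index) set" where
  "finite_adelic_indices \<psi> =
     {\<alpha> \<in> (\<Pi>\<^sub>E q\<in>{q. prime q}. haar_indices q).
        \<exists>N. \<forall>q\<ge>N. prime q \<longrightarrow> (\<forall>x\<in>carrier (Qp q). modified_haar q (\<psi> q) (\<alpha> q) x = phi q x)}"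

text \<open>
  At a finite adele all but finitely many factors are equal to 1, so the product over all primes
  is a finite one. It is written with the product operator for functions with finite
  multiplicative support, since the ordinary product over an infinite set is 1.
\<close>

definition finite_adelic_wavelet ::
    "(nat \<Rightarrow> nat \<Rightarrow> padic \<Rightarrow> complex) \<Rightarrow> (nat \<Rightarrow> haar_index) \<Rightarrow> (nat \<Rightarrow> padic) \<Rightarrow> complex" where
  "finite_adelic_wavelet \<psi> \<alpha> x =
     Prod_any (\<lambda>q. if prime q then modified_haar q (\<psi> q) (\<alpha> q) (x q) else 1)"

definition adelic_wavelet ::
    "(nat \<Rightarrow> nat \<Rightarrow> padic \<Rightarrow> complex) \<Rightarrow> (int \<times> int) \<times> (nat \<Rightarrow> haar_index) \<Rightarrow>
      real \<times> (nat \<Rightarrow> padic) \<Rightarrow> complex" where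
  "adelic_wavelet \<psi> = (\<lambda>(\<alpha>_inf, \<alpha>) (x_inf, x).
     of_real (real_haar \<alpha>_inf x_inf) * finite_adelic_wavelet \<psi> \<alpha> x)"

end

theory Submission
  imports Defs "HOL-Number_Theory.Cong"
begin

text \<open>
  In a p-adic field the balls are nested or disjoint, every ball splits into p translates of a
  smaller one, and there are only countably many of them; hence a ball of radius 1/p^k has Haar
  measure 1/p^k, and indicators of balls span a dense subspace. If B is a ball of radius 1/p inside
  a ball B' of radius 1, then 1_B - (1/p) 1_B' is orthogonal to V_0 and thus lies in W_0. So each
  V_(j+1) is contained in the closed span of V_j and the dilated wavelets, and the modified Haar
  system is an orthonormal basis of the square-integrable functions on Q_p.

  By uniqueness of Haar measure on boxes, the Haar measure of the finite adeles restricted to the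
  adeles that are integral outside a finite set S of primes projects to the product of the local
  Haar measures over S. The products of local basis functions are therefore orthonormal, and
  approximating one coordinate after another shows that their closed span contains the indicators
  of all boxes. The Haar measure of the adele ring is the product of Lebesgue measure and the Haar
  measure of the finite adeles, and a product of orthonormal bases is an orthonormal basis.
\<close>

section \<open>Square-integrable functions\<close>

text \<open>Functions stand for their classes, so identities are needed only on the space of a
  measure; \<open>closed_span_cong\<close> carries them into closed spans. The weight 1/p is the
  ratio of the volumes of the two balls: it gives the difference mean zero on every unit ball. The
  modified basis contains the translates of \<open>phi\<close>, and a ball larger than a unit ball
  is a finite sum of unit balls, so only levels from 0 on require wavelets. The real Haar basis has
  no scaling function; there an indicator is reached only as a limit, the remainder after k steps
  being spread thin over an interval 2^k times as long. The infinite product is harmless because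
  \<open>phi q\<close> is the indicator of Z_q: outside a finite set S the factors multiply to the
  indicator of integrality, so each wavelet lives where integrals are integrals over finite
  products. The measure of a ball is forced by two facts, invariance under translation and splitting
  into p congruent children; the argument is run for set functions, so that it can act on one
  coordinate of a box. The normalization of the adeles by the closed interval [0,1] makes it
  necessary to show that an endpoint carries no mass.\<close>

lemma L2_measurable: "f \<in> L2 M \<Longrightarrow> f \<in> borel_measurable M"
  by (simp add: L2_def)

lemma L2_integrable_square: "f \<in> L2 M \<Longrightarrow> integrable M (\<lambda>x. (cmod (f x))\<^sup>2)"
  by (simp add: L2_def)

lemma L2_I:
  assumes "f \<in> borel_measurable M" "integrable M g" "\<And>x. x \<in> space M \<Longrightarrow> (cmod (f x))\<^sup>2 \<le> g x"
  shows "f \<in> L2 M"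
  unfolding L2_def
proof (intro CollectI conjI assms(1))
  show "integrable M (\<lambda>x. (cmod (f x))\<^sup>2)"
    by (rule Bochner_Integration.integrable_bound[OF assms(2)])
       (use assms in \<open>auto intro!: AE_I2 order_trans[OF assms(3)]\<close>)
qed

lemma cmod_add_square_le: "(cmod (a + b))\<^sup>2 \<le> 2 * (cmod a)\<^sup>2 + 2 * (cmod b)\<^sup>2"
proof -
  have "(cmod (a + b))\<^sup>2 \<le> (cmod a + cmod b)\<^sup>2"
    by (intro power_mono norm_triangle_ineq) auto
  also have "\<dots> \<le> 2 * (cmod a)\<^sup>2 + 2 * (cmod b)\<^sup>2"
    using zero_le_power2[of "cmod a - cmod b"] by (simp add: power2_eq_square algebra_simps)
  finally show ?thesis .
qed

lemma L2_add:
  assumes "f \<in> L2 M" "g \<in> L2 M"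
  shows "(\<lambda>x. f x + g x) \<in> L2 M"
proof (rule L2_I)
  show "integrable M (\<lambda>x. 2 * (cmod (f x))\<^sup>2 + 2 * (cmod (g x))\<^sup>2)"
    using assms by (simp add: L2_def)
qed (use assms in \<open>auto simp: L2_def intro: cmod_add_square_le\<close>)

lemma L2_cmult:
  assumes "f \<in> L2 M"
  shows "(\<lambda>x. c * f x) \<in> L2 M"
  using assms by (auto simp: L2_def norm_mult power_mult_distrib)

lemma L2_uminus: "f \<in> L2 M \<Longrightarrow> (\<lambda>x. - f x) \<in> L2 M"
  by (auto simp: L2_def)

lemma L2_diff:
  assumes "f \<in> L2 M" "g \<in> L2 M"
  shows "(\<lambda>x. f x - g x) \<in> L2 M"
  using L2_add[OF assms(1) L2_uminus[OF assms(2)]] by simp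

lemma L2_zero: "(\<lambda>x. 0) \<in> L2 M"
  by (simp add: L2_def)

lemma L2_sum: "(\<And>i. i \<in> I \<Longrightarrow> f i \<in> L2 M) \<Longrightarrow> (\<lambda>x. \<Sum>i\<in>I. f i x) \<in> L2 M"
  by (induction I rule: infinite_finite_induct) (auto simp: L2_zero L2_add)

lemma L2_cong:
  assumes "f \<in> L2 M" "\<And>x. x \<in> space M \<Longrightarrow> f x = g x"
  shows "g \<in> L2 M"
proof -
  have "g \<in> borel_measurable M"
    using assms L2_measurable[OF assms(1)] by (simp cong: measurable_cong)
  moreover have "integrable M (\<lambda>x. (cmod (g x))\<^sup>2) = integrable M (\<lambda>x. (cmod (f x))\<^sup>2)"
    by (rule Bochner_Integration.integrable_cong) (auto simp: assms(2))
  ultimately show ?thesis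
    using assms by (simp add: L2_def)
qed

lemma L2_indicator:
  assumes "A \<in> sets M" "emeasure M A < \<infinity>"
  shows "(indicator A :: _ \<Rightarrow> complex) \<in> L2 M"
proof (rule L2_I)
  show "integrable M (indicator A :: _ \<Rightarrow> real)"
    using assms by simp
qed (use assms in \<open>auto simp: indicator_def\<close>)

lemma l2_inner_integrable:
  assumes "f \<in> L2 M" "g \<in> L2 M"
  shows "integrable M (\<lambda>x. f x * cnj (g x))"
proof (rule Bochner_Integration.integrable_bound)
  show "integrable M (\<lambda>x. (cmod (f x))\<^sup>2 + (cmod (g x))\<^sup>2)"
    using assms by (simp add: L2_def)
  show "(\<lambda>x. f x * cnj (g x)) \<in> borel_measurable M"
    using assms unfolding L2_def
    by (auto intro!: borel_measurable_times borel_measurable_continuous_on[OF continuous_on_cnj[OF continuous_on_id]])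
  have "cmod a * cmod b \<le> (cmod a)\<^sup>2 + (cmod b)\<^sup>2" for a b
    using sum_squares_bound[of "cmod a" "cmod b"] mult_nonneg_nonneg[OF norm_ge_zero norm_ge_zero, of a b]
    by linarith
  then show "AE x in M. norm (f x * cnj (g x)) \<le> norm ((cmod (f x))\<^sup>2 + (cmod (g x))\<^sup>2)"
    by (auto simp: norm_mult)
qed

lemma l2_norm_square: "(l2_norm M f)\<^sup>2 = (LINT x|M. (cmod (f x))\<^sup>2)"
  by (simp add: l2_norm_def)

lemma l2_norm_nonneg: "0 \<le> l2_norm M f"
  by (simp add: l2_norm_def)

lemma l2_norm_less_iff: "0 < e \<Longrightarrow> l2_norm M f < e \<longleftrightarrow> (LINT x|M. (cmod (f x))\<^sup>2) < e\<^sup>2"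
  by (metis l2_norm_nonneg l2_norm_square less_eq_real_def power_less_imp_less_base power_strict_mono zero_less_numeral)

lemma l2_inner_self: "l2_inner M f f = of_real (LINT x|M. (cmod (f x))\<^sup>2)"
  unfolding l2_inner_def by (simp add: complex_norm_square[symmetric] del: of_real_power)

lemma l2_inner_cong:
  assumes "\<And>x. x \<in> space M \<Longrightarrow> f x = f' x" "\<And>x. x \<in> space M \<Longrightarrow> g x = g' x"
  shows "l2_inner M f g = l2_inner M f' g'"
  unfolding l2_inner_def by (rule Bochner_Integration.integral_cong) (auto simp: assms)

lemma l2_norm_cong:
  assumes "\<And>x. x \<in> space M \<Longrightarrow> f x = f' x"
  shows "l2_norm M f = l2_norm M f'"
  unfolding l2_norm_def by (auto intro!: arg_cong[of _ _ sqrt] Bochner_Integration.integral_cong simp: assms)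

lemma l2_inner_commute: "l2_inner M g f = cnj (l2_inner M f g)"
  unfolding l2_inner_def by (subst Bochner_Integration.integral_cnj[symmetric]) (simp add: mult.commute)

lemma l2_inner_add_left:
  assumes "f \<in> L2 M" "g \<in> L2 M" "h \<in> L2 M"
  shows "l2_inner M (\<lambda>x. f x + g x) h = l2_inner M f h + l2_inner M g h"
  using assms unfolding l2_inner_def
  by (simp add: distrib_right l2_inner_integrable Bochner_Integration.integral_add)

lemma l2_inner_cmult_left: "l2_inner M (\<lambda>x. c * f x) h = c * l2_inner M f h"
  unfolding l2_inner_def by (simp add: mult.assoc)

lemma l2_inner_diff_left:
  assumes "f \<in> L2 M" "g \<in> L2 M" "h \<in> L2 M"
  shows "l2_inner M (\<lambda>x. f x - g x) h = l2_inner M f h - l2_inner M g h"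
  using assms unfolding l2_inner_def
  by (simp add: left_diff_distrib l2_inner_integrable Bochner_Integration.integral_diff)

lemma l2_inner_sum_left:
  assumes "finite I" "\<And>i. i \<in> I \<Longrightarrow> f i \<in> L2 M" "h \<in> L2 M"
  shows "l2_inner M (\<lambda>x. \<Sum>i\<in>I. f i x) h = (\<Sum>i\<in>I. l2_inner M (f i) h)"
  using assms
proof (induction I)
  case empty
  then show ?case by (simp add: l2_inner_def)
next
  case (insert i I)
  then show ?case
    using l2_inner_add_left[of "f i" M "\<lambda>x. \<Sum>i\<in>I. f i x" h] L2_sum[of I f M] by simp
qed

lemma l2_inner_indicator:
  assumes "A \<in> sets M" "B \<in> sets M"
  shows "l2_inner M (indicator A) (indicator B) = of_real (measure M (A \<inter> B))"
proof -
  have "l2_inner M (indicator A) (indicator B) = (LINT x|M. of_real (indicator (A \<inter> B) x))"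
    unfolding l2_inner_def by (intro Bochner_Integration.integral_cong refl) (auto simp: indicator_def)
  also have "\<dots> = of_real (measure M (A \<inter> B \<inter> space M))"
    by (subst integral_complex_of_real) simp
  also have "A \<inter> B \<inter> space M = A \<inter> B"
    using sets.sets_into_space[OF assms(1)] by blast
  finally show ?thesis .
qed

text \<open>The constant 2 is the price for integrating \<open>cmod_add_square_le\<close> pointwise
  instead of proving Minkowski's inequality; approximation arguments absorb it.\<close>

lemma l2_norm_add_le:
  assumes "f \<in> L2 M" "g \<in> L2 M"
  shows "l2_norm M (\<lambda>x. f x + g x) \<le> 2 * (l2_norm M f + l2_norm M g)"
proof -
  have "(LINT x|M. (cmod (f x + g x))\<^sup>2) \<le> (LINT x|M. 2 * (cmod (f x))\<^sup>2 + 2 * (cmod (g x))\<^sup>2)"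
    by (rule integral_mono)
       (use assms L2_add[OF assms] cmod_add_square_le in \<open>auto simp: L2_def\<close>)
  also have "\<dots> = 2 * (l2_norm M f)\<^sup>2 + 2 * (l2_norm M g)\<^sup>2"
    using assms by (simp add: L2_def l2_norm_square)
  also have "\<dots> \<le> (2 * (l2_norm M f + l2_norm M g))\<^sup>2"
    using l2_norm_nonneg[of M f] l2_norm_nonneg[of M g]
    by (simp add: power2_eq_square algebra_simps)
  finally show ?thesis
    unfolding l2_norm_square[symmetric] 
    by (rule power2_le_imp_le) (use l2_norm_nonneg[of M f] l2_norm_nonneg[of M g] in auto)
qed

lemma l2_norm_cmult: "l2_norm M (\<lambda>x. c * f x) = cmod c * l2_norm M f"
  by (simp add: l2_norm_def norm_mult power_mult_distrib real_sqrt_mult)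

text \<open>A weighted arithmetic-geometric mean bound in place of Cauchy-Schwarz. The free weight
  \<open>t\<close> lets a small first factor win against a fixed second one.\<close>

lemma l2_inner_le:
  assumes "f \<in> L2 M" "g \<in> L2 M" "t > 0"
  shows "cmod (l2_inner M f g) \<le> (l2_norm M f)\<^sup>2 / t + t * (l2_norm M g)\<^sup>2"
proof -
  have "cmod (l2_inner M f g) \<le> (LINT x|M. cmod (f x * cnj (g x)))"
    unfolding l2_inner_def by (rule integral_norm_bound)
  also have "\<dots> \<le> (LINT x|M. (cmod (f x))\<^sup>2 / t + t * (cmod (g x))\<^sup>2)"
  proof (rule integral_mono)
    show "integrable M (\<lambda>x. cmod (f x * cnj (g x)))"
      using l2_inner_integrable[OF assms(1,2)] by (rule integrable_norm)
    show "integrable M (\<lambda>x. (cmod (f x))\<^sup>2 / t + t * (cmod (g x))\<^sup>2)"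
      using assms by (simp add: L2_def)
    show "cmod (f x * cnj (g x)) \<le> (cmod (f x))\<^sup>2 / t + t * (cmod (g x))\<^sup>2" for x
    proof -
      \<comment> \<open>The factor \<open>sqrt t\<close> cancels in \<open>a * b\<close>, leaving
        the product of the two absolute values, while the squares acquire the weights 1/t and
        t.\<close>
      define a b where "a = cmod (f x) / sqrt t" and "b = sqrt t * cmod (g x)"
      have "a * b \<le> a\<^sup>2 + b\<^sup>2"
        using zero_le_power2[of "a - b"] zero_le_power2[of "a + b"]
        by (simp add: power2_eq_square algebra_simps)
      then show ?thesis
        using assms(3) by (simp add: a_def b_def norm_mult power_divide power_mult_distrib)
    qed
  qed
  also have "\<dots> = (l2_norm M f)\<^sup>2 / t + t * (l2_norm M g)\<^sup>2"
    using assms by (simp add: L2_def l2_norm_square)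
  finally show ?thesis .
qed

section \<open>Finite linear combinations and closed spans\<close>

lemma fun_span_I: "finite B \<Longrightarrow> B \<subseteq> S \<Longrightarrow> (\<lambda>x. \<Sum>b\<in>B. c b * b x) \<in> fun_span S"
  unfolding fun_span_def by blast

lemma fun_span_base: "f \<in> S \<Longrightarrow> f \<in> fun_span S"
  using fun_span_I[of "{f}" S "\<lambda>_. 1"] by simp

lemma fun_span_cmult:
  assumes "f \<in> fun_span S"
  shows "(\<lambda>x. a * f x) \<in> fun_span S"
proof -
  obtain B c where "finite B" "B \<subseteq> S" "f = (\<lambda>x. \<Sum>b\<in>B. c b * b x)"
    using assms unfolding fun_span_def by blast
  then show ?thesis
    using fun_span_I[of B S "\<lambda>b. a * c b"] by (simp add: sum_distrib_left mult.assoc)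
qed

lemma fun_span_add:
  assumes "f \<in> fun_span S" "g \<in> fun_span S"
  shows "(\<lambda>x. f x + g x) \<in> fun_span S"
proof -
  obtain B c where B: "finite B" "B \<subseteq> S" "f = (\<lambda>x. \<Sum>b\<in>B. c b * b x)"
    using assms unfolding fun_span_def by blast
  obtain D d where D: "finite D" "D \<subseteq> S" "g = (\<lambda>x. \<Sum>b\<in>D. d b * b x)"
    using assms unfolding fun_span_def by blast
  \<comment> \<open>A combination is indexed by a set of functions, so two of them are merged over
    the union, with each coefficient family extended by zero.\<close>
  let ?e = "\<lambda>b. (if b \<in> B then c b else 0) + (if b \<in> D then d b else 0)"
  have "(\<Sum>b\<in>B. c b * b x) + (\<Sum>b\<in>D. d b * b x) = (\<Sum>b\<in>B \<union> D. ?e b * b x)" for x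
  proof -
    have "(\<Sum>b\<in>B. c b * b x) = (\<Sum>b\<in>B \<union> D. (if b \<in> B then c b else 0) * b x)"
      by (rule sum.mono_neutral_cong_left) (use B D in auto)
    moreover have "(\<Sum>b\<in>D. d b * b x) = (\<Sum>b\<in>B \<union> D. (if b \<in> D then d b else 0) * b x)"
      by (rule sum.mono_neutral_cong_left) (use B D in auto)
    ultimately show ?thesis
      by (simp add: sum.distrib[symmetric] distrib_right)
  qed
  then show ?thesis
    using fun_span_I[of "B \<union> D" S ?e] B D by simp
qed

lemma fun_span_zero: "(\<lambda>x. 0) \<in> fun_span S"
  using fun_span_I[of "{}" S] by simp

lemma fun_span_subset_L2: "S \<subseteq> L2 M \<Longrightarrow> fun_span S \<subseteq> L2 M"
  unfolding fun_span_def by (auto intro!: L2_sum L2_cmult)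

lemma closed_span_subset_L2: "closed_span M S \<subseteq> L2 M"
  by (auto simp: closed_span_def)

lemma fun_span_subset_closed_span: "S \<subseteq> L2 M \<Longrightarrow> fun_span S \<subseteq> closed_span M S"
  using fun_span_subset_L2[of S M] by (force simp: closed_span_def l2_norm_def)

lemma closed_span_base: "S \<subseteq> L2 M \<Longrightarrow> f \<in> S \<Longrightarrow> f \<in> closed_span M S"
  using fun_span_subset_closed_span fun_span_base by blast

text \<open>Approximants in the closed span are themselves approximated by finite combinations; this
  is the closedness of \<open>closed_span\<close>, in the form every later limit argument
  uses.\<close>

lemma closed_span_limit:
  assumes S: "S \<subseteq> L2 M" and f: "f \<in> L2 M"
    and approx: "\<And>e. e > 0 \<Longrightarrow> \<exists>g\<in>closed_span M S. l2_norm M (\<lambda>x. f x - g x) < e"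
  shows "f \<in> closed_span M S"
  unfolding closed_span_def
proof (intro CollectI conjI allI impI f)
  fix e :: real
  assume "e > 0"
  \<comment> \<open>A quarter of \<open>e\<close> for each of the two errors, because the triangle
    inequality at hand has the constant 2.\<close>
  then obtain g where g: "g \<in> closed_span M S" "l2_norm M (\<lambda>x. f x - g x) < e / 4"
    using approx[of "e / 4"] by auto
  then obtain h where h: "h \<in> fun_span S" "l2_norm M (\<lambda>x. g x - h x) < e / 4"
    using \<open>e > 0\<close> unfolding closed_span_def by (auto dest!: spec[of _ "e / 4"])
  have L: "g \<in> L2 M" "h \<in> L2 M"
    using g h fun_span_subset_L2[OF S] closed_span_subset_L2 by blast+
  have "l2_norm M (\<lambda>x. (f x - g x) + (g x - h x)) \<le>
      2 * (l2_norm M (\<lambda>x. f x - g x) + l2_norm M (\<lambda>x. g x - h x))"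
    by (intro l2_norm_add_le L2_diff f L)
  then show "\<exists>g\<in>fun_span S. l2_norm M (\<lambda>x. f x - g x) < e"
    using g(2) h by (intro bexI[of _ h]) auto
qed

text \<open>The formulas for wavelets and balls hold on the carrier only, whereas functions are
  defined on the whole type; this lemma bridges the two.\<close>

lemma closed_span_cong:
  assumes "f \<in> closed_span M S" "\<And>x. x \<in> space M \<Longrightarrow> f x = g x"
  shows "g \<in> closed_span M S"
proof -
  have "l2_norm M (\<lambda>x. g x - h x) = l2_norm M (\<lambda>x. f x - h x)" for h
    by (rule l2_norm_cong) (simp add: assms(2))
  then show ?thesis
    using assms L2_cong[of f M g] by (simp add: closed_span_def)
qed

lemma closed_span_cmult:
  assumes S: "S \<subseteq> L2 M" and f: "f \<in> closed_span M S"
  shows "(\<lambda>x. c * f x) \<in> closed_span M S"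
proof (cases "c = 0")
  case True
  then show ?thesis
    using fun_span_subset_closed_span[OF S] fun_span_zero[of S] by auto
next
  case False
  show ?thesis
    unfolding closed_span_def
  proof (intro CollectI conjI allI impI)
    show "(\<lambda>x. c * f x) \<in> L2 M"
      using f closed_span_subset_L2 L2_cmult by blast
    fix e :: real
    assume "e > 0"
    then have "e / cmod c > 0" using False by simp
    then obtain g where g: "g \<in> fun_span S" "l2_norm M (\<lambda>x. f x - g x) < e / cmod c"
      using f unfolding closed_span_def by blast
    have "l2_norm M (\<lambda>x. c * (f x - g x)) < e"
      unfolding l2_norm_cmult using g(2) False by (simp add: mult.commute pos_less_divide_eq)
    then show "\<exists>g\<in>fun_span S. l2_norm M (\<lambda>x. c * f x - g x) < e"
      using fun_span_cmult[OF g(1), of c] by (intro bexI[of _ "\<lambda>x. c * g x"]) (auto simp: algebra_simps)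
  qed
qed

lemma closed_span_add:
  assumes S: "S \<subseteq> L2 M" and f: "f \<in> closed_span M S" and g: "g \<in> closed_span M S"
  shows "(\<lambda>x. f x + g x) \<in> closed_span M S"
  unfolding closed_span_def
proof (intro CollectI conjI allI impI)
  have L: "f \<in> L2 M" "g \<in> L2 M"
    using f g closed_span_subset_L2 by blast+
  then show "(\<lambda>x. f x + g x) \<in> L2 M"
    by (rule L2_add)
  fix e :: real
  assume "e > 0"
  then have "e / 4 > 0" by simp
  obtain f' where f': "f' \<in> fun_span S" "l2_norm M (\<lambda>x. f x - f' x) < e / 4"
    using f \<open>e / 4 > 0\<close> unfolding closed_span_def by blast
  obtain g' where g': "g' \<in> fun_span S" "l2_norm M (\<lambda>x. g x - g' x) < e / 4"
    using g \<open>e / 4 > 0\<close> unfolding closed_span_def by blast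
  have "l2_norm M (\<lambda>x. (f x - f' x) + (g x - g' x)) \<le>
      2 * (l2_norm M (\<lambda>x. f x - f' x) + l2_norm M (\<lambda>x. g x - g' x))"
    using f' g' fun_span_subset_L2[OF S] by (intro l2_norm_add_le L2_diff L) auto
  then show "\<exists>h\<in>fun_span S. l2_norm M (\<lambda>x. f x + g x - h x) < e"
    using f' g' fun_span_add[OF f'(1) g'(1)]
    by (intro bexI[of _ "\<lambda>x. f' x + g' x"]) (auto simp: algebra_simps)
qed

lemma closed_span_diff:
  assumes S: "S \<subseteq> L2 M" and f: "f \<in> closed_span M S" and g: "g \<in> closed_span M S"
  shows "(\<lambda>x. f x - g x) \<in> closed_span M S"
  using closed_span_add[OF S f closed_span_cmult[OF S g, of "-1"]] by simp

lemma closed_span_zero: "S \<subseteq> L2 M \<Longrightarrow> (\<lambda>x. 0) \<in> closed_span M S"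
  using fun_span_subset_closed_span fun_span_zero by blast

lemma closed_span_sum:
  assumes "S \<subseteq> L2 M" "\<And>i. i \<in> I \<Longrightarrow> f i \<in> closed_span M S"
  shows "(\<lambda>x. \<Sum>i\<in>I. f i x) \<in> closed_span M S"
  using assms(2)
  by (induction I rule: infinite_finite_induct)
     (auto simp: closed_span_zero[OF assms(1)] closed_span_add[OF assms(1)])

text \<open>Reduces an inclusion between closed spans to a check on generators. It is how the
  multiresolution spaces are compared.\<close>

lemma closed_span_minimal:
  assumes S: "S \<subseteq> L2 M" and T: "T \<subseteq> closed_span M S"
  shows "closed_span M T \<subseteq> closed_span M S"
proof
  fix f
  assume f: "f \<in> closed_span M T"
  have "fun_span T \<subseteq> closed_span M S"
    unfolding fun_span_def using T by (auto intro!: closed_span_sum[OF S] closed_span_cmult[OF S])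
  then show "f \<in> closed_span M S"
    using f unfolding closed_span_def[of M T] by (intro closed_span_limit[OF S]) blast+
qed

text \<open>A bounded linear operator maps a closed span into the closed span of the images. It is
  applied to dilations and to the maps that insert a variable factor into a product of functions,
  which is why linearity is asked for as plain equality of functions.\<close>

lemma closed_span_linear_image:
  assumes S: "S \<subseteq> L2 M" and T: "T \<subseteq> L2 M'" and f: "f \<in> closed_span M S"
    and im: "\<And>b. b \<in> S \<Longrightarrow> A b \<in> closed_span M' T"
    and A: "\<And>f. f \<in> L2 M \<Longrightarrow> A f \<in> L2 M'" "\<And>f. f \<in> L2 M \<Longrightarrow> l2_norm M' (A f) \<le> C * l2_norm M f"
    and diff: "\<And>f g. A (\<lambda>x. f x - g x) = (\<lambda>x. A f x - A g x)"
    and sum: "\<And>B c. finite B \<Longrightarrow> A (\<lambda>x. \<Sum>b\<in>B. c b * b x) = (\<lambda>x. \<Sum>b\<in>B. c b * A b x)"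
  shows "A f \<in> closed_span M' T"
proof -
  have fL: "f \<in> L2 M" using f closed_span_subset_L2 by blast
  show ?thesis
  proof (rule closed_span_limit[OF T A(1)[OF fL]])
    fix e :: real
    assume "e > 0"
    \<comment> \<open>\<open>\<bar>C\<bar> + 1\<close> is positive whatever the sign of
      \<open>C\<close> and still dominates it.\<close>
    then have e: "e / (\<bar>C\<bar> + 1) > 0" by simp
    then obtain g where g: "g \<in> fun_span S" "l2_norm M (\<lambda>x. f x - g x) < e / (\<bar>C\<bar> + 1)"
      using f unfolding closed_span_def by blast
    obtain B c where B: "finite B" "B \<subseteq> S" "g = (\<lambda>x. \<Sum>b\<in>B. c b * b x)"
      using g(1) unfolding fun_span_def by blast
    have gL: "g \<in> L2 M" using g(1) fun_span_subset_L2[OF S] by blast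
    have "A g \<in> closed_span M' T"
      unfolding B(3) sum[OF B(1)] using B(2) im
      by (intro closed_span_sum[OF T] closed_span_cmult[OF T]) auto
    moreover have "l2_norm M' (\<lambda>x. A f x - A g x) < e"
    proof -
      have "l2_norm M' (\<lambda>x. A f x - A g x) \<le> C * l2_norm M (\<lambda>x. f x - g x)"
        unfolding diff[symmetric] by (rule A(2)[OF L2_diff[OF fL gL]])
      also have "\<dots> \<le> (\<bar>C\<bar> + 1) * l2_norm M (\<lambda>x. f x - g x)"
        by (intro mult_right_mono) (auto simp: l2_norm_nonneg)
      also have "\<dots> < (\<bar>C\<bar> + 1) * (e / (\<bar>C\<bar> + 1))"
        using g(2) by (intro mult_strict_left_mono) auto
      finally show ?thesis by simp
    qed
    ultimately show "\<exists>g\<in>closed_span M' T. l2_norm M' (\<lambda>x. A f x - g x) < e" by blast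
  qed
qed

text \<open>Orthogonality to the generators passes to limits by continuity of the inner product,
  which here is extracted from \<open>l2_inner_le\<close>.\<close>

lemma closed_span_orthogonal:
  assumes S: "S \<subseteq> L2 M" and h: "h \<in> L2 M" and orth: "\<And>s. s \<in> S \<Longrightarrow> l2_inner M s h = 0"
    and f: "f \<in> closed_span M S"
  shows "l2_inner M f h = 0"
proof -
  have fL: "f \<in> L2 M"
    using f closed_span_subset_L2 by blast
  \<comment> \<open>The same \<open>e\<close> serves as accuracy of the approximation and as weight
    in \<open>l2_inner_le\<close>: the first term becomes at most e^2 / e.\<close>
  have "cmod (l2_inner M f h) \<le> e * (1 + (l2_norm M h)\<^sup>2)" if "e > 0" for e
  proof -
    obtain g where g: "g \<in> fun_span S" "l2_norm M (\<lambda>x. f x - g x) < e"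
      using f \<open>e > 0\<close> unfolding closed_span_def by blast
    obtain B c where B: "finite B" "B \<subseteq> S" "g = (\<lambda>x. \<Sum>b\<in>B. c b * b x)"
      using g(1) unfolding fun_span_def by blast
    have gL: "g \<in> L2 M"
      using g(1) fun_span_subset_L2[OF S] by blast
    have "l2_inner M g h = (\<Sum>b\<in>B. l2_inner M (\<lambda>x. c b * b x) h)"
      unfolding B(3) using B S by (intro l2_inner_sum_left h L2_cmult) auto
    also have "\<dots> = 0"
      using B(2) orth by (intro sum.neutral) (auto simp: l2_inner_cmult_left)
    finally have "l2_inner M f h = l2_inner M (\<lambda>x. f x - g x) h"
      using l2_inner_diff_left[OF fL gL h] by simp
    also have "cmod \<dots> \<le> (l2_norm M (\<lambda>x. f x - g x))\<^sup>2 / e + e * (l2_norm M h)\<^sup>2"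
      by (intro l2_inner_le L2_diff fL gL h that)
    also have "(l2_norm M (\<lambda>x. f x - g x))\<^sup>2 \<le> e\<^sup>2"
      using g(2) l2_norm_nonneg by (intro power_mono) auto
    finally show ?thesis
      using that by (simp add: power2_eq_square algebra_simps divide_right_mono)
  qed
  then have "cmod (l2_inner M f h) \<le> 0 + e" if "e > 0" for e
    using that[THEN divide_pos_pos, of "1 + (l2_norm M h)\<^sup>2"]
    by (smt (verit) nonzero_mult_div_cancel_right times_divide_eq_left zero_le_power2)
  then have "cmod (l2_inner M f h) \<le> 0"
    by (rule field_le_epsilon)
  then show ?thesis by simp
qed

section \<open>Completeness from a generating family of sets\<close>

lemma indicator_empty_eq_zero: "(indicator {} :: 'a \<Rightarrow> complex) = (\<lambda>x. 0)"
  by (simp add: fun_eq_iff)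

text \<open>The squared distance to a finite partial union is the measure of what is left over,
  which tends to 0 because the whole union has finite measure.\<close>

lemma indicator_UN_in_closed_span:
  fixes B :: "nat \<Rightarrow> 'a set"
  assumes S: "S \<subseteq> L2 M" and B: "disjoint_family B" "\<And>i. B i \<in> sets M"
    "\<And>i. (indicator (B i) :: 'a \<Rightarrow> complex) \<in> closed_span M S"
    and fin: "emeasure M (\<Union>i. B i) < \<infinity>"
  shows "(indicator (\<Union>i. B i) :: 'a \<Rightarrow> complex) \<in> closed_span M S"
proof (rule closed_span_limit[OF S])
  show "indicator (\<Union>i. B i) \<in> L2 M"
    using B fin by (intro L2_indicator) auto
  fix e :: real
  assume "e > 0"
  let ?U = "\<lambda>n. \<Union>i<n. B i"
  have UU: "(\<Union>n. ?U n) = (\<Union>i. B i)" by blast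
  have U: "emeasure M (?U n) < \<infinity>" for n
    by (rule le_less_trans[OF emeasure_mono fin]) (use B in auto)
  have "(\<lambda>n. measure M (?U n)) \<longlonglongrightarrow> measure M (\<Union>n. ?U n)"
  proof (rule Lim_measure_incseq)
    show "incseq ?U" unfolding incseq_def by (auto intro: less_le_trans)
    show "emeasure M (\<Union>n. ?U n) \<noteq> \<infinity>" unfolding UU using fin by simp
  qed (use B in auto)
  then have "(\<lambda>n. measure M (\<Union>i. B i) - measure M (?U n)) \<longlonglongrightarrow> measure M (\<Union>i. B i) - measure M (\<Union>i. B i)"
    unfolding UU by (intro tendsto_intros)
  then have "\<forall>\<^sub>F n in sequentially. measure M (\<Union>i. B i) - measure M (?U n) < e\<^sup>2"
    by (rule order_tendstoD) (use \<open>e > 0\<close> in simp)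
  then obtain n where n: "measure M (\<Union>i. B i) - measure M (?U n) < e\<^sup>2"
    using eventually_happens'[OF sequentially_bot] by blast
  have eq: "(indicator (?U n) x :: complex) = (\<Sum>i<n. indicator (B i) x)" for x
    using B(1) by (intro indicator_UN_disjoint) (auto simp: disjoint_family_on_def)
  have "measure M ((\<Union>i. B i) - ?U n) = measure M (\<Union>i. B i) - measure M (?U n)"
    by (rule measure_Diff) (use B fin in auto)
  moreover have "(LINT x|M. (cmod (indicator (\<Union>i. B i) x - indicator (?U n) x))\<^sup>2) = measure M ((\<Union>i. B i) - ?U n)"
  proof -
    have "(LINT x|M. (cmod (indicator (\<Union>i. B i) x - indicator (?U n) x))\<^sup>2) = (LINT x|M. indicator ((\<Union>i. B i) - ?U n) x)"
      by (rule Bochner_Integration.integral_cong) (auto simp: indicator_def)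
    also have "\<dots> = measure M (((\<Union>i. B i) - ?U n) \<inter> space M)"
      by simp
    also have "((\<Union>i. B i) - ?U n) \<inter> space M = (\<Union>i. B i) - ?U n"
      using sets.sets_into_space[OF B(2)] by blast
    finally show ?thesis .
  qed
  ultimately have "l2_norm M (\<lambda>x. indicator (\<Union>i. B i) x - indicator (?U n) x) < e"
    using n \<open>e > 0\<close> by (simp add: l2_norm_less_iff)
  then show "\<exists>g\<in>closed_span M S. l2_norm M (\<lambda>x. indicator (\<Union>i. B i) x - g x) < e"
    unfolding eq by (intro bexI[of _ "\<lambda>x. \<Sum>i<n. indicator (B i) x"] closed_span_sum[OF S] B) auto
qed

text \<open>A Dynkin argument, run inside one generator of finite measure at a time: the complement
  of a set need not have a square-integrable indicator, but its trace on such a generator does. The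
  traces are then glued along a countable cover.\<close>

lemma indicator_in_closed_span:
  fixes M :: "'a measure"
  assumes S: "S \<subseteq> L2 M"
    and E: "Int_stable E" "E \<subseteq> Pow (space M)" "sets M = sigma_sets (space M) E"
    and EL: "\<And>X. X \<in> E \<Longrightarrow> (indicator X :: 'a \<Rightarrow> complex) \<in> closed_span M S"
    and fin: "\<And>X. X \<in> E \<Longrightarrow> emeasure M X < \<infinity>"
    and C: "countable C" "C \<subseteq> E" "\<Union>C = space M"
    and X: "X \<in> sets M" "emeasure M X < \<infinity>"
  shows "(indicator X :: 'a \<Rightarrow> complex) \<in> closed_span M S"
proof (cases "C = {}")
  case True
  then have "X = {}" using C X sets.sets_into_space by auto
  then show ?thesis using closed_span_zero[OF S] by (simp add: indicator_empty_eq_zero)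
next
  case False
  define A where "A = from_nat_into C"
  have A: "A n \<in> E" for n
    using from_nat_into[OF False] C(2) by (auto simp: A_def)
  have UA: "(\<Union>n. A n) = space M"
    using range_from_nat_into[OF False C(1)] C(3) by (simp add: A_def)
  have sE: "Z \<in> sets M" if "Z \<in> E" for Z
    using that E(3) by auto
  have fin': "emeasure M (Y \<inter> A n) < \<infinity>" if "Y \<in> sets M" for Y n
    by (rule le_less_trans[OF emeasure_mono fin[OF A]]) (use sE A in auto)
  have step: "(indicator (Y \<inter> A n) :: 'a \<Rightarrow> complex) \<in> closed_span M S" if "Y \<in> sets M" for Y n
  proof -
    have "Y \<in> sigma_sets (space M) E" using that E(3) by simp
    with E(1,2) show ?thesis
    proof (induction rule: sigma_sets_induct_disjoint)
      case (basic Y)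
      then show ?case
        using E(1) A by (intro EL) (auto simp: Int_stable_def)
    next
      case empty
      then show ?case using closed_span_zero[OF S] by (simp add: indicator_empty_eq_zero)
    next
      case (compl Y)
      \<comment> \<open>The relative complement within \<open>A n\<close> is a difference of two
        indicators already in the span.\<close>
      have "(\<lambda>x. indicator (A n) x - (indicator (Y \<inter> A n) x :: complex)) \<in> closed_span M S"
        by (intro closed_span_diff[OF S] compl EL A)
      then show ?case
        by (rule closed_span_cong) (auto simp: indicator_def)
    next
      case (union Y)
      have "(indicator (\<Union>i. Y i \<inter> A n) :: 'a \<Rightarrow> complex) \<in> closed_span M S"
      proof (rule indicator_UN_in_closed_span[OF S])
        have *: "Y i \<in> sets M" for i using union(2) E(3) by auto
        then show "Y i \<inter> A n \<in> sets M" for i using sE A by blast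
        show "disjoint_family (\<lambda>i. Y i \<inter> A n)"
          using union(1) by (auto simp: disjoint_family_on_def)
        show "emeasure M (\<Union>i. Y i \<inter> A n) < \<infinity>"
          using fin'[of "\<Union>i. Y i" n] * by (simp add: Int_UN_distrib2)
      qed (use union in auto)
      then show ?case by simp
    qed
  qed
  \<comment> \<open>Disjointifying the cover partitions \<open>X\<close>; each piece lies in a
    single \<open>A n\<close>, where \<open>step\<close> applies.\<close>
  let ?D = "\<lambda>n. X \<inter> disjointed A n"
  have D: "disjointed A n \<in> sets M" for n :: nat
  proof -
    have "range A \<subseteq> sets M" using sE A by auto
    then show ?thesis using sets.range_disjointed_sets by blast
  qed
  have UD: "(\<Union>n. ?D n) = X"
  proof -
    have "(\<Union>n. ?D n) = X \<inter> (\<Union>n. disjointed A n)" by simp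
    also have "\<dots> = X \<inter> space M" by (simp only: UN_disjointed_eq UA)
    also have "\<dots> = X" using sets.sets_into_space[OF X(1)] by (rule Int_absorb2)
    finally show ?thesis .
  qed
  have "(indicator (\<Union>n. ?D n) :: 'a \<Rightarrow> complex) \<in> closed_span M S"
  proof (rule indicator_UN_in_closed_span[OF S])
    show "disjoint_family ?D"
      using disjoint_family_disjointed[of A] by (auto simp: disjoint_family_on_def)
    show "?D i \<in> sets M" for i using X D by blast
    have "?D i = ?D i \<inter> A i" for i using disjointed_subset[of A i] by blast
    then show "indicator (?D i) \<in> closed_span M S" for i
      using step[OF \<open>?D i \<in> sets M\<close>, of i] by metis
    show "emeasure M (\<Union>n. ?D n) < \<infinity>" unfolding UD by (rule X)
  qed
  then show ?thesis unfolding UD .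
qed

text \<open>Simple functions bounded by twice |f| converge to f in mean square by dominated
  convergence, and a simple function is a finite combination of indicators of level sets. The bound
  9|f|^2 comes from |f - s| being at most 3|f|.\<close>

lemma closed_span_eq_L2_of_indicators:
  fixes M :: "'a measure"
  assumes S: "S \<subseteq> L2 M"
    and ind: "\<And>X. X \<in> sets M \<Longrightarrow> emeasure M X < \<infinity> \<Longrightarrow> (indicator X :: 'a \<Rightarrow> complex) \<in> closed_span M S"
  shows "closed_span M S = L2 M"
proof (intro equalityI closed_span_subset_L2 subsetI)
  fix f :: "'a \<Rightarrow> complex"
  assume f: "f \<in> L2 M"
  have fm [measurable]: "f \<in> borel_measurable M" using f by (rule L2_measurable)
  obtain s where s: "\<And>i. simple_function M (s i)" "\<And>x. x \<in> space M \<Longrightarrow> (\<lambda>i. s i x) \<longlonglongrightarrow> f x"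
    "\<And>i x. x \<in> space M \<Longrightarrow> cmod (s i x) \<le> 2 * cmod (f x)"
    using borel_measurable_implies_sequence_metric[OF fm, of 0] unfolding dist_norm
    by (metis diff_zero)
  have sm [measurable]: "s i \<in> borel_measurable M" for i
    using s(1) by (rule borel_measurable_simple_function)
  have int9: "integrable M (\<lambda>x. 9 * (cmod (f x))\<^sup>2)"
    using f by (simp add: L2_def)
  have bd: "(cmod (f x - s i x))\<^sup>2 \<le> 9 * (cmod (f x))\<^sup>2" if "x \<in> space M" for x i
  proof -
    have "cmod (f x - s i x) \<le> 3 * cmod (f x)"
      using norm_triangle_ineq4[of "f x" "s i x"] s(3)[OF that, of i] by simp
    then have "(cmod (f x - s i x))\<^sup>2 \<le> (3 * cmod (f x))\<^sup>2" by (intro power_mono) auto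
    then show ?thesis by (simp add: power_mult_distrib)
  qed
  have "(\<lambda>i. LINT x|M. (cmod (f x - s i x))\<^sup>2) \<longlonglongrightarrow> (LINT x|M. 0)"
  proof (rule integral_dominated_convergence[OF _ _ int9])
    show "AE x in M. (\<lambda>i. (cmod (f x - s i x))\<^sup>2) \<longlonglongrightarrow> 0"
    proof (rule AE_I2)
      fix x assume "x \<in> space M"
      then have "(\<lambda>i. (cmod (f x - s i x))\<^sup>2) \<longlonglongrightarrow> (cmod (f x - f x))\<^sup>2"
        by (intro tendsto_intros s)
      then show "(\<lambda>i. (cmod (f x - s i x))\<^sup>2) \<longlonglongrightarrow> 0" by simp
    qed
  qed (use bd in auto)
  then have lim: "(\<lambda>i. LINT x|M. (cmod (f x - s i x))\<^sup>2) \<longlonglongrightarrow> 0" by simp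
  have sL: "s i \<in> closed_span M S" for i
  proof -
    have img: "finite (s i ` space M)" using s(1) by (rule simple_functionD)
    have meas: "s i -` {y} \<inter> space M \<in> sets M" for y using s(1) by (rule simple_functionD)
    have cs: "(\<lambda>x. y * indicator (s i -` {y} \<inter> space M) x) \<in> closed_span M S" for y
    \<comment> \<open>The level set of 0 may have infinite measure but enters with coefficient 0;
      every other level set has finite measure by Chebyshev's inequality.\<close>
    proof (cases "y = 0")
      case True
      then show ?thesis using closed_span_zero[OF S] by simp
    next
      case False
      have "emeasure M (s i -` {y} \<inter> space M) * ennreal ((cmod y)\<^sup>2) = (\<integral>\<^sup>+x. ennreal ((cmod y)\<^sup>2) * indicator (s i -` {y} \<inter> space M) x \<partial>M)"
        using meas by (subst nn_integral_cmult_indicator) (auto simp: mult.commute)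
      also have "\<dots> \<le> (\<integral>\<^sup>+x. ennreal (9 * (cmod (f x))\<^sup>2) \<partial>M)"
      proof (rule nn_integral_mono)
        fix x assume x: "x \<in> space M"
        have "(cmod (s i x))\<^sup>2 \<le> (2 * cmod (f x))\<^sup>2" using s(3)[OF x] by (intro power_mono) auto
        then have "(cmod (s i x))\<^sup>2 \<le> 4 * (cmod (f x))\<^sup>2"
          by (simp add: power_mult_distrib)
        then have "(cmod (s i x))\<^sup>2 \<le> 9 * (cmod (f x))\<^sup>2"
          using zero_le_power2[of "cmod (f x)"] by linarith
        then show "ennreal ((cmod y)\<^sup>2) * indicator (s i -` {y} \<inter> space M) x \<le> ennreal (9 * (cmod (f x))\<^sup>2)"
          by (auto simp: indicator_def)
      qed
      also have "\<dots> < \<infinity>"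
        using int9 unfolding integrable_iff_bounded by simp
      finally have "emeasure M (s i -` {y} \<inter> space M) * ennreal ((cmod y)\<^sup>2) < \<infinity>" .
      then have "emeasure M (s i -` {y} \<inter> space M) < \<infinity>"
        using False by (auto simp: ennreal_mult_less_top top.not_eq_extremum)
      then show ?thesis
        by (intro closed_span_cmult[OF S] ind meas)
    qed
    have "(\<lambda>x. \<Sum>y\<in>s i ` space M. y * indicator (s i -` {y} \<inter> space M) x) \<in> closed_span M S"
      by (intro closed_span_sum[OF S] cs)
    then show ?thesis
    proof (rule closed_span_cong)
      fix x assume x: "x \<in> space M"
      have "(\<Sum>y\<in>s i ` space M. y * indicator (s i -` {y} \<inter> space M) x) = (\<Sum>y\<in>s i ` space M. if s i x = y then y else 0)"
        using x by (intro sum.cong) (auto simp: indicator_def)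
      also have "\<dots> = s i x"
        using x img by (subst sum.delta') auto
      finally show "(\<Sum>y\<in>s i ` space M. y * indicator (s i -` {y} \<inter> space M) x) = s i x" .
    qed
  qed
  show "f \<in> closed_span M S"
  proof (rule closed_span_limit[OF S f])
    fix e :: real
    assume "e > 0"
    then have "\<forall>\<^sub>F i in sequentially. (LINT x|M. (cmod (f x - s i x))\<^sup>2) < e\<^sup>2"
      by (intro order_tendstoD[OF lim]) simp
    then obtain i where "(LINT x|M. (cmod (f x - s i x))\<^sup>2) < e\<^sup>2"
      using eventually_happens'[OF sequentially_bot] by blast
    then show "\<exists>g\<in>closed_span M S. l2_norm M (\<lambda>x. f x - g x) < e"
      using sL \<open>e > 0\<close> by (intro bexI[of _ "s i"]) (auto simp: l2_norm_less_iff)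
  qed
qed

text \<open>The completeness criterion used four times: for Q_p, the real line, the finite adeles
  and product measures. In each case it remains to approximate the indicators of an
  intersection-stable generator.\<close>

lemma closed_span_eq_L2:
  fixes M :: "'a measure"
  assumes "S \<subseteq> L2 M"
    and "Int_stable E" "E \<subseteq> Pow (space M)" "sets M = sigma_sets (space M) E"
    and "\<And>X. X \<in> E \<Longrightarrow> (indicator X :: 'a \<Rightarrow> complex) \<in> closed_span M S"
    and "\<And>X. X \<in> E \<Longrightarrow> emeasure M X < \<infinity>"
    and "countable C" "C \<subseteq> E" "\<Union>C = space M"
  shows "closed_span M S = L2 M"
  by (rule closed_span_eq_L2_of_indicators[OF assms(1)]) (rule indicator_in_closed_span[OF assms])

section \<open>Arithmetic of p-adic numbers\<close>

lemma padic_abs_0 [simp]: "padic_abs p 0 = 0"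
  by (simp add: padic_abs_def)

lemma padic_abs_nonneg [simp]: "0 \<le> padic_abs p r"
  by (simp add: padic_abs_def)

context
  fixes p :: nat
  assumes p: "prime p"
begin

lemma prime_int_p: "prime (int p)"
  using p by simp

text \<open>\<open>padic_abs\<close> is defined through the reduced fraction; cross multiplication
  and additivity of multiplicities free it from the normal form.\<close>

lemma padic_abs_fraction:
  fixes a b :: int
  assumes "a \<noteq> 0" "b \<noteq> 0"
  shows "padic_abs p (of_int a / of_int b) =
    real p powi (int (multiplicity (int p) b) - int (multiplicity (int p) a))"
proof -
  define r where "r = (of_int a / of_int b :: rat)"
  obtain n d where nd: "quotient_of r = (n, d)" by fastforce
  have d: "d > 0" using quotient_of_denom_pos[OF nd] .
  have r: "r = of_int n / of_int d" using quotient_of_div[OF nd] .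
  have r0: "r \<noteq> 0" using assms by (simp add: r_def)
  then have n0: "n \<noteq> 0" using r by auto
  have "(of_int (a * d) :: rat) = of_int (n * b)"
    using assms d r unfolding r_def by (simp add: field_simps)
  then have "a * d = n * b" by (simp only: of_int_eq_iff)
  then have "multiplicity (int p) a + multiplicity (int p) d = multiplicity (int p) n + multiplicity (int p) b"
    using assms d n0 prime_int_p by (metis less_irrefl prime_elem_multiplicity_mult_distrib prime_imp_prime_elem)
  then have "int (multiplicity (int p) d) - int (multiplicity (int p) n) =
      int (multiplicity (int p) b) - int (multiplicity (int p) a)" by linarith
  then show ?thesis
    using r0 nd by (simp add: padic_abs_def r_def)
qed

lemma rat_fraction_cases:
  obtains "(r::rat) = 0" | a b :: int where "r = of_int a / of_int b" "a \<noteq> 0" "b \<noteq> 0"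
proof (cases "r = 0")
  case False
  obtain n d where nd: "quotient_of r = (n, d)" by fastforce
  have "d > 0" "r = of_int n / of_int d"
    using quotient_of_denom_pos[OF nd] quotient_of_div[OF nd] by auto
  then show ?thesis using False that(2)[of n d] by auto
qed (use that in auto)

lemma padic_abs_mult: "padic_abs p (r * s) = padic_abs p r * padic_abs p s"
proof (cases r rule: rat_fraction_cases)
  case (2 a b)
  note r = 2
  show ?thesis
  proof (cases s rule: rat_fraction_cases)
    case (2 c d)
    have "r * s = of_int (a * c) / of_int (b * d)" using r 2 by simp
    then have "padic_abs p (r * s) = real p powi (int (multiplicity (int p) (b * d)) - int (multiplicity (int p) (a * c)))"
      using r 2 padic_abs_fraction[of "a * c" "b * d"] by simp
    also have "\<dots> = real p powi ((int (multiplicity (int p) b) - int (multiplicity (int p) a)) +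
        (int (multiplicity (int p) d) - int (multiplicity (int p) c)))"
      using r 2 prime_int_p
      by (simp add: prime_elem_multiplicity_mult_distrib prime_imp_prime_elem algebra_simps)
    also have "\<dots> = padic_abs p r * padic_abs p s"
      using r 2 p padic_abs_fraction[of a b] padic_abs_fraction[of c d]
      by (subst power_int_add) (auto simp: prime_gt_0_nat)
    finally show ?thesis .
  qed auto
qed auto

lemma p_power_int_le_iff: "real p powi a \<le> real p powi b \<longleftrightarrow> a \<le> b"
  using prime_gt_1_nat[OF p] power_int_increasing[of a b "real p"] power_int_strict_increasing[of b a "real p"]
  by force

text \<open>The dictionary between size and divisibility, through which all congruence arguments on
  balls pass.\<close>

lemma padic_abs_of_int_le_iff:
  "padic_abs p (of_int a) \<le> real p powi (- int k) \<longleftrightarrow> int p ^ k dvd a"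
proof (cases "a = 0")
  case False
  have "padic_abs p (of_int a) = real p powi (- int (multiplicity (int p) a))"
    using padic_abs_fraction[of a 1] False by simp
  then have "padic_abs p (of_int a) \<le> real p powi (- int k) \<longleftrightarrow> k \<le> multiplicity (int p) a"
    by (simp add: p_power_int_le_iff)
  also have "\<dots> \<longleftrightarrow> int p ^ k dvd a"
    by (rule power_dvd_iff_le_multiplicity[symmetric]) (use False prime_int_p not_prime_unit in blast)+
  finally show ?thesis .
qed auto

lemma padic_abs_1 [simp]: "padic_abs p 1 = 1"
  using padic_abs_fraction[of 1 1] by simp

lemma padic_abs_power: "padic_abs p (r ^ n) = padic_abs p r ^ n"
  by (induction n) (auto simp: padic_abs_mult)

lemma padic_abs_inverse: "padic_abs p (inverse r) = inverse (padic_abs p r)"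
proof (cases "r = 0")
  case False
  then have "padic_abs p r * padic_abs p (inverse r) = 1"
    by (simp flip: padic_abs_mult)
  then show ?thesis by (simp add: inverse_unique)
qed auto

lemma padic_abs_p: "padic_abs p (of_nat p) = inverse (real p)"
proof -
  have "multiplicity (int p) (int p) = 1"
    using prime_int_p by (simp add: prime_elem_multiplicity_eq_zero_iff multiplicity_self)
  then show ?thesis
    using padic_abs_fraction[of "int p" 1] p by (simp add: power_int_minus)
qed

lemma padic_abs_p_power_int: "padic_abs p (of_nat p powi j) = real p powi (- j)"
  by (cases "j \<ge> 0")
     (auto simp: power_int_def padic_abs_power padic_abs_inverse padic_abs_p power_inverse)

lemma padic_abs_minus [simp]: "padic_abs p (- r) = padic_abs p r"
proof -
  have "padic_abs p (-1) = 1"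
    using padic_abs_fraction[of "-1" 1] multiplicity_unit_right[of "-1" "int p"] by simp
  then show ?thesis using padic_abs_mult[of "-1" r] by simp
qed

lemma padic_abs_diff_commute: "padic_abs p (r - s) = padic_abs p (s - r)"
  using padic_abs_minus[of "r - s"] by (simp del: padic_abs_minus)

lemma padic_abs_of_int_le_1: "padic_abs p (of_int a) \<le> 1"
  using padic_abs_of_int_le_iff[of a 0] by simp

lemma padic_abs_add_le: "padic_abs p (r + s) \<le> max (padic_abs p r) (padic_abs p s)"
proof -
  \<comment> \<open>By homogeneity it suffices to compare integers with a common denominator.\<close>
  obtain a b where ab: "r = of_int a / of_int b" "b \<noteq> 0"
    by (cases r rule: rat_fraction_cases) (auto intro: that[of 0 1])
  obtain c d where cd: "s = of_int c / of_int d" "d \<noteq> 0"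
    by (cases s rule: rat_fraction_cases) (auto intro: that[of 0 1])
  define x y where "x = a * d" and "y = c * b"
  define t where "t = (of_int (b * d) :: rat)"
  have t: "t \<noteq> 0" "r = of_int x * inverse t" "s = of_int y * inverse t"
    using ab cd by (auto simp: t_def x_def y_def field_simps)
  have main: "padic_abs p (of_int (x + y)) \<le> max (padic_abs p (of_int x)) (padic_abs p (of_int y))"
  proof (cases "x = 0 \<or> y = 0 \<or> x + y = 0")
    case False
    define m where "m = min (multiplicity (int p) x) (multiplicity (int p) y)"
    have "int p ^ m dvd x" "int p ^ m dvd y"
      by (auto simp: m_def intro: multiplicity_dvd')
    then have "int p ^ m dvd x + y" by simp
    then have le: "padic_abs p (of_int (x + y)) \<le> real p powi (- int m)"
      by (simp only: padic_abs_of_int_le_iff)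
    have "padic_abs p (of_int x) = real p powi (- int (multiplicity (int p) x))"
         "padic_abs p (of_int y) = real p powi (- int (multiplicity (int p) y))"
      using padic_abs_fraction[of x 1] padic_abs_fraction[of y 1] False by auto
    then show ?thesis using le by (auto simp: m_def min_def max_def split: if_splits)
  next
    case True
    have "padic_abs p (of_int x) \<ge> 0" by simp
    then show ?thesis using True by (auto simp del: padic_abs_nonneg of_int_add)
  qed
  have "padic_abs p (r + s) = padic_abs p (of_int (x + y)) * padic_abs p (inverse t)"
    unfolding padic_abs_mult[symmetric] using t by (simp add: distrib_right)
  also have "\<dots> \<le> max (padic_abs p (of_int x)) (padic_abs p (of_int y)) * padic_abs p (inverse t)"
    by (intro mult_right_mono main) auto
  also have "\<dots> = max (padic_abs p r) (padic_abs p s)"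
    unfolding t padic_abs_mult by (simp add: max_mult_distrib_right)
  finally show ?thesis .
qed

lemma padic_abs_triangle: "padic_abs p (r + s) \<le> padic_abs p r + padic_abs p s"
  using padic_abs_add_le[of r s] padic_abs_nonneg[of p r] padic_abs_nonneg[of p s] by linarith

lemma padic_abs_diff_abs: "\<bar>padic_abs p r - padic_abs p s\<bar> \<le> padic_abs p (r - s)"
  using padic_abs_triangle[of "r - s" s] padic_abs_triangle[of "s - r" r]
    padic_abs_diff_commute[of r s] by simp

text \<open>A p-integral rational has a reduced denominator prime to p, hence invertible modulo p^g;
  the numerator times this inverse, reduced modulo p^g, is the required residue.\<close>

lemma padic_integral_approx:
  assumes "padic_abs p u \<le> 1"
  shows "\<exists>m<p ^ g. padic_abs p (u - of_nat m) \<le> real p powi (- int g)"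
proof -
  obtain a b :: int where ab: "u = of_int a / of_int b" "b \<noteq> 0" "coprime a b"
  proof -
    obtain n d where nd: "quotient_of u = (n, d)" by fastforce
    then show ?thesis
      using quotient_of_denom_pos[OF nd] quotient_of_div[OF nd] quotient_of_coprime[OF nd]
      by (intro that[of n d]) auto
  qed
  \<comment> \<open>If p divided the denominator it could not divide the numerator, and the absolute
    value would be at least p.\<close>
  have "\<not> int p dvd b"
  proof
    assume pb: "int p dvd b"
    then have "\<not> int p dvd a"
      using ab(3) prime_int_p by (metis coprime_common_divisor not_prime_unit)
    then have "a \<noteq> 0" "multiplicity (int p) a = 0" 
      by (auto simp: not_dvd_imp_multiplicity_0)
    moreover have "multiplicity (int p) b \<ge> 1"
      using pb ab(2) prime_int_p by (metis One_nat_def Suc_leI multiplicity_gt_zero_iff not_prime_unit)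
    ultimately have "padic_abs p u \<ge> real p powi 1"
      unfolding ab(1) padic_abs_fraction[OF \<open>a \<noteq> 0\<close> ab(2)]
      using prime_gt_1_nat[OF p] by (intro power_int_increasing) auto
    then show False using assms prime_gt_1_nat[OF p] by simp
  qed
  then have cop: "coprime b (int p ^ g)"
    using prime_int_p by (metis coprime_commute coprime_power_left_iff prime_imp_coprime)
  then obtain c where c: "[b * c = 1] (mod int p ^ g)"
    using cong_solve_coprime_int by blast
  define m where "m = nat ((a * c) mod int p ^ g)"
  have pg: "int p ^ g > 0" using p by (simp add: prime_gt_0_nat)
  have m: "int m = (a * c) mod int p ^ g" using pg by (simp add: m_def)
  have "m < p ^ g" 
  proof -
    have "int m < int p ^ g" unfolding m using pg by (rule pos_mod_bound)
    then show ?thesis by (metis of_nat_less_iff of_nat_power)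
  qed
  have "[int m * b = a * (b * c)] (mod int p ^ g)"
    unfolding m cong_def 
    by (metis mod_mult_left_eq mult.assoc mult.commute)
  also have "[a * (b * c) = a * 1] (mod int p ^ g)"
    using c by (rule cong_scalar_left)
  finally have "int p ^ g dvd a - int m * b"
    unfolding cong_iff_dvd_diff by (simp add: dvd_diff_commute)
  then have "padic_abs p (of_int (a - int m * b)) \<le> real p powi (- int g)"
    by (simp only: padic_abs_of_int_le_iff)
  moreover have "padic_abs p (of_int b) = 1"
    using padic_abs_fraction[of b 1] ab(2) \<open>\<not> int p dvd b\<close> by (simp add: not_dvd_imp_multiplicity_0)
  moreover have "of_int (a - int m * b) = (u - of_nat m) * (of_int b :: rat)"
    using ab by (simp add: field_simps)
  ultimately have "padic_abs p (u - of_nat m) \<le> real p powi (- int g)"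
    by (simp add: padic_abs_mult)
  then show ?thesis using \<open>m < p ^ g\<close> by blast
qed

end

section \<open>The completion: Cauchy sequences modulo null sequences\<close>

lemma padic_cauchy_ring_simps:
  "s \<in> carrier (padic_cauchy_ring p) \<longleftrightarrow> (\<forall>e>0. \<exists>N. \<forall>m\<ge>N. \<forall>n\<ge>N. padic_abs p (s m - s n) < e)"
  "s \<otimes>\<^bsub>padic_cauchy_ring p\<^esub> t = (\<lambda>n. s n * t n)"
  "s \<oplus>\<^bsub>padic_cauchy_ring p\<^esub> t = (\<lambda>n. s n + t n)"
  "\<one>\<^bsub>padic_cauchy_ring p\<^esub> = (\<lambda>n. 1)"
  "\<zero>\<^bsub>padic_cauchy_ring p\<^esub> = (\<lambda>n. 0)"
  by (auto simp: padic_cauchy_ring_def)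

context
  fixes p :: nat
  assumes p: "prime p"
begin

lemma padic_cauchy_abs_convergent:
  assumes "s \<in> carrier (padic_cauchy_ring p)"
  shows "convergent (\<lambda>n. padic_abs p (s n))"
  unfolding Cauchy_convergent_iff[symmetric]
proof (rule metric_CauchyI)
  fix e :: real
  assume "e > 0"
  then obtain N where "\<And>m n. m \<ge> N \<Longrightarrow> n \<ge> N \<Longrightarrow> padic_abs p (s m - s n) < e"
    using assms unfolding padic_cauchy_ring_simps by blast
  then show "\<exists>N. \<forall>m\<ge>N. \<forall>n\<ge>N. dist (padic_abs p (s m)) (padic_abs p (s n)) < e"
    unfolding dist_real_def using padic_abs_diff_abs[OF p] by (meson le_less_trans)
qed

lemma padic_cauchy_bounded:
  assumes "s \<in> carrier (padic_cauchy_ring p)"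
  obtains C where "C > 0" "\<And>n. padic_abs p (s n) \<le> C"
proof -
  have "Bseq (\<lambda>n. padic_abs p (s n))"
    using padic_cauchy_abs_convergent[OF assms] by (rule convergent_imp_Bseq)
  then show ?thesis
    using that unfolding Bseq_def by auto
qed

lemma padic_const_cauchy: "(\<lambda>n. r) \<in> carrier (padic_cauchy_ring p)"
  by (simp add: padic_cauchy_ring_simps)

lemma padic_cauchy_minus:
  assumes "s \<in> carrier (padic_cauchy_ring p)"
  shows "(\<lambda>n. - s n) \<in> carrier (padic_cauchy_ring p)"
  using assms padic_abs_diff_commute[OF p] by (simp add: padic_cauchy_ring_simps)

lemma padic_cauchy_add:
  assumes "s \<in> carrier (padic_cauchy_ring p)" "t \<in> carrier (padic_cauchy_ring p)"
  shows "(\<lambda>n. s n + t n) \<in> carrier (padic_cauchy_ring p)"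
  unfolding padic_cauchy_ring_simps
proof (intro allI impI)
  fix e :: real
  assume "e > 0"
  obtain N where N: "\<And>m n. m \<ge> N \<Longrightarrow> n \<ge> N \<Longrightarrow> padic_abs p (s m - s n) < e"
    using assms(1) \<open>e > 0\<close> unfolding padic_cauchy_ring_simps by blast
  obtain M where M: "\<And>m n. m \<ge> M \<Longrightarrow> n \<ge> M \<Longrightarrow> padic_abs p (t m - t n) < e"
    using assms(2) \<open>e > 0\<close> unfolding padic_cauchy_ring_simps by blast
  have "padic_abs p (s m + t m - (s n + t n)) < e" if "m \<ge> max N M" "n \<ge> max N M" for m n
  proof -
    have "padic_abs p ((s m - s n) + (t m - t n)) \<le> max (padic_abs p (s m - s n)) (padic_abs p (t m - t n))"
      by (rule padic_abs_add_le[OF p])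
    also have "\<dots> < e" using N[of m n] M[of m n] that by simp
    finally show ?thesis by (simp add: algebra_simps)
  qed
  then show "\<exists>N. \<forall>m\<ge>N. \<forall>n\<ge>N. padic_abs p (s m + t m - (s n + t n)) < e" by blast
qed

lemma padic_cauchy_mult:
  assumes "s \<in> carrier (padic_cauchy_ring p)" "t \<in> carrier (padic_cauchy_ring p)"
  shows "(\<lambda>n. s n * t n) \<in> carrier (padic_cauchy_ring p)"
  unfolding padic_cauchy_ring_simps
proof (intro allI impI)
  fix e :: real
  assume "e > 0"
  obtain C where C: "C > 0" "\<And>n. padic_abs p (s n) \<le> C"
    using padic_cauchy_bounded[OF assms(1)] by blast
  obtain D where D: "D > 0" "\<And>n. padic_abs p (t n) \<le> D"
    using padic_cauchy_bounded[OF assms(2)] by blast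
  obtain N where N: "\<And>m n. m \<ge> N \<Longrightarrow> n \<ge> N \<Longrightarrow> padic_abs p (s m - s n) < e / D"
    using assms(1) \<open>e > 0\<close> D(1) unfolding padic_cauchy_ring_simps by (meson divide_pos_pos)
  obtain M where M: "\<And>m n. m \<ge> M \<Longrightarrow> n \<ge> M \<Longrightarrow> padic_abs p (t m - t n) < e / C"
    using assms(2) \<open>e > 0\<close> C(1) unfolding padic_cauchy_ring_simps by (meson divide_pos_pos)
  have "padic_abs p (s m * t m - s n * t n) < e" if "m \<ge> max N M" "n \<ge> max N M" for m n
  proof -
    have "padic_abs p (s m * (t m - t n)) < e"
    proof -
      have "padic_abs p (s m) * padic_abs p (t m - t n) \<le> C * padic_abs p (t m - t n)"
        by (intro mult_right_mono C) auto
      also have "\<dots> < e" using M[of m n] that C(1) by (simp add: field_simps)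
      finally show ?thesis by (simp add: padic_abs_mult[OF p])
    qed
    moreover have "padic_abs p ((s m - s n) * t n) < e"
    proof -
      have "padic_abs p (s m - s n) * padic_abs p (t n) \<le> padic_abs p (s m - s n) * D"
        by (intro mult_left_mono D) auto
      also have "\<dots> < e" using N[of m n] that D(1) by (simp add: field_simps)
      finally show ?thesis by (simp add: padic_abs_mult[OF p])
    qed
    ultimately have "padic_abs p (s m * (t m - t n) + (s m - s n) * t n) < e"
      using padic_abs_add_le[OF p] by (meson le_less_trans max_less_iff_conj)
    then show ?thesis by (simp add: algebra_simps)
  qed
  then show "\<exists>N. \<forall>m\<ge>N. \<forall>n\<ge>N. padic_abs p (s m * t m - s n * t n) < e" by blast
qed

lemma padic_cauchy_ring_cring: "cring (padic_cauchy_ring p)"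
proof (rule cringI)
  show "abelian_group (padic_cauchy_ring p)"
  proof (rule abelian_groupI)
    fix x assume x: "x \<in> carrier (padic_cauchy_ring p)"
    show "\<exists>y\<in>carrier (padic_cauchy_ring p). y \<oplus>\<^bsub>padic_cauchy_ring p\<^esub> x = \<zero>\<^bsub>padic_cauchy_ring p\<^esub>"
      by (rule bexI[OF _ padic_cauchy_minus[OF x]]) (simp add: padic_cauchy_ring_simps(2-))
  qed (auto simp: padic_cauchy_ring_simps(2-) padic_cauchy_add padic_const_cauchy algebra_simps)
  show "Group.comm_monoid (padic_cauchy_ring p)"
    by (rule comm_monoidI)
       (auto simp: padic_cauchy_ring_simps(2-) padic_cauchy_mult padic_const_cauchy algebra_simps)
qed (auto simp: padic_cauchy_ring_simps(2-) algebra_simps)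

lemma padic_cauchy_ring_a_inv:
  assumes "s \<in> carrier (padic_cauchy_ring p)"
  shows "\<ominus>\<^bsub>padic_cauchy_ring p\<^esub> s = (\<lambda>n. - s n)"
proof -
  interpret cring "padic_cauchy_ring p" by (rule padic_cauchy_ring_cring)
  show ?thesis
    by (rule minus_equality[OF _ assms padic_cauchy_minus[OF assms]]) (simp add: padic_cauchy_ring_simps(2-))
qed

lemma padic_null_subset: "padic_null p \<subseteq> carrier (padic_cauchy_ring p)"
proof
  fix s assume s: "s \<in> padic_null p"
  show "s \<in> carrier (padic_cauchy_ring p)"
    unfolding padic_cauchy_ring_simps
  proof (intro allI impI)
    fix e :: real
    assume "e > 0"
    then obtain N where N: "\<And>n. n \<ge> N \<Longrightarrow> padic_abs p (s n) < e"
      using s unfolding padic_null_def LIMSEQ_iff by auto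
    have "padic_abs p (s m - s n) < e" if "m \<ge> N" "n \<ge> N" for m n
      using padic_abs_add_le[OF p, of "s m" "- s n"] N[of m] N[of n] that padic_abs_minus[OF p, of "s n"]
      by simp
    then show "\<exists>N. \<forall>m\<ge>N. \<forall>n\<ge>N. padic_abs p (s m - s n) < e" by blast
  qed
qed

lemma padic_null_add:
  assumes "s \<in> padic_null p" "t \<in> padic_null p"
  shows "(\<lambda>n. s n + t n) \<in> padic_null p"
proof -
  have "(\<lambda>n. padic_abs p (s n) + padic_abs p (t n)) \<longlonglongrightarrow> 0 + 0"
    using assms unfolding padic_null_def by (intro tendsto_add) auto
  then have "(\<lambda>n. padic_abs p (s n) + padic_abs p (t n)) \<longlonglongrightarrow> 0" by simp
  then have "(\<lambda>n. padic_abs p (s n + t n)) \<longlonglongrightarrow> 0"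
    by (rule Lim_null_comparison[rotated])
       (simp add: padic_abs_triangle[OF p])
  then show ?thesis by (simp add: padic_null_def)
qed

lemma padic_null_mult:
  assumes "s \<in> carrier (padic_cauchy_ring p)" "t \<in> padic_null p"
  shows "(\<lambda>n. s n * t n) \<in> padic_null p"
proof -
  obtain C where C: "C > 0" "\<And>n. padic_abs p (s n) \<le> C"
    using padic_cauchy_bounded[OF assms(1)] by blast
  have "(\<lambda>n. C * padic_abs p (t n)) \<longlonglongrightarrow> C * 0"
    using assms unfolding padic_null_def by (intro tendsto_mult) auto
  then have "(\<lambda>n. C * padic_abs p (t n)) \<longlonglongrightarrow> 0" by simp
  then have "(\<lambda>n. padic_abs p (s n * t n)) \<longlonglongrightarrow> 0"
    by (rule Lim_null_comparison[rotated])
       (simp add: padic_abs_mult[OF p] C mult_right_mono)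
  then show ?thesis by (simp add: padic_null_def)
qed

lemma padic_null_ideal: "ideal (padic_null p) (padic_cauchy_ring p)"
proof -
  interpret cring "padic_cauchy_ring p" by (rule padic_cauchy_ring_cring)
  show ?thesis
  proof (rule idealI)
    show "subgroup (padic_null p) (add_monoid (padic_cauchy_ring p))"
    proof (rule add.subgroupI)
      show "padic_null p \<noteq> {}"
        using padic_abs_0 by (auto simp: padic_null_def intro!: exI[of _ "\<lambda>_. 0"])
      fix a assume a: "a \<in> padic_null p"
      then have "\<ominus>\<^bsub>padic_cauchy_ring p\<^esub> a = (\<lambda>n. - a n)"
        using padic_cauchy_ring_a_inv padic_null_subset by blast
      also have "\<dots> \<in> padic_null p"
        using a by (simp add: padic_null_def padic_abs_minus[OF p])
      finally show "\<ominus>\<^bsub>padic_cauchy_ring p\<^esub> a \<in> padic_null p" .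
    qed (use padic_null_subset padic_null_add in \<open>auto simp: padic_cauchy_ring_simps(2-)\<close>)
    fix a x assume "a \<in> padic_null p" "x \<in> carrier (padic_cauchy_ring p)"
    then show "x \<otimes>\<^bsub>padic_cauchy_ring p\<^esub> a \<in> padic_null p" "a \<otimes>\<^bsub>padic_cauchy_ring p\<^esub> x \<in> padic_null p"
      using padic_null_mult[of x a] by (simp_all add: padic_cauchy_ring_simps(2-) mult.commute)
  qed (rule ring_axioms)
qed

lemma Qp_cring: "cring (Qp p)"
  unfolding Qp_def by (rule ideal.quotient_is_cring[OF padic_null_ideal padic_cauchy_ring_cring])

abbreviation (input) padic_class :: "(nat \<Rightarrow> rat) \<Rightarrow> padic" where
  "padic_class s \<equiv> padic_null p +>\<^bsub>padic_cauchy_ring p\<^esub> s"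

lemma padic_class_hom: "padic_class \<in> ring_hom (padic_cauchy_ring p) (Qp p)"
  unfolding Qp_def by (rule ideal.rcos_ring_hom[OF padic_null_ideal])

lemma padic_class_add:
  assumes "s \<in> carrier (padic_cauchy_ring p)" "t \<in> carrier (padic_cauchy_ring p)"
  shows "padic_class (\<lambda>n. s n + t n) = padic_class s \<oplus>\<^bsub>Qp p\<^esub> padic_class t"
  using ring_hom_add[OF padic_class_hom assms] unfolding padic_cauchy_ring_simps .

lemma padic_class_mult:
  assumes "s \<in> carrier (padic_cauchy_ring p)" "t \<in> carrier (padic_cauchy_ring p)"
  shows "padic_class (\<lambda>n. s n * t n) = padic_class s \<otimes>\<^bsub>Qp p\<^esub> padic_class t"
  using ring_hom_mult[OF padic_class_hom assms] unfolding padic_cauchy_ring_simps .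

lemma padic_class_zero: "padic_class (\<lambda>n. 0) = \<zero>\<^bsub>Qp p\<^esub>"
  using ring_hom_zero[OF padic_class_hom cring.axioms(1)[OF padic_cauchy_ring_cring] cring.axioms(1)[OF Qp_cring]]
  unfolding padic_cauchy_ring_simps .

lemma padic_class_one: "padic_class (\<lambda>n. 1) = \<one>\<^bsub>Qp p\<^esub>"
  using ring_hom_one[OF padic_class_hom] unfolding padic_cauchy_ring_simps .

lemma padic_class_cases:
  assumes "x \<in> carrier (Qp p)"
  obtains s where "s \<in> carrier (padic_cauchy_ring p)" "x = padic_class s"
  using assms by (auto simp: Qp_def FactRing_def A_RCOSETS_def')

lemma padic_class_mem_iff: "t \<in> padic_class s \<longleftrightarrow> (\<exists>h\<in>padic_null p. t = (\<lambda>n. h n + s n))"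
  by (auto simp: a_r_coset_def' padic_cauchy_ring_simps(2-))

lemma padic_class_self: "s \<in> padic_class s"
  unfolding padic_class_mem_iff
proof (rule bexI)
  show "(\<lambda>n. 0) \<in> padic_null p" by (simp add: padic_null_def)
qed simp

lemma padic_class_closed: "s \<in> carrier (padic_cauchy_ring p) \<Longrightarrow> padic_class s \<in> carrier (Qp p)"
  by (rule ring_hom_closed[OF padic_class_hom])

lemma padic_class_minus:
  assumes "s \<in> carrier (padic_cauchy_ring p)"
  shows "padic_class (\<lambda>n. - s n) = \<ominus>\<^bsub>Qp p\<^esub> padic_class s"
proof -
  interpret K: cring "Qp p" by (rule Qp_cring)
  have "padic_class (\<lambda>n. - s n) \<oplus>\<^bsub>Qp p\<^esub> padic_class s = \<zero>\<^bsub>Qp p\<^esub>"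
    unfolding padic_class_add[OF padic_cauchy_minus[OF assms] assms, symmetric] padic_class_zero[symmetric]
    by simp
  then show ?thesis
    by (rule K.minus_equality[symmetric])
       (intro padic_class_closed padic_cauchy_minus assms)+
qed

text \<open>Representatives differ by a null sequence, so by the reverse triangle inequality their
  absolute values have a common limit. This is what makes the definite description in
  \<open>padic_norm\<close> meaningful.\<close>

lemma padic_norm_class:
  assumes s: "s \<in> carrier (padic_cauchy_ring p)"
  shows "(\<lambda>n. padic_abs p (s n)) \<longlonglongrightarrow> padic_norm p (padic_class s)"
proof -
  obtain L where L: "(\<lambda>n. padic_abs p (s n)) \<longlonglongrightarrow> L"
    using padic_cauchy_abs_convergent[OF s] by (auto simp: convergent_def)
  have all: "(\<lambda>n. padic_abs p (t n)) \<longlonglongrightarrow> L" if t: "t \<in> padic_class s" for t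
  proof -
    obtain h where h: "h \<in> padic_null p" "t = (\<lambda>n. h n + s n)"
      using t[unfolded padic_class_mem_iff] by (rule bexE)
    have "norm (padic_abs p (t n) - padic_abs p (s n)) \<le> padic_abs p (h n)" for n
      using padic_abs_diff_abs[OF p, of "t n" "s n"] by (simp add: h(2))
    moreover have hl: "(\<lambda>n. padic_abs p (h n)) \<longlonglongrightarrow> 0"
      using h(1) by (simp add: padic_null_def)
    ultimately have "(\<lambda>n. padic_abs p (t n) - padic_abs p (s n)) \<longlonglongrightarrow> 0"
      by (intro Lim_null_comparison[OF _ hl] always_eventually allI)
    from tendsto_add[OF this L] show ?thesis by simp
  qed
  have self: "s \<in> padic_class s"
    by (rule padic_class_self)
  have "padic_norm p (padic_class s) = L"
    unfolding padic_norm_def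
    by (rule the_equality) (use all self L LIMSEQ_unique in blast)+
  then show ?thesis using L by simp
qed

lemma padic_norm_nonneg: "x \<in> carrier (Qp p) \<Longrightarrow> 0 \<le> padic_norm p x"
  by (metis LIMSEQ_le_const padic_abs_nonneg padic_class_cases padic_norm_class)

lemma padic_norm_add_le:
  assumes "x \<in> carrier (Qp p)" "y \<in> carrier (Qp p)"
  shows "padic_norm p (x \<oplus>\<^bsub>Qp p\<^esub> y) \<le> max (padic_norm p x) (padic_norm p y)"
proof -
  obtain s where s: "s \<in> carrier (padic_cauchy_ring p)" "x = padic_class s"
    using padic_class_cases[OF assms(1)] by blast
  obtain t where t: "t \<in> carrier (padic_cauchy_ring p)" "y = padic_class t"
    using padic_class_cases[OF assms(2)] by blast
  have "x \<oplus>\<^bsub>Qp p\<^esub> y = padic_class (\<lambda>n. s n + t n)"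
    unfolding s t padic_class_add[OF s(1) t(1)] ..
  then have "(\<lambda>n. padic_abs p (s n + t n)) \<longlonglongrightarrow> padic_norm p (x \<oplus>\<^bsub>Qp p\<^esub> y)"
    using padic_norm_class[OF padic_cauchy_add[OF s(1) t(1)]] by simp
  moreover have "(\<lambda>n. max (padic_abs p (s n)) (padic_abs p (t n))) \<longlonglongrightarrow> max (padic_norm p x) (padic_norm p y)"
    using padic_norm_class s t by (intro tendsto_max) auto
  ultimately show ?thesis
    by (rule LIMSEQ_le) (use padic_abs_add_le[OF p] in blast)
qed

lemma padic_norm_mult:
  assumes "x \<in> carrier (Qp p)" "y \<in> carrier (Qp p)"
  shows "padic_norm p (x \<otimes>\<^bsub>Qp p\<^esub> y) = padic_norm p x * padic_norm p y"
proof -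
  obtain s where s: "s \<in> carrier (padic_cauchy_ring p)" "x = padic_class s"
    using padic_class_cases[OF assms(1)] by blast
  obtain t where t: "t \<in> carrier (padic_cauchy_ring p)" "y = padic_class t"
    using padic_class_cases[OF assms(2)] by blast
  have "x \<otimes>\<^bsub>Qp p\<^esub> y = padic_class (\<lambda>n. s n * t n)"
    unfolding s t padic_class_mult[OF s(1) t(1)] ..
  then have "(\<lambda>n. padic_abs p (s n * t n)) \<longlonglongrightarrow> padic_norm p (x \<otimes>\<^bsub>Qp p\<^esub> y)"
    using padic_norm_class[OF padic_cauchy_mult[OF s(1) t(1)]] by simp
  moreover have "(\<lambda>n. padic_abs p (s n * t n)) \<longlonglongrightarrow> padic_norm p x * padic_norm p y"
    unfolding padic_abs_mult[OF p] using padic_norm_class s t by (intro tendsto_mult) auto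
  ultimately show ?thesis by (rule LIMSEQ_unique)
qed

lemma padic_norm_a_inv:
  assumes "x \<in> carrier (Qp p)"
  shows "padic_norm p (\<ominus>\<^bsub>Qp p\<^esub> x) = padic_norm p x"
proof -
  obtain s where s: "s \<in> carrier (padic_cauchy_ring p)" "x = padic_class s"
    using padic_class_cases[OF assms(1)] by blast
  have "\<ominus>\<^bsub>Qp p\<^esub> x = padic_class (\<lambda>n. - s n)"
    unfolding s padic_class_minus[OF s(1)] ..
  then have "(\<lambda>n. padic_abs p (s n)) \<longlonglongrightarrow> padic_norm p (\<ominus>\<^bsub>Qp p\<^esub> x)"
    using padic_norm_class[OF padic_cauchy_minus[OF s(1)]] by (simp add: padic_abs_minus[OF p])
  then show ?thesis using padic_norm_class[OF s(1)] s(2) LIMSEQ_unique by blast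
qed

lemma padic_norm_eq_0_iff:
  assumes "x \<in> carrier (Qp p)"
  shows "padic_norm p x = 0 \<longleftrightarrow> x = \<zero>\<^bsub>Qp p\<^esub>"
proof -
  obtain s where s: "s \<in> carrier (padic_cauchy_ring p)" "x = padic_class s"
    using padic_class_cases[OF assms(1)] by blast
  have z: "\<zero>\<^bsub>Qp p\<^esub> = padic_null p"
    by (simp add: Qp_def FactRing_def)
  show ?thesis
  proof
    assume "padic_norm p x = 0"
    then have "s \<in> padic_null p"
      using padic_norm_class[OF s(1)] s(2) by (simp add: padic_null_def)
    then show "x = \<zero>\<^bsub>Qp p\<^esub>"
      unfolding z s(2) using padic_null_ideal
      by (meson abelian_subgroup.a_rcos_const abelian_subgroupI3 ideal.axioms(1) padic_cauchy_ring_cring additive_subgroup.a_subgroup cring_def ring_def)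
  next
    assume "x = \<zero>\<^bsub>Qp p\<^esub>"
    moreover have "s \<in> padic_class s"
      by (rule padic_class_self)
    ultimately have "s \<in> padic_null p" using s z by simp
    then show "padic_norm p x = 0"
      using padic_norm_class[OF s(1)] s(2) LIMSEQ_unique by (auto simp: padic_null_def)
  qed
qed

lemma padic_of_rat_closed: "padic_of_rat p r \<in> carrier (Qp p)"
  unfolding padic_of_rat_def by (rule padic_class_closed[OF padic_const_cauchy])

lemma padic_norm_of_rat: "padic_norm p (padic_of_rat p r) = padic_abs p r"
  unfolding padic_of_rat_def
  using padic_norm_class[OF padic_const_cauchy[of r]] LIMSEQ_unique tendsto_const by blast

lemma padic_of_rat_add: "padic_of_rat p (r + s) = padic_of_rat p r \<oplus>\<^bsub>Qp p\<^esub> padic_of_rat p s"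
  unfolding padic_of_rat_def by (rule padic_class_add[OF padic_const_cauchy padic_const_cauchy])

lemma padic_of_rat_mult: "padic_of_rat p (r * s) = padic_of_rat p r \<otimes>\<^bsub>Qp p\<^esub> padic_of_rat p s"
  unfolding padic_of_rat_def by (rule padic_class_mult[OF padic_const_cauchy padic_const_cauchy])

lemma padic_of_rat_minus: "padic_of_rat p (- r) = \<ominus>\<^bsub>Qp p\<^esub> padic_of_rat p r"
  unfolding padic_of_rat_def by (rule padic_class_minus[OF padic_const_cauchy])

lemma padic_of_rat_diff: "padic_of_rat p (r - s) = padic_of_rat p r \<ominus>\<^bsub>Qp p\<^esub> padic_of_rat p s"
  using padic_of_rat_add[of r "- s"] by (simp add: a_minus_def padic_of_rat_minus)

lemma padic_of_rat_1: "padic_of_rat p 1 = \<one>\<^bsub>Qp p\<^esub>"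
  unfolding padic_of_rat_def by (rule padic_class_one)

lemma padic_of_rat_0: "padic_of_rat p 0 = \<zero>\<^bsub>Qp p\<^esub>"
  unfolding padic_of_rat_def by (rule padic_class_zero)

text \<open>A sufficiently late term of a representing Cauchy sequence is a rational approximation
  of its class.\<close>

lemma padic_of_rat_dense:
  assumes "x \<in> carrier (Qp p)" "e > 0"
  shows "\<exists>r. padic_norm p (x \<ominus>\<^bsub>Qp p\<^esub> padic_of_rat p r) < e"
proof -
  obtain s where s: "s \<in> carrier (padic_cauchy_ring p)" "x = padic_class s"
    using padic_class_cases[OF assms(1)] by blast
  \<comment> \<open>Half of \<open>e\<close>, since a limit preserves only weak inequalities while
    the conclusion is strict.\<close>
  obtain N where N: "\<And>m n. m \<ge> N \<Longrightarrow> n \<ge> N \<Longrightarrow> padic_abs p (s m - s n) < e / 2"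
    using s(1) assms(2) unfolding padic_cauchy_ring_simps by (meson half_gt_zero)
  define t where "t = (\<lambda>n. s n + - s N)"
  have t: "t \<in> carrier (padic_cauchy_ring p)"
    unfolding t_def by (intro padic_cauchy_add s padic_const_cauchy)
  have "x \<ominus>\<^bsub>Qp p\<^esub> padic_of_rat p (s N) = x \<oplus>\<^bsub>Qp p\<^esub> padic_of_rat p (- s N)"
    by (simp add: a_minus_def padic_of_rat_minus)
  also have "\<dots> = padic_class t"
    unfolding padic_of_rat_def s(2) t_def padic_class_add[OF s(1) padic_const_cauchy[of "- s N"]] ..
  finally have eq: "x \<ominus>\<^bsub>Qp p\<^esub> padic_of_rat p (s N) = padic_class t" .
  have "padic_norm p (padic_class t) \<le> e / 2"
    by (rule LIMSEQ_le_const2[OF padic_norm_class[OF t]])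
       (use N in \<open>auto simp: t_def intro!: exI[of _ N] less_imp_le\<close>)
  then show ?thesis using assms(2) eq by (intro exI[of _ "s N"]) simp
qed

end

section \<open>Balls\<close>

text \<open>The parameter is the exponent of the radius, not the radius: a larger \<open>k\<close>
  is a smaller ball, and exponent 0 about zero is Z_p.\<close>

definition padic_ball :: "nat \<Rightarrow> padic \<Rightarrow> int \<Rightarrow> padic set" where
  "padic_ball p c k = {x \<in> carrier (Qp p). padic_norm p (x \<ominus>\<^bsub>Qp p\<^esub> c) \<le> real p powi (- k)}"

definition padic_balls :: "nat \<Rightarrow> padic set set" where
  "padic_balls p = {padic_ball p c k | c k. c \<in> carrier (Qp p)}"

lemma padic_ball_subset_carrier: "padic_ball p c k \<subseteq> carrier (Qp p)"
  by (auto simp: padic_ball_def)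

lemma padic_ballsI: "c \<in> carrier (Qp p) \<Longrightarrow> padic_ball p c k \<in> padic_balls p"
  by (auto simp: padic_balls_def)

context
  fixes p :: nat
  assumes p: "prime p"
begin

interpretation K: cring "Qp p"
  by (rule Qp_cring[OF p])

lemma padic_diff_eq_zero_iff:
  assumes "x \<in> carrier (Qp p)" "y \<in> carrier (Qp p)"
  shows "x \<ominus>\<^bsub>Qp p\<^esub> y = \<zero>\<^bsub>Qp p\<^esub> \<longleftrightarrow> x = y"
  using assms by (metis K.a_inv_closed K.add.inv_inv K.minus_equality K.r_neg a_minus_def)

lemma padic_norm_diff_commute:
  assumes "x \<in> carrier (Qp p)" "y \<in> carrier (Qp p)"
  shows "padic_norm p (x \<ominus>\<^bsub>Qp p\<^esub> y) = padic_norm p (y \<ominus>\<^bsub>Qp p\<^esub> x)"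
proof -
  have "x \<ominus>\<^bsub>Qp p\<^esub> y = \<ominus>\<^bsub>Qp p\<^esub> (y \<ominus>\<^bsub>Qp p\<^esub> x)"
    using assms by algebra
  then show ?thesis using padic_norm_a_inv[OF p] assms by simp
qed

lemma padic_norm_diff_le:
  assumes "x \<in> carrier (Qp p)" "y \<in> carrier (Qp p)" "z \<in> carrier (Qp p)"
  shows "padic_norm p (x \<ominus>\<^bsub>Qp p\<^esub> z) \<le> max (padic_norm p (x \<ominus>\<^bsub>Qp p\<^esub> y)) (padic_norm p (y \<ominus>\<^bsub>Qp p\<^esub> z))"
proof -
  have "x \<ominus>\<^bsub>Qp p\<^esub> z = (x \<ominus>\<^bsub>Qp p\<^esub> y) \<oplus>\<^bsub>Qp p\<^esub> (y \<ominus>\<^bsub>Qp p\<^esub> z)"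
    using assms by algebra
  then show ?thesis using padic_norm_add_le[OF p] assms by simp
qed

lemma padic_ball_self: "c \<in> carrier (Qp p) \<Longrightarrow> c \<in> padic_ball p c k"
  using padic_norm_eq_0_iff[OF p, of "\<zero>\<^bsub>Qp p\<^esub>"] padic_diff_eq_zero_iff[of c c]
  by (simp add: padic_ball_def)

lemma padic_ball_subset:
  assumes "c \<in> carrier (Qp p)" "x \<in> padic_ball p c k" "k \<le> l"
  shows "padic_ball p x l \<subseteq> padic_ball p c k"
proof
  fix y assume y: "y \<in> padic_ball p x l"
  have x: "x \<in> carrier (Qp p)" using assms by (simp add: padic_ball_def)
  have "padic_norm p (y \<ominus>\<^bsub>Qp p\<^esub> c) \<le> max (padic_norm p (y \<ominus>\<^bsub>Qp p\<^esub> x)) (padic_norm p (x \<ominus>\<^bsub>Qp p\<^esub> c))"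
    using y x assms by (intro padic_norm_diff_le) (auto simp: padic_ball_def)
  also have "\<dots> \<le> real p powi (- k)"
  proof -
    have "real p powi (- l) \<le> real p powi (- k)"
      using assms(3) p_power_int_le_iff[OF p] by simp
    then show ?thesis using y assms(2) by (auto simp: padic_ball_def)
  qed
  finally show "y \<in> padic_ball p c k" using y by (simp add: padic_ball_def)
qed

lemma padic_ball_commute:
  assumes "c \<in> carrier (Qp p)" "x \<in> padic_ball p c k"
  shows "c \<in> padic_ball p x k"
  using assms padic_norm_diff_commute[of x c] by (simp add: padic_ball_def)

text \<open>Ultrametric balls have no distinguished centre: apply \<open>padic_ball_subset\<close>
  in both directions.\<close>

lemma padic_ball_eq:
  assumes "c \<in> carrier (Qp p)" "x \<in> padic_ball p c k"
  shows "padic_ball p x k = padic_ball p c k"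
proof -
  have "x \<in> carrier (Qp p)" using assms by (simp add: padic_ball_def)
  then show ?thesis
    using padic_ball_subset[OF assms order_refl] padic_ball_subset[OF _ padic_ball_commute[OF assms] order_refl]
    by blast
qed

lemma padic_ball_nested:
  assumes "c \<in> carrier (Qp p)" "d \<in> carrier (Qp p)" "k \<le> l" "padic_ball p c k \<inter> padic_ball p d l \<noteq> {}"
  shows "padic_ball p d l \<subseteq> padic_ball p c k"
proof -
  obtain x where x: "x \<in> padic_ball p c k" "x \<in> padic_ball p d l" using assms(4) by blast
  show ?thesis
    using padic_ball_subset[OF assms(1) x(1) assms(3)] padic_ball_eq[OF assms(2) x(2)] by simp
qed

lemma padic_balls_Int:
  assumes "A \<in> padic_balls p" "B \<in> padic_balls p" "A \<inter> B \<noteq> {}"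
  shows "A \<inter> B \<in> padic_balls p"
proof -
  obtain c k d l where cd: "A = padic_ball p c k" "B = padic_ball p d l" "c \<in> carrier (Qp p)" "d \<in> carrier (Qp p)"
    using assms unfolding padic_balls_def by blast
  then have "A \<subseteq> B \<or> B \<subseteq> A"
    using padic_ball_nested[of c d k l] padic_ball_nested[of d c l k] assms(3) by (cases "k \<le> l") auto
  then show ?thesis using assms by (auto simp: Int_absorb1 Int_absorb2)
qed

text \<open>A rational point within the radius of the centre can replace it. Countability of the
  family of balls rests on this.\<close>

lemma padic_ball_rational_center:
  assumes "c \<in> carrier (Qp p)"
  shows "\<exists>r. padic_ball p c k = padic_ball p (padic_of_rat p r) k"
proof -
  have "real p powi (- k) > 0" using p by (simp add: prime_gt_0_nat)
  then obtain r where "padic_norm p (c \<ominus>\<^bsub>Qp p\<^esub> padic_of_rat p r) < real p powi (- k)"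
    using padic_of_rat_dense[OF p assms] by blast
  then have "c \<in> padic_ball p (padic_of_rat p r) k"
    using assms by (simp add: padic_ball_def)
  then show ?thesis
    using padic_ball_eq[OF padic_of_rat_closed[OF p]] by blast
qed

lemma countable_padic_balls: "countable (padic_balls p)"
proof (rule countable_subset)
  show "padic_balls p \<subseteq> (\<lambda>(r, k). padic_ball p (padic_of_rat p r) k) ` UNIV"
    using padic_ball_rational_center by (fastforce simp: padic_balls_def image_iff)
qed auto

lemma padic_ball_translate:
  assumes "c \<in> carrier (Qp p)" "g \<in> carrier (Qp p)"
  shows "(\<lambda>x. g \<oplus>\<^bsub>Qp p\<^esub> x) ` padic_ball p c k = padic_ball p (g \<oplus>\<^bsub>Qp p\<^esub> c) k"
proof (intro equalityI subsetI)
  fix y assume "y \<in> (\<lambda>x. g \<oplus>\<^bsub>Qp p\<^esub> x) ` padic_ball p c k"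
  then obtain x where x: "x \<in> padic_ball p c k" "y = g \<oplus>\<^bsub>Qp p\<^esub> x" by blast
  then have "x \<in> carrier (Qp p)" by (simp add: padic_ball_def)
  then have "y \<ominus>\<^bsub>Qp p\<^esub> (g \<oplus>\<^bsub>Qp p\<^esub> c) = x \<ominus>\<^bsub>Qp p\<^esub> c"
  proof -
    assume xc: "x \<in> carrier (Qp p)"
    have sub: "z \<ominus>\<^bsub>Qp p\<^esub> (g \<oplus>\<^bsub>Qp p\<^esub> c) = (z \<ominus>\<^bsub>Qp p\<^esub> g) \<ominus>\<^bsub>Qp p\<^esub> c" if "z \<in> carrier (Qp p)" for z
      using assms that by algebra
    have "y \<ominus>\<^bsub>Qp p\<^esub> g = \<ominus>\<^bsub>Qp p\<^esub> g \<oplus>\<^bsub>Qp p\<^esub> (g \<oplus>\<^bsub>Qp p\<^esub> x)"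
      unfolding x(2) using assms(2) xc by (simp add: a_minus_def K.add.m_comm)
    then have "y \<ominus>\<^bsub>Qp p\<^esub> g = x"
      using assms(2) xc by (simp add: K.r_neg1)
    moreover have "y \<ominus>\<^bsub>Qp p\<^esub> (g \<oplus>\<^bsub>Qp p\<^esub> c) = (y \<ominus>\<^bsub>Qp p\<^esub> g) \<ominus>\<^bsub>Qp p\<^esub> c"
      using assms xc x(2) by (intro sub) auto
    ultimately show ?thesis by simp
  qed
  then show "y \<in> padic_ball p (g \<oplus>\<^bsub>Qp p\<^esub> c) k"
    using x assms by (simp add: padic_ball_def)
next
  fix y assume y: "y \<in> padic_ball p (g \<oplus>\<^bsub>Qp p\<^esub> c) k"
  then have yc: "y \<in> carrier (Qp p)" by (simp add: padic_ball_def)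
  have "(y \<ominus>\<^bsub>Qp p\<^esub> g) \<ominus>\<^bsub>Qp p\<^esub> c = y \<ominus>\<^bsub>Qp p\<^esub> (g \<oplus>\<^bsub>Qp p\<^esub> c)" "y = g \<oplus>\<^bsub>Qp p\<^esub> (y \<ominus>\<^bsub>Qp p\<^esub> g)"
    using assms yc by algebra+
  moreover from this(1) have "y \<ominus>\<^bsub>Qp p\<^esub> g \<in> padic_ball p c k"
    using y yc assms by (simp add: padic_ball_def)
  ultimately show "y \<in> (\<lambda>x. g \<oplus>\<^bsub>Qp p\<^esub> x) ` padic_ball p c k" by blast
qed

text \<open>Multiplication by p^j is invertible and scales the norm by p^(-j), so it shifts the
  exponent of a ball by j.\<close>

lemma padic_ball_dilate:
  assumes "c \<in> carrier (Qp p)" "x \<in> carrier (Qp p)"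
  shows "padic_of_rat p (of_nat p powi j) \<otimes>\<^bsub>Qp p\<^esub> x \<in> padic_ball p c k \<longleftrightarrow>
         x \<in> padic_ball p (padic_of_rat p (of_nat p powi (- j)) \<otimes>\<^bsub>Qp p\<^esub> c) (k - j)"
proof -
  let ?u = "padic_of_rat p (of_nat p powi j)" and ?v = "padic_of_rat p (of_nat p powi (- j))"
  have p0: "p > 0" using p by (simp add: prime_gt_0_nat)
  have uv: "?u \<in> carrier (Qp p)" "?v \<in> carrier (Qp p)" "?u \<otimes>\<^bsub>Qp p\<^esub> ?v = \<one>\<^bsub>Qp p\<^esub>"
    using p0 by (simp_all add: padic_of_rat_closed[OF p] padic_of_rat_mult[OF p, symmetric]
        power_int_minus padic_of_rat_1[OF p])
  have "?u \<otimes>\<^bsub>Qp p\<^esub> (x \<ominus>\<^bsub>Qp p\<^esub> ?v \<otimes>\<^bsub>Qp p\<^esub> c) = ?u \<otimes>\<^bsub>Qp p\<^esub> x \<ominus>\<^bsub>Qp p\<^esub> (?u \<otimes>\<^bsub>Qp p\<^esub> ?v) \<otimes>\<^bsub>Qp p\<^esub> c"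
    using uv(1,2) assms by algebra
  then have "?u \<otimes>\<^bsub>Qp p\<^esub> x \<ominus>\<^bsub>Qp p\<^esub> c = ?u \<otimes>\<^bsub>Qp p\<^esub> (x \<ominus>\<^bsub>Qp p\<^esub> ?v \<otimes>\<^bsub>Qp p\<^esub> c)"
    using uv assms by simp
  then have "padic_norm p (?u \<otimes>\<^bsub>Qp p\<^esub> x \<ominus>\<^bsub>Qp p\<^esub> c) = real p powi (- j) * padic_norm p (x \<ominus>\<^bsub>Qp p\<^esub> ?v \<otimes>\<^bsub>Qp p\<^esub> c)"
    using uv assms by (simp add: padic_norm_mult[OF p] padic_norm_of_rat[OF p] padic_abs_p_power_int[OF p])
  moreover have "real p powi (- k) = real p powi (- j) * real p powi (- (k - j))"
    using p0 by (subst power_int_add[symmetric]) auto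
  ultimately show ?thesis
    using uv assms p0 by (simp add: padic_ball_def)
qed

text \<open>The children are the cosets of p^(k+1) Z_p in p^k Z_p, moved to \<open>c\<close>; the
  index \<open>i\<close> is the digit of x - c at the place p^k.\<close>

lemma padic_ball_children:
  fixes k :: int
  assumes "c \<in> carrier (Qp p)"
  defines "d \<equiv> \<lambda>i. c \<oplus>\<^bsub>Qp p\<^esub> padic_of_rat p (of_nat i * of_nat p powi k)"
  shows "padic_ball p c k = (\<Union>i<p. padic_ball p (d i) (k + 1))"
    and "disjoint_family_on (\<lambda>i. padic_ball p (d i) (k + 1)) {..<p}"
proof -
  have p0: "p > 0" using p by (simp add: prime_gt_0_nat)
  have dc: "d i \<in> carrier (Qp p)" for i
    using assms by (simp add: d_def padic_of_rat_closed[OF p])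
  have abs_i: "padic_abs p (of_nat i) \<le> 1" for i
    using padic_abs_of_int_le_1[OF p, of "int i"] by simp
  have d_in: "d i \<in> padic_ball p c k" for i
  proof -
    have "d i \<ominus>\<^bsub>Qp p\<^esub> c = padic_of_rat p (of_nat i * of_nat p powi k)"
      using assms(1) padic_of_rat_closed[OF p, of "of_nat i * of_nat p powi k"] unfolding d_def by algebra
    then have "padic_norm p (d i \<ominus>\<^bsub>Qp p\<^esub> c) \<le> 1 * real p powi (- k)"
      using mult_right_mono[OF abs_i[of i], of "real p powi (- k)"]
      by (simp add: padic_norm_of_rat[OF p] padic_abs_mult[OF p] padic_abs_p_power_int[OF p])
    then show ?thesis using dc by (simp add: padic_ball_def)
  qed
  have "x \<in> (\<Union>i<p. padic_ball p (d i) (k + 1))" if x: "x \<in> padic_ball p c k" for x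
  proof -
    have xc: "x \<in> carrier (Qp p)" using x by (simp add: padic_ball_def)
    \<comment> \<open>A rational \<open>r\<close> close enough to x - c has the same digit at the
      place p^k, so the digit may be computed from a rational number.\<close>
    have "real p powi (- (k + 1)) > 0" using p0 by simp
    then obtain r where r: "padic_norm p ((x \<ominus>\<^bsub>Qp p\<^esub> c) \<ominus>\<^bsub>Qp p\<^esub> padic_of_rat p r) < real p powi (- (k + 1))"
      using padic_of_rat_dense[OF p, of "x \<ominus>\<^bsub>Qp p\<^esub> c"] xc assms(1) by blast
    have rc: "padic_of_rat p r \<in> carrier (Qp p)" by (rule padic_of_rat_closed[OF p])
    have lt: "real p powi (- (k + 1)) \<le> real p powi (- k)"
      by (simp add: p_power_int_le_iff[OF p])
    have "padic_norm p (padic_of_rat p r \<ominus>\<^bsub>Qp p\<^esub> \<zero>\<^bsub>Qp p\<^esub>) \<le>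
      max (padic_norm p (padic_of_rat p r \<ominus>\<^bsub>Qp p\<^esub> (x \<ominus>\<^bsub>Qp p\<^esub> c))) (padic_norm p ((x \<ominus>\<^bsub>Qp p\<^esub> c) \<ominus>\<^bsub>Qp p\<^esub> \<zero>\<^bsub>Qp p\<^esub>))"
      using rc xc assms(1) by (intro padic_norm_diff_le) auto
    also have "\<dots> \<le> real p powi (- k)"
      using r lt x padic_norm_diff_commute[OF rc, of "x \<ominus>\<^bsub>Qp p\<^esub> c"] xc assms(1)
      by (simp add: a_minus_def padic_ball_def)
    finally have "padic_abs p r \<le> real p powi (- k)"
      using rc by (simp add: a_minus_def padic_norm_of_rat[OF p])
    \<comment> \<open>Rescaling by p^(-k) makes \<open>r\<close> p-integral; its residue modulo p is
      the digit.\<close>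
    then have "padic_abs p (r * of_nat p powi (- k)) \<le> real p powi (- k) * real p powi k"
      by (simp add: padic_abs_mult[OF p] padic_abs_p_power_int[OF p] mult_right_mono)
    also have "\<dots> = 1" using p0 by (simp add: power_int_minus)
    finally obtain i where i: "i < p" "padic_abs p (r * of_nat p powi (- k) - of_nat i) \<le> real p powi (-1)"
      using padic_integral_approx[OF p, of "r * of_nat p powi (- k)" 1] by auto
    have "r - of_nat i * of_nat p powi k = (r * of_nat p powi (- k) - of_nat i) * of_nat p powi k"
      using p0 by (simp add: power_int_minus field_simps)
    then have "padic_abs p (r - of_nat i * of_nat p powi k) \<le> real p powi (-1) * real p powi (- k)"
      using i(2) by (simp add: padic_abs_mult[OF p] padic_abs_p_power_int[OF p] mult_right_mono)
    also have "\<dots> = real p powi (- 1 + - k)"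
      using p0 by (subst power_int_add) auto
    also have "- 1 + - k = - (k + 1)" by simp
    finally have ri: "padic_norm p (padic_of_rat p r \<ominus>\<^bsub>Qp p\<^esub> padic_of_rat p (of_nat i * of_nat p powi k)) \<le> real p powi (- (k + 1))"
      by (simp add: padic_of_rat_diff[OF p, symmetric] padic_norm_of_rat[OF p])
    have "padic_norm p ((x \<ominus>\<^bsub>Qp p\<^esub> c) \<ominus>\<^bsub>Qp p\<^esub> padic_of_rat p (of_nat i * of_nat p powi k)) \<le> real p powi (- (k + 1))"
      using padic_norm_diff_le[of "x \<ominus>\<^bsub>Qp p\<^esub> c" "padic_of_rat p r" "padic_of_rat p (of_nat i * of_nat p powi k)"]
        r ri xc assms(1) padic_of_rat_closed[OF p] by simp
    moreover have "(x \<ominus>\<^bsub>Qp p\<^esub> c) \<ominus>\<^bsub>Qp p\<^esub> padic_of_rat p (of_nat i * of_nat p powi k) = x \<ominus>\<^bsub>Qp p\<^esub> d i"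
      using xc assms(1) padic_of_rat_closed[OF p, of "of_nat i * of_nat p powi k"] unfolding d_def by algebra
    ultimately show ?thesis using i(1) xc by (auto simp: padic_ball_def)
  qed
  moreover have "padic_ball p (d i) (k + 1) \<subseteq> padic_ball p c k" for i
    using padic_ball_subset[OF assms(1) d_in[of i]] by simp
  ultimately show "padic_ball p c k = (\<Union>i<p. padic_ball p (d i) (k + 1))" by blast
  show "disjoint_family_on (\<lambda>i. padic_ball p (d i) (k + 1)) {..<p}"
    unfolding disjoint_family_on_def
  proof (intro ballI impI, rule ccontr)
    fix i j assume ij: "i \<in> {..<p}" "j \<in> {..<p}" "i \<noteq> j"
      "padic_ball p (d i) (k + 1) \<inter> padic_ball p (d j) (k + 1) \<noteq> {}"
    \<comment> \<open>Two children that meet coincide, so their centres differ by at most the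
      smaller radius; cancelling p^k leaves i congruent to j modulo p.\<close>
    have "d i \<in> padic_ball p (d j) (k + 1)"
      using padic_ball_nested[OF dc dc order_refl, of j "k + 1" i] ij(4) padic_ball_self[OF dc, of i "k + 1"] by blast
    moreover have "d i \<ominus>\<^bsub>Qp p\<^esub> d j = padic_of_rat p ((of_nat i - of_nat j) * of_nat p powi k)"
    proof -
      have "d i \<ominus>\<^bsub>Qp p\<^esub> d j = padic_of_rat p (of_nat i * of_nat p powi k) \<ominus>\<^bsub>Qp p\<^esub> padic_of_rat p (of_nat j * of_nat p powi k)"
        using assms(1) padic_of_rat_closed[OF p, of "of_nat i * of_nat p powi k"]
          padic_of_rat_closed[OF p, of "of_nat j * of_nat p powi k"] unfolding d_def by algebra
      then show ?thesis by (simp add: padic_of_rat_diff[OF p, symmetric] left_diff_distrib)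
    qed
    ultimately have "padic_abs p (of_nat i - of_nat j) * real p powi (- k) \<le> real p powi (- (k + 1))"
      by (simp add: padic_ball_def padic_norm_of_rat[OF p] padic_abs_mult[OF p] padic_abs_p_power_int[OF p])
    also have "- (k + 1) = - int 1 + - k" by simp
    also have "real p powi \<dots> = real p powi (- int 1) * real p powi (- k)"
      using p0 by (subst power_int_add) auto
    finally have "padic_abs p (of_int (int i - int j)) \<le> real p powi (- int 1)"
      using p0 by (simp add: mult_le_cancel_right)
    then have "int p ^ 1 dvd int i - int j"
      by (simp only: padic_abs_of_int_le_iff[OF p])
    then have "[int i = int j] (mod int p)" by (simp add: cong_iff_dvd_diff)
    then have "i mod p = j mod p" unfolding cong_def by (metis of_nat_eq_iff zmod_int)
    then show False using ij by simp
  qed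
qed

text \<open>Multiplication by p^g turns a string of g fractional digits into an ordinary base-p
  expansion, so the elements become fractions m / p^g below 1. Existence and uniqueness of
  representatives modulo Z_p are proved in this form.\<close>

lemma Ip_eq: "Ip p = {padic_of_rat p (of_nat m / of_nat p ^ g) | m g. m < p ^ g}"
proof -
  have p0: "p > 0" using p by (simp add: prime_gt_0_nat)
  have 1: "\<exists>m<p ^ g. (\<Sum>i=1..g. of_nat (d i) / of_nat p ^ i :: rat) = of_nat m / of_nat p ^ g"
    if "\<forall>i. d i < p" for d g
  proof (induction g)
    case (Suc g)
    then obtain m where m: "m < p ^ g" "(\<Sum>i=1..g. of_nat (d i) / of_nat p ^ i :: rat) = of_nat m / of_nat p ^ g"
      by blast
    have "m * p + d (Suc g) < (m + 1) * p" using that by simp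
    also have "\<dots> \<le> p ^ g * p" using m(1) by (intro mult_right_mono) auto
    finally have "m * p + d (Suc g) < p ^ Suc g" by (simp add: mult.commute)
    moreover have "(\<Sum>i=1..Suc g. of_nat (d i) / of_nat p ^ i :: rat) = of_nat (m * p + d (Suc g)) / of_nat p ^ Suc g"
      using m(2) p0 by (simp add: field_simps)
    ultimately show ?case by blast
  qed auto
  have shift: "of_nat a / of_nat p ^ g + of_nat b / of_nat p ^ Suc g = (of_nat (a * p + b) / of_nat p ^ Suc g :: rat)" for a b g
    using p0 by (simp add: field_simps)
  have 2: "\<exists>d. (\<forall>i. d i < p) \<and> (\<Sum>i=1..g. of_nat (d i) / of_nat p ^ i :: rat) = of_nat m / of_nat p ^ g"
    if "m < p ^ g" for m g
    using that
  proof (induction g arbitrary: m)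
    case 0
    then show ?case using p0 by (intro exI[of _ "\<lambda>_. 0"]) auto
  next
    case (Suc g)
    have "m div p < p ^ g"
      using Suc.prems by (simp add: less_mult_imp_div_less mult.commute)
    then obtain d where d: "\<forall>i. d i < p" "(\<Sum>i=1..g. of_nat (d i) / of_nat p ^ i :: rat) = of_nat (m div p) / of_nat p ^ g"
      using Suc.IH by blast
    \<comment> \<open>The digit at the last fractional place g + 1 is the least significant digit of
      \<open>m\<close>; the earlier ones come from the quotient.\<close>
    let ?d = "d(Suc g := m mod p)"
    have "(\<Sum>i=1..Suc g. of_nat (?d i) / of_nat p ^ i :: rat) = (\<Sum>i=1..g. of_nat (d i) / of_nat p ^ i) + of_nat (m mod p) / of_nat p ^ Suc g"
      by (auto intro!: sum.cong)
    also have "\<dots> = of_nat (m div p * p + m mod p) / of_nat p ^ Suc g"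
      unfolding d(2) by (rule shift)
    also have "m div p * p + m mod p = m" by simp
    finally show ?case using d(1) p0 by (intro exI[of _ ?d]) auto
  qed
  show ?thesis
  proof (intro equalityI subsetI)
    fix x assume "x \<in> Ip p"
    then obtain g d where "\<forall>i. d i < p" "x = padic_of_rat p (\<Sum>i=1..g. of_nat (d i) / of_nat p ^ i)"
      unfolding Ip_def by blast
    then show "x \<in> {padic_of_rat p (of_nat m / of_nat p ^ g) | m g. m < p ^ g}"
      using 1[of d g] by fastforce
  next
    fix x assume "x \<in> {padic_of_rat p (of_nat m / of_nat p ^ g) | m g. m < p ^ g}"
    then obtain m g where mg: "m < p ^ g" "x = padic_of_rat p (of_nat m / of_nat p ^ g)" by blast
    obtain d where "\<forall>i. d i < p" "(\<Sum>i=1..g. of_nat (d i) / of_nat p ^ i :: rat) = of_nat m / of_nat p ^ g"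
      using 2[OF mg(1)] by blast
    then show "x \<in> Ip p"
      unfolding Ip_def mg(2) by (auto intro!: exI[of _ g] exI[of _ d])
  qed
qed

lemma Ip_subset: "Ip p \<subseteq> carrier (Qp p)"
  by (auto simp: Ip_def padic_of_rat_closed[OF p])

lemma zero_in_Ip: "\<zero>\<^bsub>Qp p\<^esub> \<in> Ip p"
proof -
  have "padic_of_rat p (of_nat 0 / of_nat p ^ 0) \<in> Ip p"
    unfolding Ip_eq by (intro CollectI exI[of _ 0] exI[of _ "0::nat"] conjI refl) simp
  then show ?thesis using padic_of_rat_0[OF p] by simp
qed

text \<open>Up to an integral error \<open>x\<close> is rational; a power p^g makes that rational
  p-integral, and its residue modulo p^g, divided by p^g again, is the fractional part.\<close>

lemma Ip_exists:
  assumes "x \<in> carrier (Qp p)"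
  shows "\<exists>a\<in>Ip p. x \<in> padic_ball p a 0"
proof -
  have p0: "p > 0" using p by (simp add: prime_gt_0_nat)
  obtain r where r: "padic_norm p (x \<ominus>\<^bsub>Qp p\<^esub> padic_of_rat p r) < 1"
    using padic_of_rat_dense[OF p assms, of 1] by auto
  obtain g where g: "padic_abs p (r * of_nat p ^ g) \<le> 1"
  proof -
    obtain g where "padic_abs p r < real p ^ g"
      using real_arch_pow[of "real p"] prime_gt_1_nat[OF p] by fastforce
    then have "padic_abs p r * inverse (real p) ^ g \<le> 1"
      using p0 by (simp add: power_inverse field_simps)
    then show ?thesis
      by (intro that[of g]) (simp add: padic_abs_mult[OF p] padic_abs_power[OF p] padic_abs_p[OF p])
  qed
  obtain m where m: "m < p ^ g" "padic_abs p (r * of_nat p ^ g - of_nat m) \<le> real p powi (- int g)"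
    using padic_integral_approx[OF p g] by blast
  have "r - of_nat m / of_nat p ^ g = (r * of_nat p ^ g - of_nat m) * of_nat p powi (- int g)"
    using p0 by (simp add: power_int_minus field_simps)
  then have "padic_abs p (r - of_nat m / of_nat p ^ g) = padic_abs p (r * of_nat p ^ g - of_nat m) * real p powi (int g)"
    by (simp only: padic_abs_mult[OF p] padic_abs_p_power_int[OF p]) simp
  also have "\<dots> \<le> real p powi (- int g) * real p powi (int g)"
    using m(2) by (intro mult_right_mono) auto
  also have "\<dots> = 1" using p0 by (simp add: power_int_minus)
  finally have "padic_norm p (padic_of_rat p r \<ominus>\<^bsub>Qp p\<^esub> padic_of_rat p (of_nat m / of_nat p ^ g)) \<le> 1"
    by (simp add: padic_of_rat_diff[OF p, symmetric] padic_norm_of_rat[OF p])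
  then have "padic_norm p (x \<ominus>\<^bsub>Qp p\<^esub> padic_of_rat p (of_nat m / of_nat p ^ g)) \<le> 1"
    using r padic_norm_diff_le[OF assms padic_of_rat_closed[OF p, of r]
        padic_of_rat_closed[OF p, of "of_nat m / of_nat p ^ g"]]
    by linarith
  then show ?thesis
    using assms m(1) by (intro bexI[of _ "padic_of_rat p (of_nat m / of_nat p ^ g)"]) (auto simp: padic_ball_def Ip_eq)
qed

text \<open>Over the common denominator p^(g+h) an integral difference forces the numerators to be
  congruent modulo p^(g+h), and both lie below that modulus. Together with \<open>Ip_exists\<close>
  this makes \<open>Ip\<close> a system of representatives of Q_p modulo Z_p.\<close>

lemma Ip_unique:
  assumes "a \<in> Ip p" "b \<in> Ip p" "a \<in> padic_ball p b 0"
  shows "a = b"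
proof -
  have p0: "p > 0" using p by (simp add: prime_gt_0_nat)
  obtain m g where a: "a = padic_of_rat p (of_nat m / of_nat p ^ g)" "m < p ^ g"
    using assms(1) unfolding Ip_eq by blast
  obtain n h where b: "b = padic_of_rat p (of_nat n / of_nat p ^ h)" "n < p ^ h"
    using assms(2) unfolding Ip_eq by blast
  define M N where "M = m * p ^ h" and "N = n * p ^ g"
  have MN: "M < p ^ (g + h)" "N < p ^ (g + h)"
    using a(2) b(2) p0 by (auto simp: M_def N_def power_add mult.commute)
  have eq: "of_nat m / of_nat p ^ g = (of_nat M / of_nat p ^ (g + h) :: rat)"
           "of_nat n / of_nat p ^ h = (of_nat N / of_nat p ^ (g + h) :: rat)"
    using p0 by (auto simp: M_def N_def power_add field_simps)
  have "padic_abs p (of_nat M / of_nat p ^ (g + h) - of_nat N / of_nat p ^ (g + h)) \<le> 1"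
    using assms(3) unfolding a(1) b(1) eq
    by (simp add: padic_ball_def padic_of_rat_diff[OF p, symmetric] padic_norm_of_rat[OF p])
  moreover have "of_int (int M - int N) = (of_nat M / of_nat p ^ (g + h) - of_nat N / of_nat p ^ (g + h)) * (of_nat p powi (int (g + h)) :: rat)"
    using p0 by (simp add: diff_divide_distrib[symmetric] del: of_nat_add)
  ultimately have "padic_abs p (of_int (int M - int N)) \<le> 1 * real p powi (- int (g + h))"
    by (simp only: padic_abs_mult[OF p] padic_abs_p_power_int[OF p]) (intro mult_right_mono, auto)
  then have "int p ^ (g + h) dvd int M - int N"
    using padic_abs_of_int_le_iff[OF p, of "int M - int N" "g + h"] by simp
  then have "[int M = int N] (mod int (p ^ (g + h)))" by (simp add: cong_iff_dvd_diff)
  then have "M mod p ^ (g + h) = N mod p ^ (g + h)" unfolding cong_def by (metis of_nat_eq_iff zmod_int)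
  then have "M = N" using MN by simp
  then show ?thesis unfolding a(1) b(1) eq by simp
qed

lemma Zp_eq_ball: "Zp p = padic_ball p \<zero>\<^bsub>Qp p\<^esub> 0"
  by (auto simp: Zp_def padic_ball_def a_minus_def)

lemma phi_shift:
  assumes "a \<in> carrier (Qp p)" "x \<in> carrier (Qp p)"
  shows "phi p (x \<ominus>\<^bsub>Qp p\<^esub> a) = indicator (padic_ball p a 0) x"
  using assms padic_norm_nonneg[OF p, of "x \<ominus>\<^bsub>Qp p\<^esub> a"] by (auto simp: phi_def padic_ball_def indicator_def)

section \<open>Topology and Borel sets of Q_p\<close>

lemma padic_Metric_space: "Metric_space (carrier (Qp p)) (padic_dist p)"
proof
  show "0 \<le> padic_dist p x y" for x y
    by (simp add: padic_dist_def padic_norm_nonneg[OF p])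
  show "padic_dist p x y = padic_dist p y x" for x y
    by (simp add: padic_dist_def padic_norm_diff_commute)
  show "padic_dist p x y = 0 \<longleftrightarrow> x = y" if "x \<in> carrier (Qp p)" "y \<in> carrier (Qp p)" for x y
    using that by (simp add: padic_dist_def padic_norm_eq_0_iff[OF p] padic_diff_eq_zero_iff)
  show "padic_dist p x z \<le> padic_dist p x y + padic_dist p y z"
    if "x \<in> carrier (Qp p)" "y \<in> carrier (Qp p)" "z \<in> carrier (Qp p)" for x y z
    using that padic_norm_diff_le[of x y z] padic_norm_nonneg[OF p, of "x \<ominus>\<^bsub>Qp p\<^esub> y"]
      padic_norm_nonneg[OF p, of "y \<ominus>\<^bsub>Qp p\<^esub> z"] by (simp add: padic_dist_def)
qed

text \<open>The open metric balls of real radius and the closed balls of radius p^(-k) refine each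
  other, because the powers of 1/p become arbitrarily small.\<close>

lemma openin_Qp_topology:
  "openin (Qp_topology p) U \<longleftrightarrow> U \<subseteq> carrier (Qp p) \<and> (\<forall>x\<in>U. \<exists>k. padic_ball p x k \<subseteq> U)"
proof -
  interpret Metric_space "carrier (Qp p)" "padic_dist p" by (rule padic_Metric_space)
  have "(\<exists>r>0. mball x r \<subseteq> U) \<longleftrightarrow> (\<exists>k. padic_ball p x k \<subseteq> U)" if x: "x \<in> carrier (Qp p)" for x
  proof
    assume "\<exists>r>0. mball x r \<subseteq> U"
    then obtain r where r: "r > 0" "mball x r \<subseteq> U" by blast
    obtain n where "inverse (real p) ^ n < r"
      using real_arch_pow_inv[of r "inverse (real p)"] r(1) prime_gt_1_nat[OF p]
      by (auto simp: inverse_less_1_iff)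
    then have "padic_ball p x (int n) \<subseteq> mball x r"
      using x padic_norm_diff_commute
      by (auto simp: padic_ball_def mball_def padic_dist_def power_int_minus power_inverse)
    then show "\<exists>k. padic_ball p x k \<subseteq> U" using r(2) by blast
  next
    assume "\<exists>k. padic_ball p x k \<subseteq> U"
    then obtain k where k: "padic_ball p x k \<subseteq> U" by blast
    have "mball x (real p powi (- k)) \<subseteq> padic_ball p x k"
      using padic_norm_diff_commute by (auto simp: padic_ball_def mball_def padic_dist_def)
    moreover have "real p powi (- k) > 0" using p by (simp add: prime_gt_0_nat)
    ultimately show "\<exists>r>0. mball x r \<subseteq> U" using k by blast
  qed
  then show ?thesis
    unfolding Qp_topology_def openin_mtopology Ball_def
    by (intro conj_cong all_cong1 imp_cong refl) blast
qed

lemma openin_padic_ball: "c \<in> carrier (Qp p) \<Longrightarrow> openin (Qp_topology p) (padic_ball p c k)"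
  unfolding openin_Qp_topology using padic_ball_subset_carrier padic_ball_eq by blast

text \<open>There are only countably many balls, so an open set is a countable union of the balls it
  contains.\<close>

lemma sigma_sets_padic_balls:
  "sigma_sets (carrier (Qp p)) {U. openin (Qp_topology p) U} = sigma_sets (carrier (Qp p)) (padic_balls p)"
proof (intro sigma_sets_eqI)
  fix U assume "U \<in> {U. openin (Qp_topology p) U}"
  then have U: "U \<subseteq> carrier (Qp p)" "\<And>x. x \<in> U \<Longrightarrow> \<exists>k. padic_ball p x k \<subseteq> U"
    by (auto simp: openin_Qp_topology)
  have "U = \<Union>{B \<in> padic_balls p. B \<subseteq> U}"
  proof (intro equalityI subsetI)
    fix x assume x: "x \<in> U"
    then obtain k where "padic_ball p x k \<subseteq> U" using U by blast
    then show "x \<in> \<Union>{B \<in> padic_balls p. B \<subseteq> U}"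
      using x U(1) padic_ball_self padic_ballsI by blast
  qed auto
  moreover have "\<Union>{B \<in> padic_balls p. B \<subseteq> U} \<in> sigma_sets (carrier (Qp p)) (padic_balls p)"
    by (rule sigma_sets_UNION) (auto intro: countable_subset[OF _ countable_padic_balls])
  ultimately show "U \<in> sigma_sets (carrier (Qp p)) (padic_balls p)" by simp
qed (auto simp: padic_balls_def intro!: sigma_sets.Basic openin_padic_ball)

text \<open>The empty set is added for disjoint pairs; otherwise the intersection is the smaller
  ball.\<close>

lemma Int_stable_padic_balls: "Int_stable (insert {} (padic_balls p))"
  using padic_balls_Int by (auto simp: Int_stable_def)

end

section \<open>The modified Haar basis\<close>

text \<open>The dilation as an operator on functions. The factor p^(j/2) makes it unitary, and
  separating it from the shift lets facts about level 0 be transported to every level.\<close>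

definition padic_dilate :: "nat \<Rightarrow> int \<Rightarrow> (padic \<Rightarrow> complex) \<Rightarrow> padic \<Rightarrow> complex" where
  "padic_dilate p j f x =
     of_real (real p powr (real_of_int j / 2)) * f (padic_of_rat p (of_nat p powi (- j)) \<otimes>\<^bsub>Qp p\<^esub> x)"

lemma padic_dilate_shift_eq: "padic_dilate_shift p f j a = padic_dilate p j (padic_shift p f a)"
  by (simp add: fun_eq_iff padic_dilate_shift_def padic_dilate_def padic_shift_def)

text \<open>The values of \<open>f\<close> may be infinite, so going up one step multiplies by the
  inverse of the finite constant \<open>c\<close> rather than dividing. It is used with c = p for
  balls and with c = 2 for dyadic intervals.\<close>

lemma ennreal_geometric_recursion:
  fixes f :: "int \<Rightarrow> ennreal" and c :: real
  assumes c: "c > 0" and step: "\<And>k. f k = ennreal c * f (k + 1)"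
  shows "f k = f 0 * ennreal (c powi (- k))"
proof (induction k rule: int_induct[of _ 0])
  case (step1 k)
  have "ennreal (inverse c) * ennreal c = 1"
    using c by (simp flip: ennreal_mult)
  then have "f (k + 1) = ennreal (inverse c) * f k"
    unfolding step[of k] by (simp add: mult.assoc[symmetric])
  also have "\<dots> = f 0 * (ennreal (inverse c) * ennreal (c powi (- k)))"
    unfolding step1 by (simp add: mult_ac)
  also have "ennreal (inverse c) * ennreal (c powi (- k)) = ennreal (inverse c * c powi (- k))"
    using c by (intro ennreal_mult[symmetric]) auto
  also have "inverse c * c powi (- k) = c powi (- 1 + - k)"
    using c by (subst power_int_add) (auto simp: power_int_minus)
  also have "- 1 + - k = - (k + 1)" by simp
  finally show ?case .
next
  case (step2 k)
  have "- (k - 1) = 1 + - k" by simp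
  also have "c powi \<dots> = c * c powi (- k)"
    using c by (subst power_int_add) auto
  finally show ?case
    using step[of "k - 1"] step2 c by (simp add: ennreal_mult mult_ac)
qed simp

text \<open>All balls of one exponent have the same value, and p of them make up a ball of the
  preceding exponent. \<open>F\<close> is a mere set function because it will also be the volume of
  an adelic box as a function of one coordinate.\<close>

lemma padic_ball_function_unique:
  fixes F :: "padic set \<Rightarrow> ennreal"
  assumes p: "prime p"
    and trans: "\<And>c g k. c \<in> carrier (Qp p) \<Longrightarrow> g \<in> carrier (Qp p) \<Longrightarrow>
      F (padic_ball p (g \<oplus>\<^bsub>Qp p\<^esub> c) k) = F (padic_ball p c k)"
    and children: "\<And>c k. c \<in> carrier (Qp p) \<Longrightarrow>
      F (padic_ball p c k) = (\<Sum>i<p. F (padic_ball p (c \<oplus>\<^bsub>Qp p\<^esub> padic_of_rat p (of_nat i * of_nat p powi k)) (k + 1)))"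
    and c: "c \<in> carrier (Qp p)"
  shows "F (padic_ball p c k) = F (Zp p) * ennreal (real p powi (- k))"
proof -
  interpret K: cring "Qp p" by (rule Qp_cring[OF p])
  have p0: "p > 0" using p by (simp add: prime_gt_0_nat)
  define f where "f k = F (padic_ball p \<zero>\<^bsub>Qp p\<^esub> k)" for k
  have F: "F (padic_ball p c k) = f k" if "c \<in> carrier (Qp p)" for c k
    using trans[of "\<zero>\<^bsub>Qp p\<^esub>" c k] that by (simp add: f_def)
  have step: "f k = ennreal (real p) * f (k + 1)" for k
  proof -
    have "f k = (\<Sum>i<p. F (padic_ball p (\<zero>\<^bsub>Qp p\<^esub> \<oplus>\<^bsub>Qp p\<^esub> padic_of_rat p (of_nat i * of_nat p powi k)) (k + 1)))"
      unfolding f_def by (intro children) simp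
    also have "\<dots> = (\<Sum>i<p. f (k + 1))"
      by (intro sum.cong refl F) (simp add: padic_of_rat_closed[OF p])
    finally show ?thesis by (simp add: ennreal_of_nat_eq_real_of_nat)
  qed
  have "f k = f 0 * ennreal (real p powi (- k))"
    by (rule ennreal_geometric_recursion[of _ f, OF _ step]) (use p0 in simp)
  then show ?thesis using F[OF c] by (simp add: f_def Zp_eq_ball[OF p])
qed

section \<open>Haar measure, dilations and multiresolution spaces on Q_p\<close>

locale padic_haar =
  fixes p :: nat and M :: "padic measure"
  assumes p: "prime p"
    and haar: "haar_measure (Qp p) (Qp_topology p) M"
    and normalized: "emeasure M (Zp p) = 1"
begin

sublocale K: cring "Qp p"
  by (rule Qp_cring[OF p])

lemma p0: "p > 0"
  using p by (simp add: prime_gt_0_nat)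

lemma space_M: "space M = carrier (Qp p)"
  using haar by (simp add: haar_measure_def)

lemma sets_M: "sets M = sigma_sets (carrier (Qp p)) (padic_balls p)"
  using haar by (simp add: haar_measure_def sigma_sets_padic_balls[OF p])

lemma sets_M': "sets M = sigma_sets (space M) (insert {} (padic_balls p))"
proof -
  have "sigma_sets (carrier (Qp p)) (insert {} (padic_balls p)) = sigma_sets (carrier (Qp p)) (padic_balls p)"
    by (intro sigma_sets_eqI) (auto intro: sigma_sets.intros)
  then show ?thesis by (simp add: space_M sets_M)
qed

lemma padic_balls_Pow: "insert {} (padic_balls p) \<subseteq> Pow (space M)"
  using padic_ball_subset_carrier by (auto simp: padic_balls_def space_M)

lemma ball_in_sets [measurable]: "c \<in> carrier (Qp p) \<Longrightarrow> padic_ball p c k \<in> sets M"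
  by (auto simp: sets_M intro: padic_ballsI)

lemma emeasure_ball: 
  assumes c: "c \<in> carrier (Qp p)"
  shows "emeasure M (padic_ball p c k) = ennreal (real p powi (- k))"
proof -
  have "emeasure M (padic_ball p c k) = emeasure M (Zp p) * ennreal (real p powi (- k))"
  proof (rule padic_ball_function_unique[OF p _ _ c])
    fix c g k assume cg: "c \<in> carrier (Qp p)" "g \<in> carrier (Qp p)"
    show "emeasure M (padic_ball p (g \<oplus>\<^bsub>Qp p\<^esub> c) k) = emeasure M (padic_ball p c k)"
      using haar cg ball_in_sets[OF cg(1)] unfolding haar_measure_def
      by (simp flip: padic_ball_translate[OF p])
  next
    fix c k assume c: "c \<in> carrier (Qp p)"
    show "emeasure M (padic_ball p c k) =
      (\<Sum>i<p. emeasure M (padic_ball p (c \<oplus>\<^bsub>Qp p\<^esub> padic_of_rat p (of_nat i * of_nat p powi k)) (k + 1)))"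
      unfolding padic_ball_children(1)[OF p c, of k]
      by (rule sum_emeasure[symmetric])
         (use c padic_ball_children(2)[OF p c, of k] padic_of_rat_closed[OF p] in auto)
  qed
  then show ?thesis by (simp add: normalized)
qed

lemma measure_ball: "c \<in> carrier (Qp p) \<Longrightarrow> measure M (padic_ball p c k) = real p powi (- k)"
  by (simp add: measure_def emeasure_ball)

lemma Union_balls: "\<Union>(padic_balls p) = space M"
  using padic_ball_self[OF p] padic_ball_subset_carrier by (fastforce simp: padic_balls_def space_M)

lemma sigma_finite: "sigma_finite_measure M"
proof
  show "\<exists>A. countable A \<and> A \<subseteq> sets M \<and> \<Union>A = space M \<and> (\<forall>a\<in>A. emeasure M a \<noteq> \<infinity>)"
    using countable_padic_balls[OF p] Union_balls
    by (intro exI[of _ "padic_balls p"]) (auto simp: padic_balls_def emeasure_ball)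
qed

abbreviation (input) dil_map :: "int \<Rightarrow> padic \<Rightarrow> padic" where
  "dil_map j x \<equiv> padic_of_rat p (of_nat p powi (- j)) \<otimes>\<^bsub>Qp p\<^esub> x"

lemma scale_closed [simp]: "x \<in> carrier (Qp p) \<Longrightarrow> padic_of_rat p r \<otimes>\<^bsub>Qp p\<^esub> x \<in> carrier (Qp p)"
  by (simp add: padic_of_rat_closed[OF p])

lemma dil_map_closed: "x \<in> carrier (Qp p) \<Longrightarrow> dil_map j x \<in> carrier (Qp p)"
  by (simp add: padic_of_rat_closed[OF p])

lemma dil_map_vimage:
  assumes "c \<in> carrier (Qp p)"
  shows "dil_map j -` padic_ball p c k \<inter> space M = padic_ball p (dil_map (- j) c) (k + j)"
  using padic_ball_dilate[OF p assms, of _ "- j" k]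
    subsetD[OF padic_ball_subset_carrier, of _ p "dil_map (- j) c" "k + j"]
  by (auto simp: space_M)

lemma dil_map_measurable [measurable]: "dil_map j \<in> M \<rightarrow>\<^sub>M M"
proof (rule measurable_sigma_sets[OF sets_M])
  show "padic_balls p \<subseteq> Pow (carrier (Qp p))"
    using padic_balls_Pow by (auto simp: space_M)
  show "dil_map j \<in> space M \<rightarrow> carrier (Qp p)"
    using dil_map_closed by (auto simp: space_M)
  show "dil_map j -` B \<inter> space M \<in> sets M" if "B \<in> padic_balls p" for B
    using that by (auto simp: padic_balls_def dil_map_vimage)
qed

text \<open>It suffices to compare on balls: the preimage of a ball of exponent k has exponent k +
  j, hence p^(-j) times the volume.\<close>

lemma distr_dil_map: "distr M M (dil_map j) = density M (\<lambda>_. ennreal (real p powi (- j)))"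
proof (rule measure_eqI_generator_eq_countable[OF Int_stable_padic_balls[OF p] padic_balls_Pow])
  fix X assume "X \<in> insert {} (padic_balls p)"
  then consider "X = {}" | c k where "X = padic_ball p c k" "c \<in> carrier (Qp p)"
    by (auto simp: padic_balls_def)
  then show "emeasure (distr M M (dil_map j)) X = emeasure (density M (\<lambda>_. ennreal (real p powi (- j)))) X"
  proof cases
    case 2
    have "emeasure (distr M M (dil_map j)) X = ennreal (real p powi (- (k + j)))"
      using 2 by (simp add: emeasure_distr dil_map_vimage emeasure_ball add.commute)
    also have "- (k + j) = - j + - k" by simp
    also have "real p powi \<dots> = real p powi (- j) * real p powi (- k)"
      using p0 by (subst power_int_add) auto
    also have "ennreal \<dots> = emeasure (density M (\<lambda>_. ennreal (real p powi (- j)))) X"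
      using 2 by (simp add: emeasure_density nn_integral_cmult emeasure_ball ennreal_mult)
    finally show ?thesis .
  qed auto
next
  show "emeasure (distr M M (dil_map j)) B \<noteq> \<infinity>" if "B \<in> padic_balls p" for B
    using that by (auto simp: padic_balls_def emeasure_distr dil_map_vimage emeasure_ball dil_map_closed)
qed (use countable_padic_balls[OF p] Union_balls sets_M' in auto)

lemma powr_half_square: "(real p powr (real_of_int j / 2))\<^sup>2 = real p powi j"
  using p0 by (simp add: power2_eq_square powr_add[symmetric] powr_real_of_int')

lemma integral_dil_map:
  fixes f :: "padic \<Rightarrow> 'b::{banach, second_countable_topology}"
  assumes "f \<in> borel_measurable M"
  shows "(LINT x|M. f (dil_map j x)) = real p powi (- j) *\<^sub>R (LINT x|M. f x)"
    and "integrable M (\<lambda>x. f (dil_map j x)) \<longleftrightarrow> integrable M f"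
proof -
  have "(LINT x|M. f (dil_map j x)) = (LINT x|distr M M (dil_map j). f x)"
    using assms by (simp add: integral_distr)
  also have "\<dots> = real p powi (- j) *\<^sub>R (LINT x|M. f x)"
    unfolding distr_dil_map using assms by (simp add: integral_density)
  finally show "(LINT x|M. f (dil_map j x)) = real p powi (- j) *\<^sub>R (LINT x|M. f x)" .
  have "integrable M (\<lambda>x. f (dil_map j x)) \<longleftrightarrow> integrable (distr M M (dil_map j)) f"
    using assms by (simp add: integrable_distr_eq)
  also have "\<dots> \<longleftrightarrow> integrable M (\<lambda>x. real p powi (- j) *\<^sub>R f x)"
    unfolding distr_dil_map using assms by (simp add: integrable_density)
  also have "\<dots> \<longleftrightarrow> integrable M f"
  proof
    assume "integrable M (\<lambda>x. real p powi (- j) *\<^sub>R f x)"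
    then have "integrable M (\<lambda>x. real p powi j *\<^sub>R (real p powi (- j) *\<^sub>R f x))"
      by (rule integrable_scaleR_right)
    then show "integrable M f"
      using p0 by (simp add: power_int_minus)
  qed (rule integrable_scaleR_right)
  finally show "integrable M (\<lambda>x. f (dil_map j x)) \<longleftrightarrow> integrable M f" .
qed

lemma dilate_measurable:
  assumes [measurable]: "f \<in> borel_measurable M"
  shows "padic_dilate p j f \<in> borel_measurable M"
  unfolding padic_dilate_def by measurable

lemma dilate_L2:
  assumes "f \<in> L2 M"
  shows "padic_dilate p j f \<in> L2 M"
proof -
  have f: "f \<in> borel_measurable M" "integrable M (\<lambda>x. (cmod (f x))\<^sup>2)"
    using assms by (auto simp: L2_def)
  have "integrable M (\<lambda>x. (cmod (f (dil_map j x)))\<^sup>2)"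
    using f integral_dil_map(2)[of "\<lambda>x. (cmod (f x))\<^sup>2" j] by simp
  then have "integrable M (\<lambda>x. (cmod (padic_dilate p j f x))\<^sup>2)"
    by (simp add: padic_dilate_def norm_mult power_mult_distrib)
  then show ?thesis using dilate_measurable[OF f(1)] by (simp add: L2_def)
qed

lemma l2_inner_dilate:
  assumes "f \<in> L2 M" "g \<in> L2 M"
  shows "l2_inner M (padic_dilate p j f) (padic_dilate p j g) = l2_inner M f g"
proof -
  have m: "(\<lambda>x. f x * cnj (g x)) \<in> borel_measurable M"
    using l2_inner_integrable[OF assms] by simp
  have "l2_inner M (padic_dilate p j f) (padic_dilate p j g) =
      (LINT x|M. of_real ((real p powr (real_of_int j / 2))\<^sup>2) * (f (dil_map j x) * cnj (g (dil_map j x))))"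
    unfolding l2_inner_def padic_dilate_def
    by (intro Bochner_Integration.integral_cong refl) (simp add: power2_eq_square)
  also have "\<dots> = of_real (real p powi j) * (real p powi (- j) *\<^sub>R (LINT x|M. f x * cnj (g x)))"
    unfolding integral_mult_right_zero integral_dil_map(1)[OF m, symmetric] powr_half_square ..
  also have "\<dots> = l2_inner M f g"
    using p0 by (simp add: l2_inner_def power_int_minus scaleR_conv_of_real)
  finally show ?thesis .
qed

lemma l2_norm_dilate:
  assumes "f \<in> L2 M"
  shows "l2_norm M (padic_dilate p j f) = l2_norm M f"
  using l2_inner_dilate[OF assms assms, of j]
  by (simp add: l2_inner_self l2_norm_def del: of_real_power)

lemma dilate_dilate:
  assumes "x \<in> carrier (Qp p)"
  shows "padic_dilate p j (padic_dilate p (- j) f) x = f x"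
proof -
  have "dil_map (- j) (dil_map j x) = padic_of_rat p (of_nat p powi j * of_nat p powi (- j)) \<otimes>\<^bsub>Qp p\<^esub> x"
    using assms padic_of_rat_closed[OF p] by (simp add: padic_of_rat_mult[OF p] K.m_assoc)
  also have "\<dots> = x"
    using p0 assms by (simp add: power_int_minus padic_of_rat_1[OF p])
  finally have "dil_map (- j) (dil_map j x) = x" .
  moreover have "real p powr (real_of_int j / 2) * real p powr (real_of_int (- j) / 2) = 1"
    using p0 by (simp flip: powr_add)
  ultimately show ?thesis
    unfolding padic_dilate_def by (simp add: mult.assoc[symmetric] flip: of_real_mult)
qed

lemma dilate_closed_span:
  assumes S: "S \<subseteq> L2 M" and f: "f \<in> closed_span M S"
  shows "padic_dilate p j f \<in> closed_span M (padic_dilate p j ` S)"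
proof (rule closed_span_linear_image[OF S _ f, where C = 1])
  show S': "padic_dilate p j ` S \<subseteq> L2 M"
    using S dilate_L2 by blast
  show "padic_dilate p j b \<in> closed_span M (padic_dilate p j ` S)" if "b \<in> S" for b
    using that by (intro closed_span_base[OF S']) auto
  show "padic_dilate p j g \<in> L2 M" "l2_norm M (padic_dilate p j g) \<le> 1 * l2_norm M g" if "g \<in> L2 M" for g
    using that by (simp_all add: dilate_L2 l2_norm_dilate)
qed (auto simp: padic_dilate_def fun_eq_iff right_diff_distrib sum_distrib_left mult_ac)

text \<open>Generators of the multiresolution space of level \<open>k\<close> without normalizing
  factors and with arbitrary centres instead of representatives from \<open>Ip\<close>.\<close>

definition ball_funs :: "int \<Rightarrow> (padic \<Rightarrow> complex) set" where
  "ball_funs k = {indicator (padic_ball p c k) | c. c \<in> carrier (Qp p)}"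

lemma ball_fun_L2: "c \<in> carrier (Qp p) \<Longrightarrow> (indicator (padic_ball p c k) :: padic \<Rightarrow> complex) \<in> L2 M"
  by (rule L2_indicator) (auto simp: emeasure_ball)

lemma ball_funs_L2: "ball_funs k \<subseteq> L2 M"
  using ball_fun_L2 by (auto simp: ball_funs_def)

lemma dilate_ball_fun:
  assumes "c \<in> carrier (Qp p)" "x \<in> carrier (Qp p)"
  shows "padic_dilate p j (indicator (padic_ball p c k)) x =
    of_real (real p powr (real_of_int j / 2)) * indicator (padic_ball p (dil_map (- j) c) (k + j)) x"
  using padic_ball_dilate[OF p assms, of "- j" k] by (simp add: padic_dilate_def indicator_def)

lemma shift_phi:
  assumes "a \<in> carrier (Qp p)" "x \<in> carrier (Qp p)"
  shows "padic_shift p (phi p) a x = indicator (padic_ball p a 0) x"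
  using phi_shift[OF p assms] by (simp add: padic_shift_def)

lemma dilate_shift_phi:
  assumes "a \<in> carrier (Qp p)" "x \<in> carrier (Qp p)"
  shows "padic_dilate_shift p (phi p) j a x =
    of_real (real p powr (real_of_int j / 2)) * indicator (padic_ball p (dil_map (- j) a) j) x"
  using dilate_ball_fun[OF assms, of j 0] shift_phi[OF assms(1) dil_map_closed[OF assms(2)]]
  by (simp add: padic_dilate_shift_eq padic_dilate_def)

lemma dilate_shift_phi_L2:
  assumes "a \<in> carrier (Qp p)"
  shows "padic_dilate_shift p (phi p) j a \<in> L2 M"
  by (rule L2_cong[OF L2_cmult[OF ball_fun_L2[OF dil_map_closed[OF assms, of "- j"], of j], of "of_real (real p powr (real_of_int j / 2))"]])
     (simp add: dilate_shift_phi[OF assms] space_M)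

text \<open>Each normalized dilated translate of \<open>phi\<close> is a multiple of the indicator
  of a ball, and every ball of exponent j arises this way because its rescaled centre may be moved
  to a representative in \<open>Ip\<close>.\<close>

lemma padic_V_eq: "padic_V p M j = closed_span M (ball_funs j)"
proof
  let ?S = "{padic_dilate_shift p (phi p) j a | a. a \<in> Ip p}"
  have S: "?S \<subseteq> L2 M"
    using dilate_shift_phi_L2 Ip_subset[OF p] by auto
  show "padic_V p M j \<subseteq> closed_span M (ball_funs j)"
    unfolding padic_V_def
  proof (rule closed_span_minimal[OF ball_funs_L2], rule subsetI)
    fix f assume "f \<in> ?S"
    then obtain a where a: "a \<in> carrier (Qp p)" "f = padic_dilate_shift p (phi p) j a"
      using Ip_subset[OF p] by blast
    have "(\<lambda>x. of_real (real p powr (real_of_int j / 2)) * indicator (padic_ball p (dil_map (- j) a) j) x) \<in> closed_span M (ball_funs j)"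
      by (intro closed_span_cmult[OF ball_funs_L2] closed_span_base[OF ball_funs_L2])
         (use a(1) in \<open>auto simp: ball_funs_def\<close>)
    then show "f \<in> closed_span M (ball_funs j)"
      by (rule closed_span_cong) (simp add: a dilate_shift_phi space_M)
  qed
  show "closed_span M (ball_funs j) \<subseteq> padic_V p M j"
    unfolding padic_V_def
  proof (rule closed_span_minimal[OF S], rule subsetI)
    fix f assume "f \<in> ball_funs j"
    then obtain c where c: "c \<in> carrier (Qp p)" "f = indicator (padic_ball p c j)"
      by (auto simp: ball_funs_def)
    \<comment> \<open>Multiplication by p^(-j) takes exponent j to exponent 0, where representatives
      modulo Z_p are available.\<close>
    obtain a where a: "a \<in> Ip p" "dil_map j c \<in> padic_ball p a 0"
      using Ip_exists[OF p dil_map_closed[OF c(1)]] by blast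
    have ac: "a \<in> carrier (Qp p)" using a(1) Ip_subset[OF p] by blast
    have "c \<in> padic_ball p (dil_map (- j) a) j"
      using padic_ball_dilate[OF p ac c(1), of "- j" 0] a(2) by simp
    then have eq: "padic_ball p (padic_of_rat p (of_nat p powi j) \<otimes>\<^bsub>Qp p\<^esub> a) j = padic_ball p c j"
      using padic_ball_eq[OF p dil_map_closed[OF ac, of "- j"]] by simp
    have "(\<lambda>x. of_real (real p powr - (real_of_int j / 2)) * padic_dilate_shift p (phi p) j a x) \<in> closed_span M ?S"
      using a(1) by (intro closed_span_cmult[OF S] closed_span_base[OF S]) auto
    then show "f \<in> closed_span M ?S"
    proof (rule closed_span_cong)
      fix x assume "x \<in> space M"
      moreover have "complex_of_real (real p powr - (real_of_int j / 2)) * of_real (real p powr (real_of_int j / 2)) = 1"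
        using p0 by (simp flip: of_real_mult powr_add)
      ultimately show "of_real (real p powr - (real_of_int j / 2)) * padic_dilate_shift p (phi p) j a x = f x"
        by (simp add: dilate_shift_phi[OF ac] space_M eq c(2) mult.assoc[symmetric])
    qed
  qed
qed

lemma ball_fun_children:
  assumes "c \<in> carrier (Qp p)"
  shows "(indicator (padic_ball p c k) :: padic \<Rightarrow> complex) =
    (\<lambda>x. \<Sum>i<p. indicator (padic_ball p (c \<oplus>\<^bsub>Qp p\<^esub> padic_of_rat p (of_nat i * of_nat p powi k)) (k + 1)) x)"
  unfolding padic_ball_children(1)[OF p assms, of k]
  by (rule ext, rule indicator_UN_disjoint) (use padic_ball_children(2)[OF p assms, of k] in auto)

lemma padic_V_mono: 
  assumes "j \<le> k"
  shows "padic_V p M j \<subseteq> padic_V p M k"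
proof -
  have step: "padic_V p M j \<subseteq> padic_V p M (j + 1)" for j
    unfolding padic_V_eq
  proof (rule closed_span_minimal[OF ball_funs_L2], rule subsetI)
    fix f assume "f \<in> ball_funs j"
    then obtain c where c: "c \<in> carrier (Qp p)" "f = indicator (padic_ball p c j)"
      by (auto simp: ball_funs_def)
    show "f \<in> closed_span M (ball_funs (j + 1))"
      unfolding c(2) ball_fun_children[OF c(1)]
      by (intro closed_span_sum[OF ball_funs_L2] closed_span_base[OF ball_funs_L2])
         (use c padic_of_rat_closed[OF p] in \<open>auto simp: ball_funs_def\<close>)
  qed
  show ?thesis
    using assms by (induction rule: int_ge_induct) (use step in auto)
qed

lemma dilate_V:
  assumes "f \<in> padic_V p M j"
  shows "padic_dilate p i f \<in> padic_V p M (j + i)"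
proof -
  have "padic_dilate p i ` ball_funs j \<subseteq> closed_span M (ball_funs (j + i))"
  proof
    fix g assume "g \<in> padic_dilate p i ` ball_funs j"
    then obtain c where c: "c \<in> carrier (Qp p)" "g = padic_dilate p i (indicator (padic_ball p c j))"
      by (auto simp: ball_funs_def)
    have "(\<lambda>x. of_real (real p powr (real_of_int i / 2)) * indicator (padic_ball p (dil_map (- i) c) (j + i)) x) \<in> closed_span M (ball_funs (j + i))"
      by (intro closed_span_cmult[OF ball_funs_L2] closed_span_base[OF ball_funs_L2])
         (use c(1) in \<open>auto simp: ball_funs_def\<close>)
    then show "g \<in> closed_span M (ball_funs (j + i))"
      by (rule closed_span_cong) (simp add: c dilate_ball_fun space_M)
  qed
  then show ?thesis
    using assms dilate_closed_span[OF ball_funs_L2, of f j i] closed_span_minimal[OF ball_funs_L2]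
    unfolding padic_V_eq by blast
qed

lemma padic_V_L2: "padic_V p M j \<subseteq> L2 M"
  unfolding padic_V_def by (rule closed_span_subset_L2)

lemma padic_W_subset_V: "padic_W p M j \<subseteq> padic_V p M (j + 1)"
  by (auto simp: padic_W_def)

text \<open>By unitarity the dilation is moved to the other argument, which brings \<open>g\<close>
  down to level 0, where orthogonality is the definition of W_0.\<close>

lemma dilate_W_orthogonal:
  assumes "f \<in> padic_W p M 0" "g \<in> padic_V p M j"
  shows "l2_inner M (padic_dilate p j f) g = 0"
proof -
  have f: "f \<in> L2 M" using assms(1) padic_W_subset_V padic_V_L2 by blast
  have g': "padic_dilate p (- j) g \<in> padic_V p M 0"
    using dilate_V[OF assms(2), of "- j"] by simp
  have "l2_inner M (padic_dilate p j f) g = l2_inner M (padic_dilate p j f) (padic_dilate p j (padic_dilate p (- j) g))"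
    by (rule l2_inner_cong) (simp_all add: dilate_dilate space_M)
  also have "\<dots> = l2_inner M f (padic_dilate p (- j) g)"
    using f g' padic_V_L2 by (intro l2_inner_dilate) auto
  also have "\<dots> = 0"
    using assms(1) g' by (simp add: padic_W_def)
  finally show ?thesis .
qed

text \<open>The inner product with the indicator of a unit ball is an integral over that ball: zero
  if it misses the ball about \<open>c\<close>, and 1/p - 1/p if it equals it.\<close>

lemma ball_detail_in_W:
  assumes c: "c \<in> carrier (Qp p)"
  shows "(\<lambda>x. indicator (padic_ball p c 1) x - of_real (1 / real p) * indicator (padic_ball p c 0) x) \<in> padic_W p M 0"
    (is "?f \<in> _")
proof -
  have V: "indicator (padic_ball p c k) \<in> padic_V p M k" for k
    unfolding padic_V_eq using c by (intro closed_span_base[OF ball_funs_L2]) (auto simp: ball_funs_def)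
  have "?f \<in> padic_V p M 1"
    using V[of 1] V[of 0] padic_V_mono[of 0 1] unfolding padic_V_eq
    by (intro closed_span_diff[OF ball_funs_L2] closed_span_cmult[OF ball_funs_L2]) auto
  moreover have "l2_inner M g ?f = 0" if "g \<in> padic_V p M 0" for g
    using that unfolding padic_V_eq
  proof (rule closed_span_orthogonal[OF ball_funs_L2, rotated 2])
    show fL: "?f \<in> L2 M"
      using \<open>?f \<in> padic_V p M 1\<close> padic_V_L2 by blast
    fix s assume "s \<in> ball_funs 0"
    then obtain d where d: "d \<in> carrier (Qp p)" "s = indicator (padic_ball p d 0)"
      by (auto simp: ball_funs_def)
    have sub: "padic_ball p c 1 \<subseteq> padic_ball p c 0"
      using padic_ball_subset[OF p c padic_ball_self[OF p c]] by simp
    have "l2_inner M ?f s = l2_inner M (indicator (padic_ball p c 1)) s - of_real (1 / real p) * l2_inner M (indicator (padic_ball p c 0)) s"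
      using c d ball_fun_L2 by (simp add: l2_inner_diff_left L2_cmult l2_inner_cmult_left del: of_real_divide)
    also have "\<dots> = of_real (measure M (padic_ball p c 1 \<inter> padic_ball p d 0) - 1 / real p * measure M (padic_ball p c 0 \<inter> padic_ball p d 0))"
      using c d by (simp add: l2_inner_indicator)
    also have "\<dots> = 0"
    proof (cases "padic_ball p c 0 \<inter> padic_ball p d 0 = {}")
      case True
      then have "padic_ball p c 1 \<inter> padic_ball p d 0 = {}" using sub by blast
      then show ?thesis using True by simp
    next
      case False
      then have eq: "padic_ball p d 0 = padic_ball p c 0"
        using padic_ball_nested[OF p c d(1), of 0 0] padic_ball_nested[OF p d(1) c, of 0 0] by blast
      show ?thesis
        using sub c p0 by (simp add: eq Int_absorb2 measure_ball power_int_minus inverse_eq_divide)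
    qed
    finally show "l2_inner M s ?f = 0"
      using l2_inner_commute[of M s ?f] by simp
  qed
  then have "l2_inner M ?f g = 0" if "g \<in> padic_V p M 0" for g
    using l2_inner_commute[of M ?f g] that by simp
  ultimately show ?thesis by (simp add: padic_W_def)
qed

end

section \<open>The modified Haar system is an orthonormal basis\<close>

locale padic_wavelets = padic_haar +
  fixes \<psi> :: "nat \<Rightarrow> padic \<Rightarrow> complex"
  assumes wavelets: "orthonormal_basis M (padic_W p M 0) ({1..p-1} \<times> Ip p) (\<lambda>(k, a). padic_shift p (\<psi> k) a)"
begin

lemma wavelet_in_W:
  assumes "k \<in> {1..p-1}" "a \<in> Ip p"
  shows "padic_shift p (\<psi> k) a \<in> padic_W p M 0"
proof -
  let ?e = "\<lambda>(k, a). padic_shift p (\<psi> k) a"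
  have "?e ` ({1..p-1} \<times> Ip p) \<subseteq> L2 M" "padic_W p M 0 = closed_span M (?e ` ({1..p-1} \<times> Ip p))"
    using wavelets unfolding orthonormal_basis_def by auto
  moreover have "padic_shift p (\<psi> k) a \<in> ?e ` ({1..p-1} \<times> Ip p)"
    using assms by force
  ultimately show ?thesis using closed_span_base by metis
qed

lemma modified_haar_Scaling_V: "a \<in> Ip p \<Longrightarrow> modified_haar p \<psi> (Scaling a) \<in> padic_V p M 0"
proof -
  assume "a \<in> Ip p"
  then have a: "a \<in> carrier (Qp p)" using Ip_subset[OF p] by blast
  have "indicator (padic_ball p a 0) \<in> padic_V p M 0"
    unfolding padic_V_eq using a by (intro closed_span_base[OF ball_funs_L2]) (auto simp: ball_funs_def)
  then show ?thesis
    unfolding padic_V_eq by (rule closed_span_cong) (simp add: shift_phi[OF a] space_M)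
qed

lemma modified_haar_Wavelet: "modified_haar p \<psi> (Wavelet k j a) = padic_dilate p (int j) (padic_shift p (\<psi> k) a)"
  by (simp add: padic_dilate_shift_eq)

lemma modified_haar_Wavelet_V:
  assumes "k \<in> {1..p-1}" "a \<in> Ip p"
  shows "modified_haar p \<psi> (Wavelet k j a) \<in> padic_V p M (int j + 1)"
  unfolding modified_haar_Wavelet
  using dilate_V[of "padic_shift p (\<psi> k) a" 1 "int j"] wavelet_in_W[OF assms] padic_W_subset_V[of 0]
  by (auto simp: add.commute)

text \<open>A wavelet of level j lies in V_(j+1) and is orthogonal to everything up to V_j. These
  two facts settle all inner products between different levels.\<close>

lemma modified_haar_Wavelet_orthogonal:
  assumes "k \<in> {1..p-1}" "a \<in> Ip p" "g \<in> padic_V p M i" "i \<le> int j"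
  shows "l2_inner M (modified_haar p \<psi> (Wavelet k j a)) g = 0"
  unfolding modified_haar_Wavelet
  using dilate_W_orthogonal[OF wavelet_in_W[OF assms(1,2)]] padic_V_mono[OF assms(4)] assms(3) by blast

lemma modified_haar_L2: "\<alpha> \<in> haar_indices p \<Longrightarrow> modified_haar p \<psi> \<alpha> \<in> L2 M"
  using modified_haar_Scaling_V modified_haar_Wavelet_V padic_V_L2 unfolding haar_indices_def by blast

text \<open>Translates of \<open>phi\<close> count as functions of V_0, below every wavelet. Within
  one level unitarity of the dilation reduces the claim to the given basis of W_0.\<close>

lemma modified_haar_orthonormal:
  assumes "\<alpha> \<in> haar_indices p" "\<beta> \<in> haar_indices p"
  shows "l2_inner M (modified_haar p \<psi> \<alpha>) (modified_haar p \<psi> \<beta>) = (if \<alpha> = \<beta> then 1 else 0)"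
proof -
  have SW: "l2_inner M (modified_haar p \<psi> (Wavelet k j b)) (modified_haar p \<psi> (Scaling a)) = 0"
    if "k \<in> {1..p-1}" "a \<in> Ip p" "b \<in> Ip p" for a k j b
    by (rule modified_haar_Wavelet_orthogonal[OF that(1,3) modified_haar_Scaling_V[OF that(2)]]) simp
  have WW: "l2_inner M (modified_haar p \<psi> (Wavelet k j a)) (modified_haar p \<psi> (Wavelet l i b)) = 0"
    if "k \<in> {1..p-1}" "l \<in> {1..p-1}" "a \<in> Ip p" "b \<in> Ip p" "i < j" for k l i j a b
    by (rule modified_haar_Wavelet_orthogonal[OF that(1,3) modified_haar_Wavelet_V[OF that(2,4)]]) (use that in simp)
  have cnj0: "l2_inner M f g = 0" if "l2_inner M g f = 0" for f g
    using that l2_inner_commute[of M f g] by simp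
  consider a b where "\<alpha> = Scaling a" "\<beta> = Scaling b" "a \<in> Ip p" "b \<in> Ip p"
    | a k j b where "\<alpha> = Scaling a" "\<beta> = Wavelet k j b" "a \<in> Ip p" "b \<in> Ip p" "k \<in> {1..p-1}"
    | a k j b where "\<beta> = Scaling a" "\<alpha> = Wavelet k j b" "a \<in> Ip p" "b \<in> Ip p" "k \<in> {1..p-1}"
    | k j a l i b where "\<alpha> = Wavelet k j a" "\<beta> = Wavelet l i b" "a \<in> Ip p" "b \<in> Ip p" "k \<in> {1..p-1}" "l \<in> {1..p-1}"
    using assms unfolding haar_indices_def by blast
  then show ?thesis
  proof cases
    case 1
    then have ab: "a \<in> carrier (Qp p)" "b \<in> carrier (Qp p)" using Ip_subset[OF p] by auto
    have "l2_inner M (modified_haar p \<psi> \<alpha>) (modified_haar p \<psi> \<beta>) = l2_inner M (indicator (padic_ball p a 0)) (indicator (padic_ball p b 0))"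
      by (rule l2_inner_cong) (simp_all add: 1 shift_phi ab space_M)
    also have "\<dots> = of_real (measure M (padic_ball p a 0 \<inter> padic_ball p b 0))"
      using ab by (intro l2_inner_indicator) auto
    also have "\<dots> = (if a = b then 1 else 0)"
    proof (cases "padic_ball p a 0 \<inter> padic_ball p b 0 = {}")
      case True
      then show ?thesis using padic_ball_self[OF p ab(1), of 0] by auto
    next
      case False
      \<comment> \<open>Intersecting unit balls are equal, so the two centres are representatives of
        one class modulo Z_p.\<close>
      then have "a \<in> padic_ball p b 0"
        using padic_ball_nested[OF p ab(2,1), of 0 0] padic_ball_self[OF p ab(1), of 0] by blast
      then have "a = b" using Ip_unique[OF p] 1 by blast
      then show ?thesis using ab by (simp add: measure_ball)
    qed
    finally show ?thesis using 1 by simp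
  next
    case 2
    then show ?thesis using SW[of k a b j] cnj0 by simp
  next
    case 3
    then show ?thesis using SW[of k a b j] by simp
  next
    case 4
    consider "i < j" | "j < i" | "i = j" by linarith
    then show ?thesis
    proof cases
      case 3
      have L: "padic_shift p (\<psi> k) a \<in> L2 M" "padic_shift p (\<psi> l) b \<in> L2 M"
        using wavelet_in_W 4 padic_W_subset_V padic_V_L2 by blast+
      have "l2_inner M (modified_haar p \<psi> \<alpha>) (modified_haar p \<psi> \<beta>) = l2_inner M (padic_shift p (\<psi> k) a) (padic_shift p (\<psi> l) b)"
        unfolding 4 modified_haar_Wavelet 3 by (rule l2_inner_dilate[OF L])
      also have "\<dots> = (if (k, a) = (l, b) then 1 else 0)"
        using wavelets 4 unfolding orthonormal_basis_def by (auto split: prod.splits)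
      finally show ?thesis using 4 3 by simp
    qed (use WW 4 cnj0 in simp_all)
  qed
qed

text \<open>Upwards from exponent 0, a ball of exponent j + 1 is a dilated detail function plus 1/p
  times its parent; downwards, a ball is the sum of its children.\<close>

lemma ball_fun_in_span:
  assumes "c \<in> carrier (Qp p)"
  shows "indicator (padic_ball p c k) \<in> closed_span M (modified_haar p \<psi> ` haar_indices p)"
proof -
  let ?L = "modified_haar p \<psi> ` haar_indices p"
  have L: "?L \<subseteq> L2 M" using modified_haar_L2 by blast
  have base0: "indicator (padic_ball p c 0) \<in> closed_span M ?L" if c: "c \<in> carrier (Qp p)" for c
  proof -
    obtain a where a: "a \<in> Ip p" "c \<in> padic_ball p a 0" using Ip_exists[OF p c] by blast
    then have ac: "a \<in> carrier (Qp p)" using Ip_subset[OF p] by blast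
    have "modified_haar p \<psi> (Scaling a) \<in> closed_span M ?L"
      using a(1) by (intro closed_span_base[OF L] imageI) (auto simp: haar_indices_def)
    then show ?thesis
      by (rule closed_span_cong) (simp add: shift_phi[OF ac] space_M padic_ball_eq[OF p ac a(2)])
  qed
  \<comment> \<open>Dilating the given basis of W_0 by a nonnegative power yields wavelets of that
    level, so the whole dilated space is in the span.\<close>
  have W: "padic_dilate p (int j) f \<in> closed_span M ?L" if f: "f \<in> padic_W p M 0" for f j
  proof -
    let ?E = "(\<lambda>(k, a). padic_shift p (\<psi> k) a) ` ({1..p-1} \<times> Ip p)"
    have E: "?E \<subseteq> L2 M" "f \<in> closed_span M ?E"
      using wavelets f unfolding orthonormal_basis_def by auto
    have "padic_dilate p (int j) ` ?E \<subseteq> ?L"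
    proof
      fix g assume "g \<in> padic_dilate p (int j) ` ?E"
      then obtain k a where "k \<in> {1..p-1}" "a \<in> Ip p" "g = modified_haar p \<psi> (Wavelet k j a)"
        unfolding modified_haar_Wavelet by auto
      then show "g \<in> ?L" unfolding haar_indices_def by blast
    qed
    then have "padic_dilate p (int j) ` ?E \<subseteq> closed_span M ?L"
      using closed_span_base[OF L] by blast
    then show ?thesis
      using dilate_closed_span[OF E, of "int j"] closed_span_minimal[OF L] by blast
  qed
  have pos: "indicator (padic_ball p c (int j)) \<in> closed_span M ?L" if "c \<in> carrier (Qp p)" for c j
    using that
  proof (induction j arbitrary: c)
    case 0
    then show ?case using base0 by simp
  next
    case (Suc j)
    \<comment> \<open>The centre is rescaled so that dilation by \<open>j\<close> takes the balls of
      exponents 0 and 1 about \<open>c0\<close> to those of exponents j and j + 1 about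
      \<open>c\<close>.\<close>
    define c0 where "c0 = dil_map (int j) c"
    have c0c: "c0 \<in> carrier (Qp p)" using dil_map_closed[OF Suc.prems] by (simp add: c0_def)
    have bk: "dil_map (- int j) c0 = c"
    proof -
      have "dil_map (- int j) c0 = padic_of_rat p (of_nat p powi (int j) * of_nat p powi (- int j)) \<otimes>\<^bsub>Qp p\<^esub> c"
        using Suc.prems padic_of_rat_closed[OF p] by (simp add: c0_def padic_of_rat_mult[OF p] K.m_assoc del: power_int_of_nat)
      then show ?thesis
        using p0 Suc.prems by (simp add: power_int_minus padic_of_rat_1[OF p])
    qed
    let ?f = "\<lambda>x. indicator (padic_ball p c0 1) x - of_real (1 / real p) * indicator (padic_ball p c0 0) x"
    let ?s = "complex_of_real (real p powr (real_of_int (int j) / 2))"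
    have s0: "?s \<noteq> 0" using p0 by simp
    \<comment> \<open>Removing the normalization of the dilation leaves the child minus 1/p times
      the parent; adding the parent back, which is covered by induction, leaves the child.\<close>
    have "(\<lambda>x. inverse ?s * padic_dilate p (int j) ?f x + of_real (1 / real p) * indicator (padic_ball p c (int j)) x) \<in> closed_span M ?L"
      by (intro closed_span_add[OF L] closed_span_cmult[OF L] W ball_detail_in_W c0c Suc.IH Suc.prems)
    then show ?case
    proof (rule closed_span_cong)
      fix x assume "x \<in> space M"
      then have x: "x \<in> carrier (Qp p)" by (simp add: space_M)
      have "padic_dilate p (int j) ?f x = padic_dilate p (int j) (indicator (padic_ball p c0 1)) x - of_real (1 / real p) * padic_dilate p (int j) (indicator (padic_ball p c0 0)) x"
        by (simp add: padic_dilate_def right_diff_distrib mult_ac)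
      also have "\<dots> = ?s * (indicator (padic_ball p c (1 + int j)) x - of_real (1 / real p) * indicator (padic_ball p c (int j)) x)"
        unfolding dilate_ball_fun[OF c0c x] bk by (simp add: right_diff_distrib mult_ac)
      finally have eq: "padic_dilate p (int j) ?f x = \<dots>" .
      have "inverse ?s * (?s * z) = z" for z
        using s0 by (simp only: mult.assoc[symmetric] left_inverse mult_1_left not_False_eq_True)
      then show "inverse ?s * padic_dilate p (int j) ?f x + of_real (1 / real p) * indicator (padic_ball p c (int j)) x = indicator (padic_ball p c (int (Suc j))) x"
        unfolding eq by (simp only: diff_add_cancel of_nat_Suc)
    qed
  qed
  have "\<forall>c\<in>carrier (Qp p). indicator (padic_ball p c k) \<in> closed_span M ?L"
  proof (cases "k \<ge> 0")
    case True
    then show ?thesis using pos[of _ "nat k"] by simp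
  next
    case False
    then have "k \<le> 0" by simp
    then show ?thesis
    proof (induction k rule: int_le_induct)
      case base
      then show ?case using base0 by simp
    next
      case (step i)
      show ?case
      proof
        fix c assume c: "c \<in> carrier (Qp p)"
        show "indicator (padic_ball p c (i - 1)) \<in> closed_span M ?L"
          unfolding ball_fun_children[OF c]
          using step c padic_of_rat_closed[OF p] by (intro closed_span_sum[OF L]) auto
      qed
    qed
  qed
  then show ?thesis using assms by blast
qed

theorem modified_haar_basis: "orthonormal_basis M (L2 M) (haar_indices p) (modified_haar p \<psi>)"
  unfolding orthonormal_basis_def
proof (intro conjI ballI)
  let ?L = "modified_haar p \<psi> ` haar_indices p"
  have L: "?L \<subseteq> L2 M" using modified_haar_L2 by blast
  show "closed_span M ?L = L2 M"
  proof (rule closed_span_eq_L2[OF L Int_stable_padic_balls[OF p] padic_balls_Pow sets_M' _ _ countable_padic_balls[OF p] _ Union_balls])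
    fix X assume "X \<in> insert {} (padic_balls p)"
    then show "(indicator X :: padic \<Rightarrow> complex) \<in> closed_span M ?L" "emeasure M X < \<infinity>"
      using ball_fun_in_span closed_span_zero[OF L] by (auto simp: padic_balls_def emeasure_ball indicator_empty_eq_zero)
  qed auto
qed (use modified_haar_L2 modified_haar_orthonormal in auto)

end

section \<open>The real Haar basis\<close>

text \<open>The half-open interval from n 2^(-j) to (n+1) 2^(-j), encoded by a floor: intervals of
  one level are then visibly disjoint, and nesting is integer division.\<close>

definition dyadic :: "int \<Rightarrow> int \<Rightarrow> real set" where
  "dyadic j n = {t. \<lfloor>2 powi j * t\<rfloor> = n}"

lemma dyadic_eq_interval: "dyadic j n = {of_int n * 2 powi (- j) ..< (of_int n + 1) * 2 powi (- j)}"
  by (auto simp: dyadic_def floor_eq_iff power_int_minus field_simps)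

lemma emeasure_dyadic: "emeasure lborel (dyadic j n) = ennreal (2 powi (- j))"
proof -
  have "of_int n * 2 powi (- j) \<le> ((of_int n + 1) * 2 powi (- j) :: real)"
    by (intro mult_right_mono) auto
  then show ?thesis by (simp add: dyadic_eq_interval algebra_simps)
qed

lemma measure_dyadic: "measure lborel (dyadic j n) = 2 powi (- j)"
  by (simp add: measure_def emeasure_dyadic)

lemma dyadic_in_borel [measurable]: "dyadic j n \<in> sets borel"
  by (simp add: dyadic_eq_interval)

lemma dyadic_disjoint: "m \<noteq> n \<Longrightarrow> dyadic j m \<inter> dyadic j n = {}"
  by (auto simp: dyadic_def)

text \<open>The floor of y / 2^k is the floor of y divided as an integer by 2^k.\<close>

lemma dyadic_parent:
  assumes "t \<in> dyadic (j + int k) n"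
  shows "t \<in> dyadic j (n div 2 ^ k)"
proof -
  have "(2::real) powi j * t = (2 powi (j + int k) * t) / real (2 ^ k)"
    by (subst power_int_add) auto
  then have "\<lfloor>2 powi j * t\<rfloor> = \<lfloor>2 powi (j + int k) * t\<rfloor> div int (2 ^ k)"
    by (simp only: floor_divide_real_eq_div of_nat_0_le_iff)
       (use floor_divide_real_eq_div[of "int (2 ^ k)" "2 powi (j + int k) * t"] in simp)
  then show ?thesis using assms by (simp add: dyadic_def)
qed

lemma dyadic_nested:
  assumes "j \<le> k"
  shows "dyadic k m \<subseteq> dyadic j n \<or> dyadic k m \<inter> dyadic j n = {}"
proof -
  have "dyadic k m \<subseteq> dyadic j (m div 2 ^ nat (k - j))"
    using dyadic_parent[of _ j "nat (k - j)" m] assms by auto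
  then show ?thesis
    using dyadic_disjoint[of "m div 2 ^ nat (k - j)" n j] by blast
qed

lemma dyadic_children:
  "dyadic j n = dyadic (j + 1) (2 * n) \<union> dyadic (j + 1) (2 * n + 1)"
proof -
  have "\<lfloor>x\<rfloor> = n \<longleftrightarrow> \<lfloor>2 * x\<rfloor> = 2 * n \<or> \<lfloor>2 * x\<rfloor> = 2 * n + 1" for x :: real
    by (auto simp: floor_eq_iff)
  moreover have "(2::real) powi (j + 1) * t = 2 * (2 powi j * t)" for t
    by (simp add: power_int_add)
  ultimately show ?thesis
    unfolding dyadic_def set_eq_iff Un_iff mem_Collect_eq by metis
qed

lemma real_haar_eq:
  "real_haar (j, n) t = 2 powr (real_of_int j / 2) *
     (indicator (dyadic (j + 1) (2 * n)) t - indicator (dyadic (j + 1) (2 * n + 1)) t)"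
proof -
  have "(2::real) powi (j + 1) * t = 2 * (2 powi j * t)"
    by (simp add: power_int_add)
  then have "t \<in> dyadic (j + 1) (2 * n) \<longleftrightarrow> 2 powi j * t - of_int n \<in> {0..<1/2}"
    and "t \<in> dyadic (j + 1) (2 * n + 1) \<longleftrightarrow> 2 powi j * t - of_int n \<in> {1/2..<1}"
    by (auto simp: dyadic_def floor_eq_iff)
  then show ?thesis
    by (simp add: real_haar_def haar_mother_def indicator_def)
qed

abbreviation (input) dyadic_fun :: "int \<Rightarrow> int \<Rightarrow> real \<Rightarrow> complex" where
  "dyadic_fun j n \<equiv> indicator (dyadic j n)"

text \<open>The complexification, since \<open>L2\<close> and \<open>l2_inner\<close> concern
  complex functions.\<close>

definition complex_haar :: "int \<times> int \<Rightarrow> real \<Rightarrow> complex" where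
  "complex_haar \<alpha> t = of_real (real_haar \<alpha> t)"

lemma complex_haar_eq:
  "complex_haar (j, n) = (\<lambda>t. of_real (2 powr (real_of_int j / 2)) *
     (dyadic_fun (j + 1) (2 * n) t - dyadic_fun (j + 1) (2 * n + 1) t))"
  by (simp add: fun_eq_iff complex_haar_def real_haar_eq of_real_indicator)

lemma dyadic_fun_L2: "dyadic_fun j n \<in> L2 lborel"
  by (rule L2_indicator) (auto simp: emeasure_dyadic)

lemma complex_haar_L2: "complex_haar \<alpha> \<in> L2 lborel"
  by (cases \<alpha>) (auto simp: complex_haar_eq intro!: L2_cmult L2_diff dyadic_fun_L2)

lemma l2_inner_haar_left:
  assumes "g \<in> L2 lborel"
  shows "l2_inner lborel (complex_haar (j, n)) g = of_real (2 powr (real_of_int j / 2)) *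
    (l2_inner lborel (dyadic_fun (j + 1) (2 * n)) g - l2_inner lborel (dyadic_fun (j + 1) (2 * n + 1)) g)"
  unfolding complex_haar_eq l2_inner_cmult_left
  using assms by (simp add: l2_inner_diff_left dyadic_fun_L2)

lemma l2_inner_dyadic: "l2_inner lborel (dyadic_fun j n) (dyadic_fun k m) = of_real (measure lborel (dyadic j n \<inter> dyadic k m))"
  by (rule l2_inner_indicator) auto

text \<open>An interval at least as coarse contains or misses the whole support, so it meets both
  halves of the Haar function in equal measure.\<close>

lemma dyadic_haar_orthogonal:
  assumes "j \<le> k"
  shows "l2_inner lborel (complex_haar (k, m)) (dyadic_fun j n) = 0"
proof -
  have "dyadic (k + 1) i \<inter> dyadic j n = dyadic (k + 1) i \<inter> (dyadic k m \<inter> dyadic j n)"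
    if "i \<in> {2 * m, 2 * m + 1}" for i
    using dyadic_children[of k m] that by auto
  moreover have "dyadic k m \<inter> dyadic j n = dyadic k m \<or> dyadic k m \<inter> dyadic j n = {}"
    using dyadic_nested[OF assms, of m n] by blast
  ultimately have "measure lborel (dyadic (k + 1) (2 * m) \<inter> dyadic j n) = measure lborel (dyadic (k + 1) (2 * m + 1) \<inter> dyadic j n)"
    using dyadic_children[of k m] by (auto simp: Int_absorb2 measure_dyadic)
  then show ?thesis
    by (simp add: l2_inner_haar_left dyadic_fun_L2 l2_inner_dyadic)
qed

lemma complex_haar_orthonormal:
  "l2_inner lborel (complex_haar \<alpha>) (complex_haar \<beta>) = (if \<alpha> = \<beta> then 1 else 0)"
proof -
  have less: "l2_inner lborel (complex_haar (j, n)) (complex_haar (k, m)) = 0" if "j < k" for j k n m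
  proof -
    \<comment> \<open>Each half of the coarser Haar function is an interval of level j + 1, which is
      at most k.\<close>
    have "l2_inner lborel (dyadic_fun (j + 1) i) (complex_haar (k, m)) = 0" for i
      using dyadic_haar_orthogonal[of "j + 1" k m i] that
        l2_inner_commute[of lborel "dyadic_fun (j + 1) i" "complex_haar (k, m)"] by simp
    then show ?thesis by (simp add: l2_inner_haar_left complex_haar_L2)
  qed
  obtain j n k m where ab: "\<alpha> = (j, n)" "\<beta> = (k, m)" by fastforce
  consider "j < k" | "k < j" | "j = k" by linarith
  then show ?thesis
  proof cases
    case 1
    then show ?thesis using less ab by simp
  next
    case 2
    then show ?thesis
      using less[OF 2, of m n] ab l2_inner_commute[of lborel "complex_haar \<alpha>" "complex_haar \<beta>"] by auto
  next
    case 3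
    \<comment> \<open>Within one level the inner product expands into four overlaps of intervals of
      level j + 1. Left and right halves never coincide, by parity, and for equal indices 2^j times
      two intervals of length 2^(-(j+1)) gives 1.\<close>
    let ?I = "\<lambda>a b. measure lborel (dyadic (j + 1) a \<inter> dyadic (j + 1) b)"
    have I: "?I a b = (if a = b then 2 powi (- (j + 1)) else 0)" for a b
      using dyadic_disjoint[of a b "j + 1"] by (simp add: measure_dyadic)
    have D: "l2_inner lborel (dyadic_fun (j + 1) a) (complex_haar (j, m)) =
        of_real (2 powr (real_of_int j / 2) * (?I (2 * m) a - ?I (2 * m + 1) a))" for a
      by (subst l2_inner_commute) (simp add: l2_inner_haar_left dyadic_fun_L2 l2_inner_dyadic)
    have "l2_inner lborel (complex_haar \<alpha>) (complex_haar \<beta>) =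
      of_real ((2 powr (real_of_int j / 2))\<^sup>2 *
        ((?I (2 * m) (2 * n) - ?I (2 * m + 1) (2 * n)) - (?I (2 * m) (2 * n + 1) - ?I (2 * m + 1) (2 * n + 1))))"
      unfolding ab 3[symmetric] l2_inner_haar_left[OF complex_haar_L2] D
      by (simp add: power2_eq_square algebra_simps)
    also have "(2 powr (real_of_int j / 2))\<^sup>2 = (2::real) powi j"
      by (simp add: power2_eq_square powr_add[symmetric] powr_real_of_int')
    also have "(?I (2 * m) (2 * n) - ?I (2 * m + 1) (2 * n)) - (?I (2 * m) (2 * n + 1) - ?I (2 * m + 1) (2 * n + 1)) =
      (if m = n then 2 * 2 powi (- (j + 1)) else 0)"
    proof -
      have "2 * m + 1 \<noteq> 2 * n" "2 * m \<noteq> 2 * n + 1" by presburger+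
      then show ?thesis unfolding I by auto
    qed
    also have "2 * (2::real) powi (- (j + 1)) = 2 powi (- j)"
      by (simp add: power_int_diff power_int_minus field_simps power_int_add)
    finally show ?thesis
      using ab 3 by (auto simp: power_int_minus)
  qed
qed

text \<open>A child minus half its parent is a multiple of a Haar function. Iterating k times leaves
  2^(-k) times the indicator of an ancestor of length 2^(k-j); its squared norm is 2^(-k-j), which
  tends to 0.\<close>

lemma dyadic_fun_in_span: "dyadic_fun j n \<in> closed_span lborel (range complex_haar)"
proof -
  let ?S = "range complex_haar"
  have S: "?S \<subseteq> L2 lborel" using complex_haar_L2 by blast
  have step: "(\<lambda>x. dyadic_fun (j + 1) m x - 1 / 2 * dyadic_fun j (m div 2) x) \<in> closed_span lborel ?S" for j m
  proof -
    define s where "s = complex_of_real (2 powr (real_of_int j / 2))"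
    \<comment> \<open>The sign distinguishes the left child, with even index, from the right one:
      the child minus half the parent is plus or minus half the difference of the two
      halves.\<close>
    define \<epsilon> :: complex where "\<epsilon> = (if even m then 1 else - 1)"
    have s0: "s \<noteq> 0" by (simp add: s_def)
    have "(\<lambda>x. \<epsilon> / (2 * s) * complex_haar (j, m div 2) x) \<in> closed_span lborel ?S"
      by (intro closed_span_cmult[OF S] closed_span_base[OF S]) auto
    moreover have "\<epsilon> / (2 * s) * complex_haar (j, m div 2) x = dyadic_fun (j + 1) m x - 1 / 2 * dyadic_fun j (m div 2) x" for x
    proof -
      define i where "i = m div 2"
      have "dyadic_fun j i x = dyadic_fun (j + 1) (2 * i) x + dyadic_fun (j + 1) (2 * i + 1) x"
        unfolding dyadic_children[of j i] using dyadic_disjoint[of "2 * i" "2 * i + 1" "j + 1"]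
        by (auto simp: indicator_def)
      moreover have "complex_haar (j, i) x = s * (dyadic_fun (j + 1) (2 * i) x - dyadic_fun (j + 1) (2 * i + 1) x)"
        unfolding complex_haar_eq s_def ..
      moreover have "m = 2 * i \<and> \<epsilon> = 1 \<or> m = 2 * i + 1 \<and> \<epsilon> = - 1"
        by (auto simp: i_def \<epsilon>_def)
      ultimately show ?thesis
        using s0 unfolding i_def[symmetric] by (auto simp: field_simps)
    qed
    ultimately show ?thesis by simp
  qed
  have diff: "(\<lambda>x. dyadic_fun j n x - (1 / 2) ^ k * dyadic_fun (j - int k) (n div 2 ^ k) x) \<in> closed_span lborel ?S" for k
  proof (induction k)
    case 0
    then show ?case using closed_span_zero[OF S] by simp
  next
    case (Suc k)
    \<comment> \<open>Telescoping: the coarsest term so far is exchanged for half its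
      parent.\<close>
    have "(\<lambda>x. (dyadic_fun j n x - (1 / 2) ^ k * dyadic_fun (j - int k) (n div 2 ^ k) x) +
      (1 / 2) ^ k * (dyadic_fun (j - int (Suc k) + 1) (n div 2 ^ k) x - 1 / 2 * dyadic_fun (j - int (Suc k)) (n div 2 ^ k div 2) x))
      \<in> closed_span lborel ?S"
      by (intro closed_span_add[OF S] closed_span_cmult[OF S] Suc step)
    moreover have "n div 2 ^ k div 2 = n div 2 ^ Suc k"
      unfolding power_Suc2 by (rule zdiv_zmult2_eq[symmetric]) simp
    moreover have "j - int (Suc k) + 1 = j - int k" by simp
    ultimately show ?case by (simp add: algebra_simps)
  qed
  show ?thesis
  proof (rule closed_span_limit[OF S dyadic_fun_L2])
    fix e :: real
    assume "e > 0"
    have "(\<lambda>k. (1 / 2) ^ k * 2 powi (- j)) \<longlonglongrightarrow> 0 * (2 powi (- j) :: real)"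
      by (intro tendsto_mult tendsto_const LIMSEQ_power_zero) simp
    then have "\<forall>\<^sub>F k in sequentially. (1 / 2) ^ k * (2 powi (- j) :: real) < e\<^sup>2"
      by (rule order_tendstoD) (use \<open>e > 0\<close> in simp)
    then obtain k where k: "(1 / 2) ^ k * (2 powi (- j) :: real) < e\<^sup>2"
      using eventually_happens'[OF sequentially_bot] by blast
    let ?g = "\<lambda>x. dyadic_fun j n x - (1 / 2) ^ k * dyadic_fun (j - int k) (n div 2 ^ k) x"
    have "(LINT x|lborel. (cmod (dyadic_fun j n x - ?g x))\<^sup>2) = (LINT x|lborel. ((1 / 2) ^ k)\<^sup>2 * indicator (dyadic (j - int k) (n div 2 ^ k)) x)"
      by (rule Bochner_Integration.integral_cong) (auto simp: norm_mult norm_power norm_divide indicator_def)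
    also have "\<dots> = ((1 / 2) ^ k)\<^sup>2 * 2 powi (- (j - int k))"
      by (simp add: measure_dyadic)
    also have "(2::real) powi (- (j - int k)) = 2 ^ k * 2 powi (- j)"
      by (simp add: power_int_diff power_int_minus field_simps)
    also have "((1 / 2) ^ k)\<^sup>2 * (2 ^ k * 2 powi (- j)) = (1 / 2) ^ k * (2 powi (- j) :: real)"
      by (simp add: power2_eq_square field_simps)
    finally have "l2_norm lborel (\<lambda>x. dyadic_fun j n x - ?g x) < e"
      using k \<open>e > 0\<close> by (simp add: l2_norm_less_iff)
    then show "\<exists>g\<in>closed_span lborel ?S. l2_norm lborel (\<lambda>x. dyadic_fun j n x - g x) < e"
      by (intro bexI[OF _ diff[of k]])
  qed
qed

section \<open>Dyadic intervals as generators of the Borel sets\<close>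

definition dyadic_intervals :: "real set set" where
  "dyadic_intervals = range (\<lambda>(j, n). dyadic j n)"

lemma countable_dyadic_intervals: "countable dyadic_intervals"
  by (simp add: dyadic_intervals_def)

lemma dyadic_neighbourhood:
  assumes "open U" "x \<in> U"
  shows "\<exists>D\<in>dyadic_intervals. x \<in> D \<and> D \<subseteq> U"
proof -
  obtain e where e: "e > 0" "ball x e \<subseteq> U" using assms open_contains_ball by blast
  obtain k where k: "(1 / 2) ^ k < e" using real_arch_pow_inv[of e "1 / 2"] e(1) by auto
  let ?n = "\<lfloor>2 ^ k * x\<rfloor>"
  have "dyadic (int k) ?n \<subseteq> ball x e"
  proof
    fix t assume "t \<in> dyadic (int k) ?n"
    then have "\<lfloor>2 ^ k * t\<rfloor> = \<lfloor>2 ^ k * x\<rfloor>" by (simp add: dyadic_def)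
    then have "\<bar>2 ^ k * t - 2 ^ k * x\<bar> < 1" by linarith
    then have "2 ^ k * \<bar>t - x\<bar> < 1"
      by (simp add: right_diff_distrib[symmetric] abs_mult)
    then have "\<bar>t - x\<bar> < (1 / 2) ^ k" by (simp add: field_simps power_divide)
    then show "t \<in> ball x e" using k by (simp add: dist_real_def abs_minus_commute)
  qed
  moreover have "x \<in> dyadic (int k) ?n" "dyadic (int k) ?n \<in> dyadic_intervals"
    by (auto simp: dyadic_intervals_def) (simp add: dyadic_def)
  ultimately show ?thesis using e(2) by blast
qed

lemma Int_stable_dyadic_intervals: "Int_stable (insert {} dyadic_intervals)"
proof -
  have "dyadic j n \<inter> dyadic k m \<in> insert {} dyadic_intervals" for j n k m
    using dyadic_nested[of j k m n] dyadic_nested[of k j n m]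
    by (cases "j \<le> k") (auto simp: dyadic_intervals_def Int_absorb1 Int_absorb2)
  then show ?thesis by (auto simp: Int_stable_def dyadic_intervals_def)
qed

lemma sets_borel_dyadic_intervals: "sets borel = sigma_sets UNIV dyadic_intervals"
proof -
  have "sigma_sets UNIV {U. open U} = sigma_sets UNIV dyadic_intervals"
  proof (intro sigma_sets_eqI)
    fix U :: "real set" assume "U \<in> {U. open U}"
    then have "U = \<Union>{D \<in> dyadic_intervals. D \<subseteq> U}"
      using dyadic_neighbourhood by blast
    moreover have "\<Union>{D \<in> dyadic_intervals. D \<subseteq> U} \<in> sigma_sets UNIV dyadic_intervals"
      by (rule sigma_sets_UNION) (auto intro: countable_subset[OF _ countable_dyadic_intervals])
    ultimately show "U \<in> sigma_sets UNIV dyadic_intervals" by simp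
  next
    fix D assume "D \<in> dyadic_intervals"
    then show "D \<in> sigma_sets UNIV {U. open U}"
      using dyadic_in_borel unfolding borel_def dyadic_intervals_def by auto
  qed
  then show ?thesis by (simp add: borel_def)
qed

lemma Union_dyadic_intervals: "\<Union>dyadic_intervals = UNIV"
  by (auto simp: dyadic_intervals_def dyadic_def)

theorem complex_haar_basis: "orthonormal_basis lborel (L2 lborel) UNIV complex_haar"
  unfolding orthonormal_basis_def
proof (intro conjI ballI)
  let ?S = "range complex_haar"
  have S: "?S \<subseteq> L2 lborel" using complex_haar_L2 by blast
  have gen: "sets lborel = sigma_sets (space lborel) (insert {} dyadic_intervals)"
  proof -
    have "sigma_sets UNIV (insert {} dyadic_intervals) = sigma_sets UNIV dyadic_intervals"
      by (intro sigma_sets_eqI) (auto intro: sigma_sets.intros)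
    then show ?thesis by (simp add: sets_borel_dyadic_intervals)
  qed
  show "closed_span lborel ?S = L2 lborel"
  proof (rule closed_span_eq_L2[OF S Int_stable_dyadic_intervals _ gen _ _ countable_dyadic_intervals])
    fix X assume "X \<in> insert {} dyadic_intervals"
    then show "(indicator X :: real \<Rightarrow> complex) \<in> closed_span lborel ?S" "emeasure lborel X < \<infinity>"
      using dyadic_fun_in_span closed_span_zero[OF S] by (auto simp: dyadic_intervals_def emeasure_dyadic indicator_empty_eq_zero)
  qed (auto simp: Union_dyadic_intervals)
qed (use complex_haar_L2 complex_haar_orthonormal in auto)

section \<open>Finite adeles\<close>

abbreviation (input) primes :: "nat set" where
  "primes \<equiv> {q. prime q}"

lemma finite_adele_ring_simps:
  "carrier finite_adele_ring = {x \<in> (\<Pi>\<^sub>E q\<in>primes. carrier (Qp q)). finite {q. prime q \<and> x q \<notin> Zp q}}"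
  "x \<oplus>\<^bsub>finite_adele_ring\<^esub> y = (\<lambda>q\<in>primes. x q \<oplus>\<^bsub>Qp q\<^esub> y q)"
  by (simp_all add: finite_adele_ring_def)

text \<open>A base of the restricted product topology whose local factors are balls rather than
  arbitrary open sets, so that it is countable.\<close>

definition adele_boxes :: "(nat \<Rightarrow> padic) set set" where
  "adele_boxes = {Pi\<^sub>E primes U | U. (\<forall>q\<in>primes. U q \<in> padic_balls q) \<and> finite {q. prime q \<and> U q \<noteq> Zp q}}"

lemma Zp_in_balls: "prime q \<Longrightarrow> Zp q \<in> padic_balls q"
  using cring.cring_simprules(2)[OF Qp_cring[of q]] by (simp add: Zp_eq_ball padic_ballsI)

lemma padic_balls_subset: "B \<in> padic_balls q \<Longrightarrow> B \<subseteq> carrier (Qp q)"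
  using padic_ball_subset_carrier by (auto simp: padic_balls_def)

lemma adele_boxesI:
  "(\<And>q. prime q \<Longrightarrow> U q \<in> padic_balls q) \<Longrightarrow> finite {q. prime q \<and> U q \<noteq> Zp q} \<Longrightarrow> Pi\<^sub>E primes U \<in> adele_boxes"
  by (auto simp: adele_boxes_def)

lemma adele_box_subset:
  assumes "B \<in> adele_boxes"
  shows "B \<subseteq> carrier finite_adele_ring"
proof
  fix x assume x: "x \<in> B"
  obtain U where U: "B = Pi\<^sub>E primes U" "\<forall>q\<in>primes. U q \<in> padic_balls q" "finite {q. prime q \<and> U q \<noteq> Zp q}"
    using assms by (auto simp: adele_boxes_def)
  have "finite {q. prime q \<and> x q \<notin> Zp q}"
    by (rule finite_subset[OF _ U(3)]) (use x U(1) in \<open>auto simp: PiE_iff\<close>)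
  moreover have "x q \<in> carrier (Qp q)" if "prime q" for q
    using that x U padic_balls_subset[of "U q" q] by (auto simp: PiE_iff)
  then have "x \<in> (\<Pi>\<^sub>E q\<in>primes. carrier (Qp q))"
    using x U(1) by (auto simp: PiE_iff)
  ultimately show "x \<in> carrier finite_adele_ring" by (simp add: finite_adele_ring_simps)
qed

lemma adele_boxes_Int:
  assumes "A \<in> adele_boxes" "B \<in> adele_boxes" "A \<inter> B \<noteq> {}"
  shows "A \<inter> B \<in> adele_boxes"
proof -
  obtain U where U: "A = Pi\<^sub>E primes U" "\<forall>q\<in>primes. U q \<in> padic_balls q" "finite {q. prime q \<and> U q \<noteq> Zp q}"
    using assms by (auto simp: adele_boxes_def)
  obtain V where V: "B = Pi\<^sub>E primes V" "\<forall>q\<in>primes. V q \<in> padic_balls q" "finite {q. prime q \<and> V q \<noteq> Zp q}"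
    using assms by (auto simp: adele_boxes_def)
  obtain x where x: "x \<in> A" "x \<in> B" using assms(3) by blast
  have "A \<inter> B = Pi\<^sub>E primes (\<lambda>q. U q \<inter> V q)"
    unfolding U V by (rule PiE_Int)
  also have "\<dots> \<in> adele_boxes"
  proof (rule adele_boxesI)
    show "U q \<inter> V q \<in> padic_balls q" if "prime q" for q
      using x U V that by (intro padic_balls_Int) (auto simp: PiE_iff)
    show "finite {q. prime q \<and> U q \<inter> V q \<noteq> Zp q}"
      by (rule finite_subset[OF _ finite_UnI[OF U(3) V(3)]]) auto
  qed
  finally show ?thesis .
qed

lemma Int_stable_adele_boxes: "Int_stable (insert {} adele_boxes)"
  using adele_boxes_Int by (auto simp: Int_stable_def)

text \<open>Beyond some bound n every factor is Z_q, so a box is determined by n and finitely many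
  balls.\<close>

lemma countable_adele_boxes: "countable adele_boxes"
proof (rule countable_subset)
  define D where "D n = {q. prime q \<and> q < n}" for n :: nat
  have finD: "finite (D n)" for n by (simp add: D_def)
  let ?f = "\<lambda>n U. Pi\<^sub>E primes (\<lambda>q. if q < n then U q else Zp q)"
  show "adele_boxes \<subseteq> (\<Union>n. ?f n ` Pi\<^sub>E (D n) padic_balls)"
  proof
    fix B assume "B \<in> adele_boxes"
    then obtain U where U: "B = Pi\<^sub>E primes U" "\<forall>q\<in>primes. U q \<in> padic_balls q" "finite {q. prime q \<and> U q \<noteq> Zp q}"
      by (auto simp: adele_boxes_def)
    obtain n where n: "\<forall>q\<in>{q. prime q \<and> U q \<noteq> Zp q}. q < n"
      using finite_nat_set_iff_bounded[THEN iffD1, OF U(3)] by blast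
    have "B = ?f n (restrict U (D n))"
      unfolding U(1) using n by (intro PiE_cong) (auto simp: D_def)
    moreover have "restrict U (D n) \<in> Pi\<^sub>E (D n) padic_balls"
      using U(2) by (auto simp: D_def)
    ultimately show "B \<in> (\<Union>n. ?f n ` Pi\<^sub>E (D n) padic_balls)" by blast
  qed
  show "countable (\<Union>n. ?f n ` Pi\<^sub>E (D n) padic_balls)"
    using finD countable_padic_balls by (intro countable_UN countable_image countable_PiE) (auto simp: D_def)
qed

text \<open>A canonical box about an adele: Z_q wherever the coordinate is integral, a unit ball at
  the finitely many other primes. It serves as a neighbourhood in measurability proofs.\<close>

lemma adele_point_box:
  assumes "x \<in> carrier finite_adele_ring"
  defines "U \<equiv> \<lambda>q. if x q \<in> Zp q then Zp q else padic_ball q (x q) 0"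
  shows "\<And>q. prime q \<Longrightarrow> U q \<in> padic_balls q" "finite {q. prime q \<and> U q \<noteq> Zp q}" "\<And>q. prime q \<Longrightarrow> x q \<in> U q"
    "Pi\<^sub>E primes U \<in> adele_boxes" "x \<in> Pi\<^sub>E primes U"
proof -
  have xc: "x q \<in> carrier (Qp q)" if "prime q" for q
    using assms that by (auto simp: finite_adele_ring_simps PiE_iff)
  show 1: "U q \<in> padic_balls q" if "prime q" for q
    using that xc by (simp add: U_def Zp_in_balls padic_ballsI)
  have "finite {q. prime q \<and> x q \<notin> Zp q}"
    using assms(1) by (simp add: finite_adele_ring_simps)
  then show 2: "finite {q. prime q \<and> U q \<noteq> Zp q}"
    by (rule finite_subset[rotated]) (auto simp: U_def)
  show 3: "x q \<in> U q" if "prime q" for q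
    using that xc padic_ball_self[of q "x q"] by (simp add: U_def)
  show "Pi\<^sub>E primes U \<in> adele_boxes"
    using 1 2 by (rule adele_boxesI)
  show "x \<in> Pi\<^sub>E primes U"
    using 3 assms(1) by (auto simp: finite_adele_ring_simps PiE_iff)
qed

text \<open>Induction over the generation of the topology; the intersection step uses that two boxes
  through a common point meet in a box.\<close>

lemma adele_box_neighbourhood:
  assumes "openin finite_adele_topology W" "x \<in> W"
  shows "\<exists>B\<in>adele_boxes. x \<in> B \<and> B \<subseteq> W"
proof -
  have "generate_topology_on {(\<Pi>\<^sub>E q\<in>primes. U q) | U.
          (\<forall>q. prime q \<longrightarrow> openin (Qp_topology q) (U q)) \<and> finite {q. prime q \<and> U q \<noteq> Zp q}} W"
    using assms(1) unfolding finite_adele_topology_def by (rule openin_topology_generated_by)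
  then show ?thesis
    using assms(2)
  proof (induction arbitrary: x rule: generate_topology_on.induct)
    case (Int a b)
    obtain A where A: "A \<in> adele_boxes" "x \<in> A" "A \<subseteq> a" using Int by blast
    obtain B where B: "B \<in> adele_boxes" "x \<in> B" "B \<subseteq> b" using Int by blast
    have "A \<inter> B \<in> adele_boxes" using A B by (intro adele_boxes_Int) auto
    then show ?case using A B by (intro bexI[of _ "A \<inter> B"]) auto
  next
    case (UN K)
    obtain k where k: "k \<in> K" "x \<in> k" using UN.prems by auto
    obtain B where "B \<in> adele_boxes" "x \<in> B" "B \<subseteq> k" using UN.IH[OF k] by auto
    then show ?case using k(1) by (intro bexI[of _ B]) auto
  next
    case (Basis s)
    then obtain U where U: "s = Pi\<^sub>E primes U" "\<And>q. prime q \<Longrightarrow> openin (Qp_topology q) (U q)"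
      "finite {q. prime q \<and> U q \<noteq> Zp q}" by blast
    \<comment> \<open>Where the open factor is Z_q it is kept unchanged; shrinking it as well could
      leave infinitely many exceptional primes.\<close>
    have "\<exists>V. V \<in> padic_balls q \<and> x q \<in> V \<and> V \<subseteq> U q \<and> (U q = Zp q \<longrightarrow> V = Zp q)" if q: "prime q" for q
    proof (cases "U q = Zp q")
      case True
      then show ?thesis using Zp_in_balls[OF q] Basis.prems U(1) q by (auto simp: PiE_iff)
    next
      case False
      have xq: "x q \<in> U q" using Basis.prems U(1) q by (auto simp: PiE_iff)
      then obtain k where "x q \<in> carrier (Qp q)" "padic_ball q (x q) k \<subseteq> U q"
        using U(2)[OF q] unfolding openin_Qp_topology[OF q] by blast
      then show ?thesis using False padic_ball_self[OF q] padic_ballsI by blast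
    qed
    then obtain V where V: "\<And>q. prime q \<Longrightarrow> V q \<in> padic_balls q \<and> x q \<in> V q \<and> V q \<subseteq> U q \<and> (U q = Zp q \<longrightarrow> V q = Zp q)"
      by metis
    have "Pi\<^sub>E primes V \<in> adele_boxes"
      by (rule adele_boxesI, use V in blast, rule finite_subset[OF _ U(3)]) (use V in auto)
    moreover have "x \<in> Pi\<^sub>E primes V" "Pi\<^sub>E primes V \<subseteq> s"
      using V Basis.prems unfolding U(1) by (auto simp: PiE_iff)
    ultimately show ?case by blast
  qed auto
qed

lemma openin_adele_box:
  assumes "B \<in> adele_boxes"
  shows "openin finite_adele_topology B"
proof -
  obtain U where U: "B = Pi\<^sub>E primes U" "\<forall>q\<in>primes. U q \<in> padic_balls q" "finite {q. prime q \<and> U q \<noteq> Zp q}"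
    using assms by (auto simp: adele_boxes_def)
  have "openin (Qp_topology q) (U q)" if "prime q" for q
    using U(2) that openin_padic_ball[OF that] by (auto simp: padic_balls_def)
  then show ?thesis
    unfolding finite_adele_topology_def U(1) using U(3) by (intro topology_generated_by_Basis) blast
qed

text \<open>A set that is a neighbourhood of each of its points in terms of boxes is a countable
  union of boxes. This is the measurability test for subsets of the finite adeles.\<close>

lemma union_adele_boxes_measurable:
  assumes "\<And>x. x \<in> A \<Longrightarrow> \<exists>B\<in>adele_boxes. x \<in> B \<and> B \<subseteq> A"
  shows "A \<in> sigma_sets (carrier finite_adele_ring) adele_boxes"
proof -
  have "A = \<Union>{B \<in> adele_boxes. B \<subseteq> A}" using assms by blast
  moreover have "\<Union>{B \<in> adele_boxes. B \<subseteq> A} \<in> sigma_sets (carrier finite_adele_ring) adele_boxes"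
    by (rule sigma_sets_UNION) (auto intro: countable_subset[OF _ countable_adele_boxes])
  ultimately show ?thesis by simp
qed

lemma sigma_sets_adele_boxes:
  "sigma_sets (carrier finite_adele_ring) {U. openin finite_adele_topology U} =
   sigma_sets (carrier finite_adele_ring) adele_boxes"
proof (rule sigma_sets_eqI)
  fix W assume "W \<in> {U. openin finite_adele_topology U}"
  then show "W \<in> sigma_sets (carrier finite_adele_ring) adele_boxes"
    by (intro union_adele_boxes_measurable adele_box_neighbourhood) auto
next
  fix B assume "B \<in> adele_boxes"
  then show "B \<in> sigma_sets (carrier finite_adele_ring) {U. openin finite_adele_topology U}"
    using openin_adele_box by (intro sigma_sets.Basic) simp
qed

lemma Union_adele_boxes: "\<Union>adele_boxes = carrier finite_adele_ring"
proof (intro equalityI subsetI)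
  fix x assume "x \<in> carrier finite_adele_ring"
  from adele_point_box(4,5)[OF this] show "x \<in> \<Union>adele_boxes" by (rule UnionI)
qed (use adele_box_subset in blast)

lemma Z_hat_box: "Z_hat \<in> adele_boxes"
  unfolding Z_hat_def by (rule adele_boxesI) (auto simp: Zp_in_balls)

lemma adele_box_translate:
  assumes "\<And>q. prime q \<Longrightarrow> U q \<subseteq> carrier (Qp q)"
  shows "(\<lambda>x. g \<oplus>\<^bsub>finite_adele_ring\<^esub> x) ` Pi\<^sub>E primes U = Pi\<^sub>E primes (\<lambda>q. (\<lambda>y. g q \<oplus>\<^bsub>Qp q\<^esub> y) ` U q)"
proof (intro equalityI subsetI)
  fix y assume "y \<in> (\<lambda>x. g \<oplus>\<^bsub>finite_adele_ring\<^esub> x) ` Pi\<^sub>E primes U"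
  then show "y \<in> Pi\<^sub>E primes (\<lambda>q. (\<lambda>y. g q \<oplus>\<^bsub>Qp q\<^esub> y) ` U q)"
    by (auto simp: finite_adele_ring_simps PiE_iff)
next
  fix y assume y: "y \<in> Pi\<^sub>E primes (\<lambda>q. (\<lambda>y. g q \<oplus>\<^bsub>Qp q\<^esub> y) ` U q)"
  then have "\<forall>q. \<exists>z. prime q \<longrightarrow> z \<in> U q \<and> y q = g q \<oplus>\<^bsub>Qp q\<^esub> z"
    by (auto simp: PiE_iff)
  then obtain z where z: "\<And>q. prime q \<Longrightarrow> z q \<in> U q \<and> y q = g q \<oplus>\<^bsub>Qp q\<^esub> z q" by metis
  have "restrict z primes \<in> Pi\<^sub>E primes U" using z by auto
  moreover have "y = g \<oplus>\<^bsub>finite_adele_ring\<^esub> restrict z primes"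
    using z y by (auto simp: fun_eq_iff finite_adele_ring_simps PiE_iff extensional_def)
  ultimately show "y \<in> (\<lambda>x. g \<oplus>\<^bsub>finite_adele_ring\<^esub> x) ` Pi\<^sub>E primes U" by blast
qed

text \<open>Uniqueness of Haar measure is stated for finitely additive functions of boxes, so that it also
  applies to the measures of products of boxes with a fixed real interval.\<close>

lemma adele_box_function_unique:
  fixes G :: "(nat \<Rightarrow> padic) set \<Rightarrow> ennreal"
  assumes trans: "\<And>g B. g \<in> carrier finite_adele_ring \<Longrightarrow> B \<in> adele_boxes \<Longrightarrow>
      G ((\<lambda>x. g \<oplus>\<^bsub>finite_adele_ring\<^esub> x) ` B) = G B"
    and add: "\<And>n B. (\<And>i. i < n \<Longrightarrow> B i \<in> adele_boxes) \<Longrightarrow> disjoint_family_on B {..<n} \<Longrightarrow>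
      G (\<Union>i<(n::nat). B i) = (\<Sum>i<n. G (B i))"
    and m: "\<And>q c k. prime q \<Longrightarrow> c \<in> carrier (Qp q) \<Longrightarrow> m q (padic_ball q c k) = ennreal (real q powi (- k))"
    and S: "finite S" "S \<subseteq> primes"
    and U: "\<And>q. q \<in> S \<Longrightarrow> U q \<in> padic_balls q" "\<And>q. prime q \<Longrightarrow> q \<notin> S \<Longrightarrow> U q = Zp q"
  shows "G (Pi\<^sub>E primes U) = G Z_hat * (\<Prod>q\<in>S. m q (U q))"
  using S U
proof (induction S arbitrary: U)
  case empty
  then have "Pi\<^sub>E primes U = Z_hat" unfolding Z_hat_def by (intro PiE_cong) auto
  then show ?case by simp
next
  case (insert q S)
  then have q: "prime q" by simp
  interpret K: cring "Qp q" by (rule Qp_cring[OF q])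
  obtain c k where ck: "U q = padic_ball q c k" "c \<in> carrier (Qp q)"
    using insert.prems(2)[of q] by (auto simp: padic_balls_def)
  \<comment> \<open>All coordinates but \<open>q\<close> are frozen, which turns the volume of the
    box into a set function on the balls of Q_q.\<close>
  define F where "F A = G (Pi\<^sub>E primes (U(q := A)))" for A
  have Ub: "U r \<in> padic_balls r" if "prime r" for r
    using insert.prems(2,3) Zp_in_balls that by (cases "r \<in> insert q S") auto
  have Ufin: "finite {r. prime r \<and> (U(q := A)) r \<noteq> Zp r}" for A
    by (rule finite_subset[of _ "insert q S"]) (use insert in \<open>auto split: if_splits\<close>)
  have box: "Pi\<^sub>E primes (U(q := A)) \<in> adele_boxes" if "A \<in> padic_balls q" for A
    using that Ub Ufin by (intro adele_boxesI) auto
  have "F (padic_ball q c k) = F (Zp q) * ennreal (real q powi (- k))"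
  proof (rule padic_ball_function_unique[OF q _ _ ck(2)])
    fix c g k assume c: "c \<in> carrier (Qp q)" and g: "g \<in> carrier (Qp q)"
    \<comment> \<open>Translation in one coordinate is translation by the adele that is
      \<open>g\<close> at q and zero elsewhere.\<close>
    define g' where "g' = (\<lambda>r\<in>primes. if r = q then g else \<zero>\<^bsub>Qp r\<^esub>)"
    have zero: "\<zero>\<^bsub>Qp r\<^esub> \<in> carrier (Qp r)" "\<zero>\<^bsub>Qp r\<^esub> \<in> Zp r" if "prime r" for r
      using cring.cring_simprules(2)[OF Qp_cring[OF that]] padic_ball_self[OF that] by (auto simp: Zp_eq_ball[OF that])
    have "finite {r. prime r \<and> g' r \<notin> Zp r}"
      by (rule finite_subset[of _ "{q}"]) (auto simp: g'_def zero)
    then have g': "g' \<in> carrier finite_adele_ring"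
      using g zero by (auto simp: finite_adele_ring_simps g'_def)
    have "(\<lambda>x. g' \<oplus>\<^bsub>finite_adele_ring\<^esub> x) ` Pi\<^sub>E primes (U(q := padic_ball q c k)) =
      Pi\<^sub>E primes (\<lambda>r. (\<lambda>y. g' r \<oplus>\<^bsub>Qp r\<^esub> y) ` (U(q := padic_ball q c k)) r)"
      using padic_balls_subset Ub padic_ball_subset_carrier by (intro adele_box_translate) auto
    also have "\<dots> = Pi\<^sub>E primes (U(q := padic_ball q (g \<oplus>\<^bsub>Qp q\<^esub> c) k))"
    proof (rule PiE_cong)
      fix r assume "r \<in> primes"
      then have r: "prime r" by simp
      interpret Kr: cring "Qp r" by (rule Qp_cring[OF r])
      have "(\<lambda>y. \<zero>\<^bsub>Qp r\<^esub> \<oplus>\<^bsub>Qp r\<^esub> y) ` U r = (\<lambda>y. y) ` U r"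
        using padic_balls_subset[OF Ub[OF r]] by (intro image_cong) auto
      then show "(\<lambda>y. g' r \<oplus>\<^bsub>Qp r\<^esub> y) ` (U(q := padic_ball q c k)) r = (U(q := padic_ball q (g \<oplus>\<^bsub>Qp q\<^esub> c) k)) r"
        using r padic_ball_translate[OF q c g, of k] by (auto simp: g'_def)
    qed
    finally show "F (padic_ball q (g \<oplus>\<^bsub>Qp q\<^esub> c) k) = F (padic_ball q c k)"
      unfolding F_def using trans[OF g' box[OF padic_ballsI[OF c, of k]]] by simp
  next
    fix c k assume c: "c \<in> carrier (Qp q)"
    let ?d = "\<lambda>i. c \<oplus>\<^bsub>Qp q\<^esub> padic_of_rat q (of_nat i * of_nat q powi k)"
    let ?B = "\<lambda>i. Pi\<^sub>E primes (U(q := padic_ball q (?d i) (k + 1)))"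
    have "Pi\<^sub>E primes (U(q := padic_ball q c k)) = (\<Union>i<q. ?B i)"
    proof (intro equalityI subsetI)
      fix x assume x: "x \<in> Pi\<^sub>E primes (U(q := padic_ball q c k))"
      then have "x q \<in> padic_ball q c k" using q by (auto simp: PiE_iff)
      then obtain i where "i < q" "x q \<in> padic_ball q (?d i) (k + 1)"
        unfolding padic_ball_children(1)[OF q c, of k] by blast
      then have "x \<in> ?B i" using x by (auto simp: PiE_iff split: if_splits)
      then show "x \<in> (\<Union>i<q. ?B i)" using \<open>i < q\<close> by blast
    next
      fix x assume "x \<in> (\<Union>i<q. ?B i)"
      then obtain i where i: "i < q" "x \<in> ?B i" by blast
      then have "x q \<in> padic_ball q (?d i) (k + 1)" using q by (auto simp: PiE_iff)
      then have "x q \<in> padic_ball q c k"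
        unfolding padic_ball_children(1)[OF q c, of k] using i(1) by blast
      then show "x \<in> Pi\<^sub>E primes (U(q := padic_ball q c k))"
        using i(2) by (auto simp: PiE_iff split: if_splits)
    qed
    moreover have "G (\<Union>i<q. ?B i) = (\<Sum>i<q. G (?B i))"
    proof (rule add)
      show "?B i \<in> adele_boxes" for i
        using c padic_of_rat_closed[OF q] by (intro box padic_ballsI) auto
      show "disjoint_family_on ?B {..<q}"
        unfolding disjoint_family_on_def
      proof (intro ballI impI equals0I)
        fix i j x assume ij: "i \<in> {..<q}" "j \<in> {..<q}" "i \<noteq> j" and x: "x \<in> ?B i \<inter> ?B j"
        have "x q \<in> padic_ball q (?d i) (k + 1) \<inter> padic_ball q (?d j) (k + 1)"
          using x q by (auto simp: PiE_iff)
        then show False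
          using disjoint_family_onD[OF padic_ball_children(2)[OF q c, of k] ij] by auto
      qed
    qed
    ultimately show "F (padic_ball q c k) = (\<Sum>i<q. F (padic_ball q (?d i) (k + 1)))"
      by (simp add: F_def)
  qed
  \<comment> \<open>With the coordinate \<open>q\<close> reset to Z_q the box deviates only over
    \<open>S\<close>, so the induction hypothesis applies.\<close>
  moreover have "F (Zp q) = G Z_hat * (\<Prod>r\<in>S. m r ((U(q := Zp q)) r))"
    unfolding F_def by (rule insert.IH) (use insert in auto)
  moreover have "(\<Prod>r\<in>S. m r ((U(q := Zp q)) r)) = (\<Prod>r\<in>S. m r (U r))"
    using insert.hyps by (intro prod.cong) auto
  moreover have "F (padic_ball q c k) = G (Pi\<^sub>E primes U)"
    unfolding F_def ck(1)[symmetric] by simp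
  ultimately show ?case
    using insert.hyps ck by (simp add: m[OF q] mult_ac)
qed

section \<open>Haar measure of the finite adeles\<close>

locale finite_adele_haar =
  fixes \<mu> :: "nat \<Rightarrow> padic measure" and N :: "(nat \<Rightarrow> padic) measure"
  assumes local_haar: "\<And>p. prime p \<Longrightarrow> padic_haar p (\<mu> p)"
    and haar: "haar_measure finite_adele_ring finite_adele_topology N"
    and normalized: "emeasure N Z_hat = 1"
begin

lemma space_N: "space N = carrier finite_adele_ring"
  using haar by (simp add: haar_measure_def)

lemma sets_N: "sets N = sigma_sets (carrier finite_adele_ring) adele_boxes"
  using haar by (simp add: haar_measure_def sigma_sets_adele_boxes)

lemma sets_N': "sets N = sigma_sets (space N) (insert {} adele_boxes)"
proof -
  have "sigma_sets (carrier finite_adele_ring) (insert {} adele_boxes) = sigma_sets (carrier finite_adele_ring) adele_boxes"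
    by (intro sigma_sets_eqI) (auto intro: sigma_sets.intros)
  then show ?thesis by (simp add: space_N sets_N)
qed

lemma adele_boxes_Pow: "insert {} adele_boxes \<subseteq> Pow (space N)"
  using adele_box_subset by (auto simp: space_N)

lemma box_in_sets: "B \<in> adele_boxes \<Longrightarrow> B \<in> sets N"
  by (auto simp: sets_N)

lemma translation_invariant:
  "g \<in> carrier finite_adele_ring \<Longrightarrow> A \<in> sets N \<Longrightarrow>
    emeasure N ((\<lambda>x. g \<oplus>\<^bsub>finite_adele_ring\<^esub> x) ` A) = emeasure N A"
  using haar by (simp add: haar_measure_def)

lemma emeasure_box:
  assumes S: "finite S" "S \<subseteq> primes"
    and U: "\<And>q. q \<in> S \<Longrightarrow> U q \<in> padic_balls q" "\<And>q. prime q \<Longrightarrow> q \<notin> S \<Longrightarrow> U q = Zp q"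
  shows "emeasure N (Pi\<^sub>E primes U) = (\<Prod>q\<in>S. emeasure (\<mu> q) (U q))"
proof -
  have "emeasure N (Pi\<^sub>E primes U) = emeasure N Z_hat * (\<Prod>q\<in>S. emeasure (\<mu> q) (U q))"
  proof (rule adele_box_function_unique[OF _ _ _ S U])
    show "emeasure N ((\<lambda>x. g \<oplus>\<^bsub>finite_adele_ring\<^esub> x) ` B) = emeasure N B"
      if "g \<in> carrier finite_adele_ring" "B \<in> adele_boxes" for g B
      using translation_invariant box_in_sets that by simp
    show "emeasure N (\<Union>i<n. B i) = (\<Sum>i<n. emeasure N (B i))"
      if "\<And>i. i < n \<Longrightarrow> B i \<in> adele_boxes" "disjoint_family_on B {..<n}" for n :: nat and B
      using that box_in_sets by (intro sum_emeasure[symmetric]) auto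
    show "emeasure (\<mu> q) (padic_ball q c k) = ennreal (real q powi (- k))"
      if "prime q" "c \<in> carrier (Qp q)" for q c k
      using padic_haar.emeasure_ball[OF local_haar] that by blast
  qed
  then show ?thesis by (simp add: normalized)
qed

lemma emeasure_local_ball_finite: "prime q \<Longrightarrow> B \<in> padic_balls q \<Longrightarrow> emeasure (\<mu> q) B < \<infinity>"
  using padic_haar.emeasure_ball[OF local_haar, of q] by (auto simp: padic_balls_def)

lemma emeasure_box_finite:
  assumes "B \<in> adele_boxes"
  shows "emeasure N B < \<infinity>"
proof -
  obtain U where U: "B = Pi\<^sub>E primes U" "\<forall>q\<in>primes. U q \<in> padic_balls q" "finite {q. prime q \<and> U q \<noteq> Zp q}"
    using assms by (auto simp: adele_boxes_def)
  have "emeasure N B = (\<Prod>q\<in>{q. prime q \<and> U q \<noteq> Zp q}. emeasure (\<mu> q) (U q))"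
    unfolding U(1) using U by (intro emeasure_box) auto
  also have "\<dots> \<noteq> \<infinity>"
    using U(2) emeasure_local_ball_finite by (auto simp: ennreal_prod_eq_top less_top[symmetric])
  finally show ?thesis by (simp add: top.not_eq_extremum)
qed

lemma sigma_finite_N: "sigma_finite_measure N"
proof
  show "\<exists>A. countable A \<and> A \<subseteq> sets N \<and> \<Union>A = space N \<and> (\<forall>a\<in>A. emeasure N a \<noteq> \<infinity>)"
    using countable_adele_boxes Union_adele_boxes box_in_sets emeasure_box_finite
    by (intro exI[of _ adele_boxes]) (auto simp: space_N less_top)
qed

text \<open>The finite S-adeles: arbitrary at the primes of S, integral at all others.\<close>

definition integral_outside :: "nat set \<Rightarrow> (nat \<Rightarrow> padic) set" where
  "integral_outside S = {x \<in> carrier finite_adele_ring. \<forall>q. prime q \<longrightarrow> q \<notin> S \<longrightarrow> x q \<in> Zp q}"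

lemma integral_outside_in_sets [measurable]: "integral_outside S \<in> sets N"
  unfolding sets_N
proof (rule union_adele_boxes_measurable)
  fix x assume x: "x \<in> integral_outside S"
  then have xc: "x \<in> carrier finite_adele_ring" by (simp add: integral_outside_def)
  let ?U = "\<lambda>q. if x q \<in> Zp q then Zp q else padic_ball q (x q) 0"
  have "Pi\<^sub>E primes ?U \<subseteq> integral_outside S"
    using adele_box_subset[OF adele_point_box(4)[OF xc]] x
    by (auto simp: integral_outside_def PiE_iff split: if_splits)
  then show "\<exists>B\<in>adele_boxes. x \<in> B \<and> B \<subseteq> integral_outside S"
    using adele_point_box(4,5)[OF xc] by blast
qed

lemma component_measurable:
  assumes q: "prime q"
  shows "(\<lambda>x. x q) \<in> N \<rightarrow>\<^sub>M \<mu> q"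
proof (rule measurable_sigma_sets[OF padic_haar.sets_M[OF local_haar[OF q]]])
  show "padic_balls q \<subseteq> Pow (carrier (Qp q))" using padic_balls_subset by blast
  show "(\<lambda>x. x q) \<in> space N \<rightarrow> carrier (Qp q)"
    using q by (auto simp: space_N finite_adele_ring_simps PiE_iff)
  fix A assume A: "A \<in> padic_balls q"
  show "(\<lambda>x. x q) -` A \<inter> space N \<in> sets N"
    unfolding sets_N
  proof (rule union_adele_boxes_measurable)
    fix x assume x: "x \<in> (\<lambda>x. x q) -` A \<inter> space N"
    then have xc: "x \<in> carrier finite_adele_ring" by (simp add: space_N)
    let ?U = "\<lambda>q. if x q \<in> Zp q then Zp q else padic_ball q (x q) 0"
    \<comment> \<open>The canonical box about \<open>x\<close> with its factor at \<open>q\<close>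
      replaced by the given ball; only one further exceptional prime can arise.\<close>
    let ?B = "Pi\<^sub>E primes (?U(q := A))"
    have "finite {r. prime r \<and> (?U(q := A)) r \<noteq> Zp r}"
      by (rule finite_subset[OF _ finite.insertI[OF adele_point_box(2)[OF xc], of q]]) (auto split: if_splits)
    then have B: "?B \<in> adele_boxes"
      using adele_point_box(1)[OF xc] A by (intro adele_boxesI) auto
    moreover have "x \<in> ?B"
      using adele_point_box(5)[OF xc] x by (auto simp: PiE_iff)
    moreover have "?B \<subseteq> (\<lambda>x. x q) -` A \<inter> space N"
      using adele_box_subset[OF B] PiE_mem[of _ primes "?U(q := A)" q] q by (auto simp: space_N)
    ultimately show "\<exists>B\<in>adele_boxes. x \<in> B \<and> B \<subseteq> (\<lambda>x. x q) -` A \<inter> space N" by blast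
  qed
qed

text \<open>The locale for product measures requires a sigma-finite measure at every index, so the
  indices that are not prime receive a dummy value.\<close>

definition \<mu>' :: "nat \<Rightarrow> padic measure" where
  "\<mu>' q = (if prime q then \<mu> q else \<mu> 2)"

lemma \<mu>'_prime: "prime q \<Longrightarrow> \<mu>' q = \<mu> q"
  by (simp add: \<mu>'_def)

sublocale P: product_sigma_finite \<mu>'
  by (rule product_sigma_finite.intro) (simp add: \<mu>'_def padic_haar.sigma_finite[OF local_haar])

lemma restrict_measurable:
  assumes "S \<subseteq> primes"
  shows "(\<lambda>x. restrict x S) \<in> restrict_space N (integral_outside S) \<rightarrow>\<^sub>M Pi\<^sub>M S \<mu>'"
proof (rule measurable_restrict)
  fix q assume "q \<in> S"
  then have "prime q" using assms by blast
  then show "(\<lambda>x. x q) \<in> restrict_space N (integral_outside S) \<rightarrow>\<^sub>M \<mu>' q"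
    by (simp add: \<mu>'_prime measurable_restrict_space1 component_measurable)
qed

text \<open>The preimage of a product of balls over S is the box with Z_q at every other prime. As
  Z_q has volume 1, the volume of this box is the product of the volumes over S.\<close>

lemma distr_restrict_eq_PiM:
  assumes S: "finite S" "S \<subseteq> primes"
  shows "Pi\<^sub>M S \<mu>' = distr (restrict_space N (integral_outside S)) (Pi\<^sub>M S \<mu>') (\<lambda>x. restrict x S)"
proof -
  define E where "E = {Pi\<^sub>E S U | U. \<forall>q\<in>S. U q \<in> insert {} (padic_balls q)}"
  define A where "A = Pi\<^sub>E S ` Pi\<^sub>E S padic_balls"
  have Sp: "prime q" if "q \<in> S" for q using S(2) that by blast
  have spaceq: "space (\<mu>' q) = carrier (Qp q)" if "q \<in> S" for q
    using padic_haar.space_M[OF local_haar[OF Sp[OF that]]] Sp[OF that] by (simp add: \<mu>'_prime)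
  have ne: "padic_balls q \<noteq> {}" if "q \<in> S" for q
    using Zp_in_balls[OF Sp[OF that]] by blast
  have Uq: "\<Union>(padic_balls q) = carrier (Qp q)" if "q \<in> S" for q
    using padic_haar.Union_balls[OF local_haar[OF Sp[OF that]]] spaceq[OF that] Sp[OF that] by (simp add: \<mu>'_prime)
  have sub: "restrict U S \<in> Pi\<^sub>E S padic_balls" if "\<forall>q\<in>S. U q \<in> padic_balls q" for U
    using that by auto
  have gen: "sets (Pi\<^sub>M S \<mu>') = sigma_sets (space (Pi\<^sub>M S \<mu>')) E"
  proof -
    let ?E = "\<lambda>q. insert {} (padic_balls q)" and ?Q = "\<lambda>q. carrier (Qp q)"
    have EPow: "?E q \<subseteq> Pow (?Q q)" for q
      using padic_balls_subset by blast
    have PiE_Q: "space (Pi\<^sub>M S \<mu>') = Pi\<^sub>E S ?Q"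
      unfolding space_PiM by (intro PiE_cong spaceq)
    have E_Pow: "E \<subseteq> Pow (Pi\<^sub>E S ?Q)"
    proof
      fix X assume "X \<in> E"
      then obtain U where U: "X = Pi\<^sub>E S U" "\<forall>q\<in>S. U q \<in> ?E q" unfolding E_def by blast
      have "U q \<subseteq> ?Q q" if "q \<in> S" for q using U(2) EPow[of q] that by blast
      then show "X \<in> Pow (Pi\<^sub>E S ?Q)" unfolding U(1) by (intro PowI PiE_mono)
    qed
    have "sets (Pi\<^sub>M S \<mu>') = sets (\<Pi>\<^sub>M q\<in>S. sigma (?Q q) (?E q))"
    proof (rule sets_PiM_cong)
      fix q assume q: "q \<in> S"
      show "sets (\<mu>' q) = sets (sigma (?Q q) (?E q))"
        using padic_haar.sets_M'[OF local_haar[OF Sp[OF q]]] spaceq[OF q] Sp[OF q] EPow[of q]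
        by (simp add: \<mu>'_prime)
    qed simp
    \<comment> \<open>Taking all of \<open>S\<close> as the only block of coordinates turns cylinder
      sets into full rectangles with balls as sides.\<close>
    also have "\<dots> = sets (sigma (Pi\<^sub>E S ?Q) {{f \<in> Pi\<^sub>E S ?Q. \<forall>q\<in>j. f q \<in> A q} | A j. j \<in> {S} \<and> A \<in> Pi j ?E})"
    proof (rule sets_PiM_sigma)
      show "\<exists>T\<subseteq>?E q. countable T \<and> ?Q q = \<Union>T" if "q \<in> S" for q
        using Uq[OF that] countable_padic_balls[OF Sp[OF that]] by (intro exI[of _ "padic_balls q"]) auto
    qed (use S EPow in auto)
    also have "{{f \<in> Pi\<^sub>E S ?Q. \<forall>q\<in>j. f q \<in> A q} | A j. j \<in> {S} \<and> A \<in> Pi j ?E} = E"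
    proof -
      have *: "{f \<in> Pi\<^sub>E S ?Q. \<forall>q\<in>S. f q \<in> A q} = Pi\<^sub>E S A" if A: "A \<in> Pi S ?E" for A
      proof -
        have "A q \<subseteq> ?Q q" if "q \<in> S" for q
          using EPow[of q] A that by blast
        then show ?thesis unfolding set_eq_iff mem_Collect_eq PiE_iff by blast
      qed
      show ?thesis
      proof (intro equalityI subsetI)
        fix X assume "X \<in> {{f \<in> Pi\<^sub>E S ?Q. \<forall>q\<in>j. f q \<in> A q} | A j. j \<in> {S} \<and> A \<in> Pi j ?E}"
        then obtain A where A: "A \<in> Pi S ?E" "X = {f \<in> Pi\<^sub>E S ?Q. \<forall>q\<in>S. f q \<in> A q}" by blast
        show "X \<in> E" unfolding A(2) *[OF A(1)] E_def
          by (intro CollectI exI[of _ A] conjI refl ballI Pi_mem[OF A(1)])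
      next
        fix X assume "X \<in> E"
        then obtain U where U: "X = Pi\<^sub>E S U" "\<forall>q\<in>S. U q \<in> ?E q" unfolding E_def by blast
        have "U \<in> Pi S ?E" using U(2) by (intro Pi_I) (rule bspec)
        then show "X \<in> {{f \<in> Pi\<^sub>E S ?Q. \<forall>q\<in>j. f q \<in> A q} | A j. j \<in> {S} \<and> A \<in> Pi j ?E}"
          unfolding U(1) *[OF \<open>U \<in> Pi S ?E\<close>, symmetric]
          by (intro CollectI exI[of _ U] exI[of _ S] conjI refl singletonI)
      qed
    qed
    finally show ?thesis using E_Pow by (simp add: PiE_Q)
  qed
  have meas: "emeasure (Pi\<^sub>M S \<mu>') (Pi\<^sub>E S U) = (\<Prod>q\<in>S. emeasure (\<mu> q) (U q))"
    if "\<forall>q\<in>S. U q \<in> padic_balls q" for U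
  proof -
    have "emeasure (Pi\<^sub>M S \<mu>') (Pi\<^sub>E S U) = (\<Prod>q\<in>S. emeasure (\<mu>' q) (U q))"
    proof (rule P.emeasure_PiM[OF S(1)])
      fix q assume q: "q \<in> S"
      then show "U q \<in> sets (\<mu>' q)"
        using that padic_haar.sets_M[OF local_haar[OF Sp[OF q]]] Sp[OF q] by (auto simp: \<mu>'_prime)
    qed
    also have "\<dots> = (\<Prod>q\<in>S. emeasure (\<mu> q) (U q))"
      using Sp by (intro prod.cong) (auto simp: \<mu>'_prime)
    finally show ?thesis .
  qed
  show ?thesis
  proof (rule measure_eqI_generator_eq_countable[where A = A])
    show "Int_stable E"
      unfolding Int_stable_def
    proof (intro ballI)
      fix X Y assume "X \<in> E" "Y \<in> E"
      then obtain U V where UV: "X = Pi\<^sub>E S U" "Y = Pi\<^sub>E S V" "\<forall>q\<in>S. U q \<in> insert {} (padic_balls q)" "\<forall>q\<in>S. V q \<in> insert {} (padic_balls q)"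
        unfolding E_def by blast
      then have "X \<inter> Y = Pi\<^sub>E S (\<lambda>q. U q \<inter> V q)" by (simp add: PiE_Int)
      moreover have "\<forall>q\<in>S. U q \<inter> V q \<in> insert {} (padic_balls q)"
        using UV(3,4) Int_stable_padic_balls[OF Sp] unfolding Int_stable_def by blast
      ultimately show "X \<inter> Y \<in> E" unfolding E_def by blast
    qed
    show "E \<subseteq> Pow (space (Pi\<^sub>M S \<mu>'))"
      using padic_balls_subset spaceq by (fastforce simp: E_def space_PiM PiE_iff)
    show "sets (Pi\<^sub>M S \<mu>') = sigma_sets (space (Pi\<^sub>M S \<mu>')) E" by (rule gen)
    show "sets (distr (restrict_space N (integral_outside S)) (Pi\<^sub>M S \<mu>') (\<lambda>x. restrict x S)) = sigma_sets (space (Pi\<^sub>M S \<mu>')) E"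
      by (simp add: gen)
    show "A \<subseteq> E" unfolding A_def E_def by (auto simp: PiE_iff)
    show "countable A"
      unfolding A_def using S countable_padic_balls Sp by (intro countable_image countable_PiE) auto
    show "emeasure (Pi\<^sub>M S \<mu>') a \<noteq> \<infinity>" if aA: "a \<in> A" for a
    proof -
      obtain U where U: "a = Pi\<^sub>E S U" "\<forall>q\<in>S. U q \<in> padic_balls q" using aA unfolding A_def by (auto simp: PiE_iff)
      show ?thesis
        unfolding U(1) meas[OF U(2)] using U(2) Sp emeasure_local_ball_finite
        by (auto simp: ennreal_prod_eq_top less_top[symmetric])
    qed
    show "\<Union>A = space (Pi\<^sub>M S \<mu>')"
    proof (intro equalityI subsetI)
      fix x assume "x \<in> \<Union>A"
      then show "x \<in> space (Pi\<^sub>M S \<mu>')"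
        using padic_balls_subset spaceq by (fastforce simp: A_def space_PiM PiE_iff)
    next
      fix x assume x: "x \<in> space (Pi\<^sub>M S \<mu>')"
      then have xq: "x q \<in> carrier (Qp q)" if "q \<in> S" for q
        using spaceq that by (auto simp: space_PiM PiE_iff)
      let ?U = "restrict (\<lambda>q. padic_ball q (x q) 0) S"
      have "?U \<in> Pi\<^sub>E S padic_balls" using xq by (auto intro: padic_ballsI)
      moreover have "x \<in> Pi\<^sub>E S ?U"
        using xq x padic_ball_self Sp by (auto simp: space_PiM PiE_iff)
      ultimately show "x \<in> \<Union>A" unfolding A_def by blast
    qed
    fix X assume "X \<in> E"
    then obtain U where U: "X = Pi\<^sub>E S U" "\<forall>q\<in>S. U q \<in> insert {} (padic_balls q)"
      unfolding E_def by blast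
    show "emeasure (Pi\<^sub>M S \<mu>') X = emeasure (distr (restrict_space N (integral_outside S)) (Pi\<^sub>M S \<mu>') (\<lambda>x. restrict x S)) X"
    proof (cases "\<exists>q\<in>S. U q = {}")
      case True
      then have "X = {}" unfolding U(1) by (auto simp: PiE_eq_empty_iff)
      then show ?thesis by simp
    next
      case False
      then have balls: "\<forall>q\<in>S. U q \<in> padic_balls q" using U(2) by auto
      let ?V = "\<lambda>q. if q \<in> S then U q else Zp q"
      have "finite {q. prime q \<and> ?V q \<noteq> Zp q}" by (rule finite_subset[OF _ S(1)]) auto
      then have box: "Pi\<^sub>E primes ?V \<in> adele_boxes"
        using balls by (intro adele_boxesI) (auto simp: Zp_in_balls)
      have vim: "(\<lambda>x. restrict x S) -` X \<inter> space (restrict_space N (integral_outside S)) = Pi\<^sub>E primes ?V"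
      proof (intro equalityI subsetI)
        fix x assume "x \<in> (\<lambda>x. restrict x S) -` X \<inter> space (restrict_space N (integral_outside S))"
        then show "x \<in> Pi\<^sub>E primes ?V"
          by (auto simp: U(1) space_restrict_space space_N integral_outside_def finite_adele_ring_simps PiE_iff)
      next
        fix x assume x: "x \<in> Pi\<^sub>E primes ?V"
        moreover have "x \<in> carrier finite_adele_ring" using x adele_box_subset[OF box] by blast
        moreover have "x q \<in> U q" if "q \<in> S" for q
          using PiE_mem[OF x, of q] Sp[OF that] that by simp
        ultimately show "x \<in> (\<lambda>x. restrict x S) -` X \<inter> space (restrict_space N (integral_outside S))"
          using Sp by (auto simp: U(1) space_restrict_space space_N integral_outside_def PiE_iff)
      qed
      have "X \<in> sets (Pi\<^sub>M S \<mu>')" unfolding gen using \<open>X \<in> E\<close> by blast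
      then have "emeasure (distr (restrict_space N (integral_outside S)) (Pi\<^sub>M S \<mu>') (\<lambda>x. restrict x S)) X =
        emeasure (restrict_space N (integral_outside S)) (Pi\<^sub>E primes ?V)"
        by (subst emeasure_distr[OF restrict_measurable[OF S(2)]]) (simp_all only: vim)
      also have "\<dots> = emeasure N (Pi\<^sub>E primes ?V)"
      proof (rule emeasure_restrict_space)
        show "Pi\<^sub>E primes ?V \<subseteq> integral_outside S"
          unfolding vim[symmetric] by (auto simp: space_restrict_space)
      qed simp
      also have "\<dots> = (\<Prod>q\<in>S. emeasure (\<mu> q) (?V q))"
        using S balls by (intro emeasure_box) auto
      also have "\<dots> = (\<Prod>q\<in>S. emeasure (\<mu> q) (U q))" by (intro prod.cong) auto
      finally show ?thesis unfolding U(1) meas[OF balls] by simp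
    qed
  qed
qed

text \<open>The indicator stands for the product of \<open>phi q\<close> over the primes outside
  \<open>S\<close>. The value type is general because squared absolute values are real and the
  wavelets complex.\<close>

definition tensor :: "nat set \<Rightarrow> (nat \<Rightarrow> padic \<Rightarrow> 'b) \<Rightarrow> (nat \<Rightarrow> padic) \<Rightarrow> 'b::{real_normed_field,banach,second_countable_topology}" where
  "tensor S f x = indicator (integral_outside S) x *\<^sub>R (\<Prod>q\<in>S. f q (x q))"

text \<open>On the adeles integral outside S the integrand depends only on the coordinates in S, so
  the integral is taken over the projected product measure, where it factors.\<close>

lemma integral_tensor:
  fixes f :: "nat \<Rightarrow> padic \<Rightarrow> 'b::{real_normed_field,banach,second_countable_topology}"
  assumes S: "finite S" "S \<subseteq> primes" and f: "\<And>q. q \<in> S \<Longrightarrow> integrable (\<mu> q) (f q)"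
  shows "integrable N (tensor S f)" "(LINT x|N. tensor S f x) = (\<Prod>q\<in>S. LINT x|\<mu> q. f q x)"
proof -
  let ?R = "restrict_space N (integral_outside S)"
  let ?g = "\<lambda>x. \<Prod>q\<in>S. f q (x q)"
  have Sp: "prime q" if "q \<in> S" for q using S(2) that by blast
  have f': "integrable (\<mu>' q) (f q)" if "q \<in> S" for q
    using f[OF that] Sp[OF that] by (simp add: \<mu>'_prime)
  have int: "integrable (Pi\<^sub>M S \<mu>') ?g"
    by (rule P.product_integrable_prod[OF S(1) f'])
  have gm: "?g \<in> borel_measurable (Pi\<^sub>M S \<mu>')" using int by simp
  note rm = restrict_measurable[OF S(2)]
  have \<Omega>: "integral_outside S \<inter> space N \<in> sets N" by simp
  have eq: "?g (restrict x S) = ?g x" for x by (intro prod.cong) auto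
  have "integrable (distr ?R (Pi\<^sub>M S \<mu>') (\<lambda>x. restrict x S)) ?g"
    using int distr_restrict_eq_PiM[OF S] by simp
  then have "integrable ?R (\<lambda>x. ?g (restrict x S))"
    by (subst (asm) integrable_distr_eq[OF rm gm])
  then show "integrable N (tensor S f)"
    unfolding eq integrable_restrict_space[OF \<Omega>] tensor_def .
  have "(LINT x|N. tensor S f x) = (LINT x|?R. ?g (restrict x S))"
    unfolding eq integral_restrict_space[OF \<Omega>] tensor_def ..
  also have "\<dots> = (LINT x|distr ?R (Pi\<^sub>M S \<mu>') (\<lambda>x. restrict x S). ?g x)"
    by (rule integral_distr[OF rm gm, symmetric])
  also have "\<dots> = (LINT x|Pi\<^sub>M S \<mu>'. ?g x)"
    using distr_restrict_eq_PiM[OF S] by simp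
  also have "\<dots> = (\<Prod>q\<in>S. integral\<^sup>L (\<mu>' q) (f q))"
    by (rule P.product_integral_prod[OF S(1) f'])
  also have "\<dots> = (\<Prod>q\<in>S. LINT x|\<mu> q. f q x)"
    using Sp by (intro prod.cong) (auto simp: \<mu>'_prime)
  finally show "(LINT x|N. tensor S f x) = (\<Prod>q\<in>S. LINT x|\<mu> q. f q x)" .
qed

lemma tensor_L2:
  assumes S: "finite S" "S \<subseteq> primes" and f: "\<And>q. q \<in> S \<Longrightarrow> f q \<in> L2 (\<mu> q)"
  shows "tensor S f \<in> L2 N"
  unfolding L2_def
proof (intro CollectI conjI)
  have "(\<lambda>x. f q (x q)) \<in> borel_measurable N" if "q \<in> S" for q
    using S(2) that L2_measurable[OF f[OF that]] by (intro measurable_compose[OF component_measurable]) auto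
  then show "tensor S f \<in> borel_measurable N"
    unfolding tensor_def by (intro borel_measurable_scaleR borel_measurable_prod borel_measurable_indicator) auto
  have "(\<lambda>x. (cmod (tensor S f x))\<^sup>2) = tensor S (\<lambda>q x. (cmod (f q x))\<^sup>2)"
    by (auto simp: fun_eq_iff tensor_def prod_norm[symmetric] power_mult_distrib prod_power_distrib indicator_def)
  then show "integrable N (\<lambda>x. (cmod (tensor S f x))\<^sup>2)"
    using integral_tensor(1)[OF S, of "\<lambda>q x. (cmod (f q x))\<^sup>2"] f L2_integrable_square by auto
qed

lemma l2_inner_tensor:
  assumes S: "finite S" "S \<subseteq> primes"
    and f: "\<And>q. q \<in> S \<Longrightarrow> f q \<in> L2 (\<mu> q)" and g: "\<And>q. q \<in> S \<Longrightarrow> g q \<in> L2 (\<mu> q)"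
  shows "l2_inner N (tensor S f) (tensor S g) = (\<Prod>q\<in>S. l2_inner (\<mu> q) (f q) (g q))"
proof -
  have "(\<lambda>x. tensor S f x * cnj (tensor S g x)) = tensor S (\<lambda>q x. f q x * cnj (g q x))"
    by (auto simp: fun_eq_iff tensor_def prod.distrib indicator_def)
  then show ?thesis
    unfolding l2_inner_def using integral_tensor(2)[OF S l2_inner_integrable[OF f g]] by simp
qed

end

section \<open>Wavelets on the finite adeles\<close>

lemma finite_adelic_indices_iff:
  "\<alpha> \<in> finite_adelic_indices \<psi> \<longleftrightarrow> \<alpha> \<in> (\<Pi>\<^sub>E q\<in>primes. haar_indices q) \<and>
     (\<exists>n. \<forall>q\<ge>n. prime q \<longrightarrow> (\<forall>x\<in>carrier (Qp q). modified_haar q (\<psi> q) (\<alpha> q) x = phi q x))"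
  by (simp add: finite_adelic_indices_def)

locale finite_adele_wavelets = finite_adele_haar +
  fixes \<psi> :: "nat \<Rightarrow> nat \<Rightarrow> padic \<Rightarrow> complex"
  assumes local_wavelets: "\<And>p. prime p \<Longrightarrow> padic_wavelets p (\<mu> p) (\<psi> p)"
begin

abbreviation (input) local_haar_fun :: "nat \<Rightarrow> haar_index \<Rightarrow> padic \<Rightarrow> complex" where
  "local_haar_fun q \<equiv> modified_haar q (\<psi> q)"

lemma local_haar_L2: "prime q \<Longrightarrow> i \<in> haar_indices q \<Longrightarrow> local_haar_fun q i \<in> L2 (\<mu> q)"
  by (rule padic_wavelets.modified_haar_L2[OF local_wavelets])

text \<open>Outside \<open>S\<close> each factor is 1 at an integral coordinate and 0 otherwise, so
  the infinite product there is the indicator of integrality.\<close>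

lemma finite_adelic_wavelet_eq_tensor:
  assumes S: "finite S" "S \<subseteq> primes"
    and \<alpha>: "\<And>q x. prime q \<Longrightarrow> q \<notin> S \<Longrightarrow> x \<in> carrier (Qp q) \<Longrightarrow> local_haar_fun q (\<alpha> q) x = phi q x"
    and x: "x \<in> carrier finite_adele_ring"
  shows "finite_adelic_wavelet \<psi> \<alpha> x = tensor S (\<lambda>q. local_haar_fun q (\<alpha> q)) x"
proof -
  let ?g = "\<lambda>q. if prime q then local_haar_fun q (\<alpha> q) (x q) else 1"
  let ?T = "{q. prime q \<and> x q \<notin> Zp q}"
  have T: "finite ?T" using x by (simp add: finite_adele_ring_simps)
  have xq: "x q \<in> carrier (Qp q)" if "prime q" for q
    using x that by (auto simp: finite_adele_ring_simps PiE_iff)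
  have out: "?g q = (if x q \<in> Zp q then 1 else 0)" if "prime q" "q \<notin> S" for q
    using that xq[OF that(1)] \<alpha>[OF that xq[OF that(1)]] padic_norm_nonneg[OF that(1) xq[OF that(1)]]
    by (simp add: phi_def Zp_def)
  \<comment> \<open>An adele has finitely many non-integral coordinates, so the factors different
    from 1 lie over the finite set \<open>S \<union> ?T\<close>.\<close>
  have "Prod_any ?g = prod ?g (S \<union> ?T)"
    by (rule Prod_any.expand_superset) (use S T out in \<open>auto split: if_splits\<close>)
  also have "\<dots> = prod ?g S * prod ?g (?T - S)"
    using S T by (subst prod.union_disjoint[symmetric]) (auto intro: prod.cong)
  also have "prod ?g S = (\<Prod>q\<in>S. local_haar_fun q (\<alpha> q) (x q))"
    using S(2) by (intro prod.cong) auto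
  also have "prod ?g (?T - S) = indicator (integral_outside S) x"
  proof (cases "x \<in> integral_outside S")
    case True
    then have "?T - S = {}" by (auto simp: integral_outside_def)
    then show ?thesis using True by (simp only: prod.empty indicator_simps)
  next
    case False
    then obtain q where q: "prime q" "q \<notin> S" "x q \<notin> Zp q" using x by (auto simp: integral_outside_def)
    then have "?g q = 0" using out by simp
    then have "prod ?g (?T - S) = 0"
      using T q by (intro prod_zero) auto
    then show ?thesis using False by simp
  qed
  finally show ?thesis
    by (simp add: finite_adelic_wavelet_def tensor_def scaleR_conv_of_real of_real_indicator mult.commute)
qed

lemma finite_adelic_index_support:
  assumes "\<alpha> \<in> finite_adelic_indices \<psi>"
  obtains n where "\<And>q x. n \<le> q \<Longrightarrow> prime q \<Longrightarrow> x \<in> carrier (Qp q) \<Longrightarrow> local_haar_fun q (\<alpha> q) x = phi q x"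
  using assms unfolding finite_adelic_indices_iff by blast

lemma finite_adelic_index_local:
  assumes "\<alpha> \<in> finite_adelic_indices \<psi>" "prime q"
  shows "\<alpha> q \<in> haar_indices q"
  using assms by (auto simp: finite_adelic_indices_iff PiE_iff)

lemma finite_adelic_wavelet_L2:
  assumes \<alpha>: "\<alpha> \<in> finite_adelic_indices \<psi>"
  shows "finite_adelic_wavelet \<psi> \<alpha> \<in> L2 N"
proof -
  obtain n where n: "\<And>q x. n \<le> q \<Longrightarrow> prime q \<Longrightarrow> x \<in> carrier (Qp q) \<Longrightarrow> local_haar_fun q (\<alpha> q) x = phi q x"
    using finite_adelic_index_support[OF \<alpha>] by blast
  let ?S = "{q. prime q \<and> q < n}"
  have "tensor ?S (\<lambda>q. local_haar_fun q (\<alpha> q)) \<in> L2 N"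
    using finite_adelic_index_local[OF \<alpha>] by (intro tensor_L2 local_haar_L2) auto
  then show ?thesis
    by (rule L2_cong) (subst finite_adelic_wavelet_eq_tensor[of ?S], auto simp: n space_N)
qed

lemma finite_adelic_wavelet_orthonormal:
  assumes \<alpha>: "\<alpha> \<in> finite_adelic_indices \<psi>" and \<beta>: "\<beta> \<in> finite_adelic_indices \<psi>"
  shows "l2_inner N (finite_adelic_wavelet \<psi> \<alpha>) (finite_adelic_wavelet \<psi> \<beta>) = (if \<alpha> = \<beta> then 1 else 0)"
proof -
  obtain n where n: "\<And>q x. n \<le> q \<Longrightarrow> prime q \<Longrightarrow> x \<in> carrier (Qp q) \<Longrightarrow> local_haar_fun q (\<alpha> q) x = phi q x"
    using finite_adelic_index_support[OF \<alpha>] by blast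
  obtain m where m: "\<And>q x. m \<le> q \<Longrightarrow> prime q \<Longrightarrow> x \<in> carrier (Qp q) \<Longrightarrow> local_haar_fun q (\<beta> q) x = phi q x"
    using finite_adelic_index_support[OF \<beta>] by blast
  have "\<exists>r. \<alpha> = \<beta> \<or> (prime r \<and> \<alpha> r \<noteq> \<beta> r)"
    using \<alpha> \<beta> PiE_ext[of \<alpha> primes haar_indices \<beta>] by (auto simp: finite_adelic_indices_iff)
  then obtain r where r: "\<alpha> = \<beta> \<or> (prime r \<and> \<alpha> r \<noteq> \<beta> r)" by blast
  \<comment> \<open>One finite set for both indices. It also contains a prime at which they differ,
    if they do, so that a vanishing local inner product is among the factors.\<close>
  define S where "S = {q. prime q \<and> q < max (max n m) (Suc r)}"
  have S: "finite S" "S \<subseteq> primes" by (auto simp: S_def)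
  have "l2_inner N (finite_adelic_wavelet \<psi> \<alpha>) (finite_adelic_wavelet \<psi> \<beta>) =
    l2_inner N (tensor S (\<lambda>q. local_haar_fun q (\<alpha> q))) (tensor S (\<lambda>q. local_haar_fun q (\<beta> q)))"
    by (rule l2_inner_cong; subst finite_adelic_wavelet_eq_tensor[OF S]) (auto simp: n m S_def space_N)
  also have "\<dots> = (\<Prod>q\<in>S. l2_inner (\<mu> q) (local_haar_fun q (\<alpha> q)) (local_haar_fun q (\<beta> q)))"
    using S(2) finite_adelic_index_local[OF \<alpha>] finite_adelic_index_local[OF \<beta>]
    by (intro l2_inner_tensor[OF S] local_haar_L2) auto
  also have "\<dots> = (\<Prod>q\<in>S. if \<alpha> q = \<beta> q then 1 else 0)"
    using S(2) finite_adelic_index_local[OF \<alpha>] finite_adelic_index_local[OF \<beta>]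
    by (intro prod.cong refl padic_wavelets.modified_haar_orthonormal[OF local_wavelets]) auto
  also have "\<dots> = (if \<alpha> = \<beta> then 1 else 0)"
  proof (cases "\<alpha> = \<beta>")
    case False
    then have "r \<in> S" "\<alpha> r \<noteq> \<beta> r" using r by (auto simp: S_def)
    then have "(\<Prod>q\<in>S. if \<alpha> q = \<beta> q then 1 else (0::complex)) = 0"
      using S(1) by (intro prod_zero) auto
    then show ?thesis using False by simp
  qed simp
  finally show ?thesis .
qed

abbreviation (input) wavelet_set :: "((nat \<Rightarrow> padic) \<Rightarrow> complex) set" where
  "wavelet_set \<equiv> finite_adelic_wavelet \<psi> ` finite_adelic_indices \<psi>"

lemma wavelet_set_L2: "wavelet_set \<subseteq> L2 N"
  using finite_adelic_wavelet_L2 by blast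

text \<open>\<open>phi\<close> itself belongs to every local basis, as the translate by zero; it
  pads an index given on finitely many primes.\<close>

lemma Scaling_zero:
  assumes "prime q"
  shows "Scaling \<zero>\<^bsub>Qp q\<^esub> \<in> haar_indices q"
    and "x \<in> carrier (Qp q) \<Longrightarrow> local_haar_fun q (Scaling \<zero>\<^bsub>Qp q\<^esub>) x = phi q x"
proof -
  interpret K: cring "Qp q" by (rule Qp_cring[OF assms])
  show "Scaling \<zero>\<^bsub>Qp q\<^esub> \<in> haar_indices q"
    using zero_in_Ip[OF assms] by (simp add: haar_indices_def)
  show "local_haar_fun q (Scaling \<zero>\<^bsub>Qp q\<^esub>) x = phi q x" if "x \<in> carrier (Qp q)"
    using that by (simp add: padic_shift_def a_minus_def)
qed

lemma tensor_haar_in_span: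
  assumes S: "finite S" "S \<subseteq> primes" and f: "\<And>q. q \<in> S \<Longrightarrow> f q \<in> local_haar_fun q ` haar_indices q"
  shows "tensor S f \<in> closed_span N wavelet_set"
proof -
  obtain \<beta> where \<beta>: "\<And>q. q \<in> S \<Longrightarrow> \<beta> q \<in> haar_indices q \<and> f q = local_haar_fun q (\<beta> q)"
    using f unfolding image_iff by metis
  define \<alpha> where "\<alpha> = (\<lambda>q\<in>primes. if q \<in> S then \<beta> q else Scaling \<zero>\<^bsub>Qp q\<^esub>)"
  have out: "local_haar_fun q (\<alpha> q) x = phi q x" if "prime q" "q \<notin> S" "x \<in> carrier (Qp q)" for q x
    using that Scaling_zero(2) by (simp add: \<alpha>_def)
  obtain n where n: "\<forall>q\<in>S. q < n"
    using finite_nat_set_iff_bounded[THEN iffD1, OF S(1)] by blast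
  have "\<alpha> \<in> finite_adelic_indices \<psi>"
    unfolding finite_adelic_indices_iff
  proof (intro conjI exI[of _ n] allI impI ballI)
    show "\<alpha> \<in> (\<Pi>\<^sub>E q\<in>primes. haar_indices q)"
      using \<beta> Scaling_zero(1) by (auto simp: \<alpha>_def)
    fix q x assume "n \<le> q" "prime q" "x \<in> carrier (Qp q)"
    then show "local_haar_fun q (\<alpha> q) x = phi q x" using n by (intro out) auto
  qed
  then have "finite_adelic_wavelet \<psi> \<alpha> \<in> closed_span N wavelet_set"
    by (intro closed_span_base[OF wavelet_set_L2] imageI)
  then show ?thesis
  proof (rule closed_span_cong)
    fix x assume "x \<in> space N"
    then have "finite_adelic_wavelet \<psi> \<alpha> x = tensor S (\<lambda>q. local_haar_fun q (\<alpha> q)) x"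
      by (intro finite_adelic_wavelet_eq_tensor[OF S] out) (auto simp: space_N)
    also have "\<dots> = tensor S f x"
      unfolding tensor_def using \<beta> S(2) by (intro arg_cong2[of _ _ _ _ scaleR] refl prod.cong) (auto simp: \<alpha>_def)
    finally show "finite_adelic_wavelet \<psi> \<alpha> x = tensor S f x" .
  qed
qed

lemma l2_norm_tensor:
  assumes S: "finite S" "S \<subseteq> primes" and f: "\<And>q. q \<in> S \<Longrightarrow> f q \<in> L2 (\<mu> q)"
  shows "l2_norm N (tensor S f) = (\<Prod>q\<in>S. l2_norm (\<mu> q) (f q))"
proof -
  have "complex_of_real ((l2_norm N (tensor S f))\<^sup>2) = of_real ((\<Prod>q\<in>S. l2_norm (\<mu> q) (f q))\<^sup>2)"
    using l2_inner_tensor[OF S f f]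
    by (simp add: l2_inner_self l2_norm_square[symmetric] prod_power_distrib del: of_real_power)
  then have "(l2_norm N (tensor S f))\<^sup>2 = (\<Prod>q\<in>S. l2_norm (\<mu> q) (f q))\<^sup>2"
    unfolding of_real_eq_iff .
  then show ?thesis
    by (simp add: l2_norm_nonneg prod_nonneg)
qed

text \<open>Exhibits the linear dependence on a single factor, from which the linearity conditions
  of \<open>closed_span_linear_image\<close> are read off.\<close>

lemma tensor_update:
  assumes "finite S" "q \<in> S"
  shows "tensor S (f(q := g)) x = g (x q) * (indicator (integral_outside S) x *\<^sub>R (\<Prod>r\<in>S - {q}. f r (x r)))"
proof -
  have "(\<Prod>r\<in>S. (f(q := g)) r (x r)) = g (x q) * (\<Prod>r\<in>S - {q}. (f(q := g)) r (x r))"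
    using assms by (subst prod.remove) auto
  also have "(\<Prod>r\<in>S - {q}. (f(q := g)) r (x r)) = (\<Prod>r\<in>S - {q}. f r (x r))"
    by (intro prod.cong) auto
  finally show ?thesis by (simp add: tensor_def)
qed

text \<open>The local bases are passed from finite linear combinations to arbitrary square-integrable
  functions one coordinate at a time.\<close>

lemma tensor_in_span:
  assumes S: "finite S" "S \<subseteq> primes" and T: "T \<subseteq> S"
    and f: "\<And>q. q \<in> S - T \<Longrightarrow> f q \<in> local_haar_fun q ` haar_indices q" "\<And>q. q \<in> T \<Longrightarrow> f q \<in> L2 (\<mu> q)"
  shows "tensor S f \<in> closed_span N wavelet_set"
  using finite_subset[OF T S(1)] T f
proof (induction T arbitrary: f)
  case empty
  then show ?case using tensor_haar_in_span[OF S] by simp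
next
  case (insert q T)
  have q: "q \<in> S" "prime q" using insert.prems(1) S(2) by auto
  have fL: "f r \<in> L2 (\<mu> r)" if "r \<in> S" for r
  proof (cases "r \<in> insert q T")
    case False
    have "local_haar_fun r ` haar_indices r \<subseteq> L2 (\<mu> r)" using local_haar_L2 that S(2) by blast
    then show ?thesis using insert.prems(2)[of r] that False by blast
  qed (rule insert.prems(3))
  have upd: "(f(q := g)) r \<in> L2 (\<mu> r)" if "g \<in> L2 (\<mu> q)" "r \<in> S" for g r
    using fL that by auto
  have "tensor S (f(q := f q)) \<in> closed_span N wavelet_set"
  proof (rule closed_span_linear_image[where A = "\<lambda>g. tensor S (f(q := g))" and M = "\<mu> q"
        and S = "local_haar_fun q ` haar_indices q" and C = "\<Prod>r\<in>S - {q}. l2_norm (\<mu> r) (f r)"])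
    show "local_haar_fun q ` haar_indices q \<subseteq> L2 (\<mu> q)"
      using local_haar_L2[OF q(2)] by blast
    show "f q \<in> closed_span (\<mu> q) (local_haar_fun q ` haar_indices q)"
      using padic_wavelets.modified_haar_basis[OF local_wavelets[OF q(2)]] fL[OF q(1)]
      by (simp add: orthonormal_basis_def)
    show "tensor S (f(q := b)) \<in> closed_span N wavelet_set" if b: "b \<in> local_haar_fun q ` haar_indices q" for b
    proof (rule insert.IH)
      fix r assume "r \<in> S - T"
      then show "(f(q := b)) r \<in> local_haar_fun r ` haar_indices r"
        using b insert.prems(2)[of r] by (cases "r = q") auto
    qed (use insert in auto)
    fix g assume g: "g \<in> L2 (\<mu> q)"
    show "tensor S (f(q := g)) \<in> L2 N"
      by (rule tensor_L2[OF S upd[OF g]])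
    have "l2_norm N (tensor S (f(q := g))) = (\<Prod>r\<in>S. l2_norm (\<mu> r) ((f(q := g)) r))"
      by (rule l2_norm_tensor[OF S upd[OF g]])
    also have "\<dots> = (\<Prod>r\<in>S - {q}. l2_norm (\<mu> r) (f r)) * l2_norm (\<mu> q) g"
      using S(1) q(1) by (subst prod.remove) (auto intro!: prod.cong)
    finally show "l2_norm N (tensor S (f(q := g))) \<le> (\<Prod>r\<in>S - {q}. l2_norm (\<mu> r) (f r)) * l2_norm (\<mu> q) g"
      by simp
  next
    fix g h show "tensor S (f(q := \<lambda>x. g x - h x)) = (\<lambda>x. tensor S (f(q := g)) x - tensor S (f(q := h)) x)"
      unfolding fun_eq_iff tensor_update[OF S(1) q(1)] by (simp add: left_diff_distrib scaleR_right_diff_distrib)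
  next
    fix B c show "tensor S (f(q := \<lambda>x. \<Sum>b\<in>B. c b * b x)) = (\<lambda>x. \<Sum>b\<in>B. c b * tensor S (f(q := b)) x)"
      unfolding fun_eq_iff tensor_update[OF S(1) q(1)]
      by (simp add: sum_distrib_right mult.assoc scaleR_sum_right)
  qed (rule wavelet_set_L2)
  then show ?case by simp
qed

text \<open>With S the set of primes where a side differs from Z_q, the indicator of the box is the
  tensor of the local indicators over S.\<close>

lemma box_in_span:
  assumes "B \<in> adele_boxes"
  shows "indicator B \<in> closed_span N wavelet_set"
proof -
  obtain U where U: "B = Pi\<^sub>E primes U" "\<forall>q\<in>primes. U q \<in> padic_balls q" "finite {q. prime q \<and> U q \<noteq> Zp q}"
    using assms by (auto simp: adele_boxes_def)
  define S where "S = {q. prime q \<and> U q \<noteq> Zp q}"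
  have S: "finite S" "S \<subseteq> primes" using U(3) by (auto simp: S_def)
  have UL: "(indicator (U q) :: padic \<Rightarrow> complex) \<in> L2 (\<mu> q)" if "prime q" for q
    using U(2) that padic_haar.sets_M[OF local_haar[OF that]] emeasure_local_ball_finite[OF that]
    by (intro L2_indicator) auto
  have "tensor S (\<lambda>q. indicator (U q)) \<in> closed_span N wavelet_set"
    by (rule tensor_in_span[OF S order_refl]) (use UL S(2) in auto)
  then show ?thesis
  proof (rule closed_span_cong)
    fix x assume x: "x \<in> space N"
    have xB: "x \<in> B \<longleftrightarrow> x \<in> integral_outside S \<and> (\<forall>q\<in>S. x q \<in> U q)"
      using x S(2) unfolding U(1)
      by (auto simp: integral_outside_def space_N finite_adele_ring_simps PiE_iff S_def)
    have pr: "(\<Prod>q\<in>S. indicator (U q) (x q)) = (if \<forall>q\<in>S. x q \<in> U q then 1 else (0::complex))"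
      using S(1) by (auto simp: indicator_def intro: prod.neutral)
    show "tensor S (\<lambda>q. indicator (U q)) x = (indicator B x :: complex)"
      unfolding tensor_def by (simp only: pr) (simp add: indicator_def xB)
  qed
qed

theorem finite_adelic_wavelet_basis:
  "orthonormal_basis N (L2 N) (finite_adelic_indices \<psi>) (finite_adelic_wavelet \<psi>)"
  unfolding orthonormal_basis_def
proof (intro conjI ballI)
  show "closed_span N wavelet_set = L2 N"
  proof (rule closed_span_eq_L2[OF wavelet_set_L2 Int_stable_adele_boxes adele_boxes_Pow sets_N' _ _ countable_adele_boxes])
    fix X assume "X \<in> insert {} adele_boxes"
    then show "(indicator X :: (nat \<Rightarrow> padic) \<Rightarrow> complex) \<in> closed_span N wavelet_set" "emeasure N X < \<infinity>"
      using box_in_span closed_span_zero[OF wavelet_set_L2] emeasure_box_finite by (auto simp: indicator_empty_eq_zero)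
  qed (auto simp: Union_adele_boxes space_N)
qed (use finite_adelic_wavelet_L2 finite_adelic_wavelet_orthonormal in auto)

end

section \<open>The adele ring\<close>

definition tensor2 :: "('a \<Rightarrow> 'c) \<Rightarrow> ('b \<Rightarrow> 'c) \<Rightarrow> 'a \<times> 'b \<Rightarrow> 'c::real_normed_field" where
  "tensor2 f g = (\<lambda>(x, y). f x * g y)"

context pair_sigma_finite
begin

lemma integral_tensor2:
  fixes f :: "'a \<Rightarrow> 'c::{real_normed_field,banach,second_countable_topology}"
  assumes f: "integrable M1 f" and g: "integrable M2 g"
  shows "integrable (M1 \<Otimes>\<^sub>M M2) (tensor2 f g)"
    and "(LINT z|(M1 \<Otimes>\<^sub>M M2). tensor2 f g z) = (LINT x|M1. f x) * (LINT y|M2. g y)"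
proof -
  have [measurable]: "f \<in> borel_measurable M1" "g \<in> borel_measurable M2" using f g by auto
  show int: "integrable (M1 \<Otimes>\<^sub>M M2) (tensor2 f g)"
  proof (rule Fubini_integrable)
    show "tensor2 f g \<in> borel_measurable (M1 \<Otimes>\<^sub>M M2)" unfolding tensor2_def by measurable
    show "integrable M1 (\<lambda>x. LINT y|M2. norm (tensor2 f g (x, y)))"
      using f by (simp add: tensor2_def norm_mult)
    show "AE x in M1. integrable M2 (\<lambda>y. tensor2 f g (x, y))"
      using g by (simp add: tensor2_def)
  qed
  show "(LINT z|(M1 \<Otimes>\<^sub>M M2). tensor2 f g z) = (LINT x|M1. f x) * (LINT y|M2. g y)"
    unfolding integral_fst'[OF int, symmetric] by (simp add: tensor2_def)
qed

lemma tensor2_L2: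
  assumes "f \<in> L2 M1" "g \<in> L2 M2"
  shows "tensor2 f g \<in> L2 (M1 \<Otimes>\<^sub>M M2)"
  unfolding L2_def
proof (intro CollectI conjI)
  have [measurable]: "f \<in> borel_measurable M1" "g \<in> borel_measurable M2" using assms by (auto simp: L2_def)
  show "tensor2 f g \<in> borel_measurable (M1 \<Otimes>\<^sub>M M2)" unfolding tensor2_def by measurable
  have "(\<lambda>z. (cmod (tensor2 f g z))\<^sup>2) = tensor2 (\<lambda>x. (cmod (f x))\<^sup>2) (\<lambda>y. (cmod (g y))\<^sup>2)"
    by (simp add: fun_eq_iff tensor2_def norm_mult power_mult_distrib)
  then show "integrable (M1 \<Otimes>\<^sub>M M2) (\<lambda>z. (cmod (tensor2 f g z))\<^sup>2)"
    using integral_tensor2(1)[OF L2_integrable_square[OF assms(1)] L2_integrable_square[OF assms(2)]] by simp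
qed

lemma l2_inner_tensor2:
  assumes "f \<in> L2 M1" "g \<in> L2 M2" "f' \<in> L2 M1" "g' \<in> L2 M2"
  shows "l2_inner (M1 \<Otimes>\<^sub>M M2) (tensor2 f g) (tensor2 f' g') = l2_inner M1 f f' * l2_inner M2 g g'"
proof -
  have "(\<lambda>z. tensor2 f g z * cnj (tensor2 f' g' z)) = tensor2 (\<lambda>x. f x * cnj (f' x)) (\<lambda>y. g y * cnj (g' y))"
    by (simp add: fun_eq_iff tensor2_def)
  then show ?thesis
    unfolding l2_inner_def
    using integral_tensor2(2)[OF l2_inner_integrable[OF assms(1,3)] l2_inner_integrable[OF assms(2,4)]] by simp
qed

lemma l2_norm_tensor2:
  assumes "f \<in> L2 M1" "g \<in> L2 M2"
  shows "l2_norm (M1 \<Otimes>\<^sub>M M2) (tensor2 f g) = l2_norm M1 f * l2_norm M2 g"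
proof -
  have "complex_of_real ((l2_norm (M1 \<Otimes>\<^sub>M M2) (tensor2 f g))\<^sup>2) = of_real ((l2_norm M1 f * l2_norm M2 g)\<^sup>2)"
    using l2_inner_tensor2[OF assms assms]
    by (simp add: l2_inner_self l2_norm_square[symmetric] power_mult_distrib del: of_real_power)
  then have "(l2_norm (M1 \<Otimes>\<^sub>M M2) (tensor2 f g))\<^sup>2 = (l2_norm M1 f * l2_norm M2 g)\<^sup>2"
    unfolding of_real_eq_iff .
  then show ?thesis by (simp add: l2_norm_nonneg)
qed

text \<open>Completeness is obtained by replacing first one factor and then the other by an
  arbitrary square-integrable function; products of two indicators are the indicators of
  rectangles.\<close>

lemma orthonormal_basis_tensor2:
  assumes e: "orthonormal_basis M1 (L2 M1) I e" and e': "orthonormal_basis M2 (L2 M2) J e'"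
  shows "orthonormal_basis (M1 \<Otimes>\<^sub>M M2) (L2 (M1 \<Otimes>\<^sub>M M2)) (I \<times> J) (\<lambda>(i, j). tensor2 (e i) (e' j))"
proof -
  let ?e = "\<lambda>(i, j). tensor2 (e i) (e' j)"
  let ?T = "?e ` (I \<times> J)" and ?P = "M1 \<Otimes>\<^sub>M M2"
  have e1: "e i \<in> L2 M1" if "i \<in> I" for i using e that by (simp add: orthonormal_basis_def)
  have e2: "e' j \<in> L2 M2" if "j \<in> J" for j using e' that by (simp add: orthonormal_basis_def)
  have T: "?T \<subseteq> L2 ?P" using e1 e2 tensor2_L2 by auto
  have span1: "closed_span M1 (e ` I) = L2 M1" using e by (simp add: orthonormal_basis_def)
  have span2: "closed_span M2 (e' ` J) = L2 M2" using e' by (simp add: orthonormal_basis_def)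
  have left: "tensor2 (e i) g \<in> closed_span ?P ?T" if i: "i \<in> I" and g: "g \<in> L2 M2" for i g
  proof (rule closed_span_linear_image[where A = "tensor2 (e i)" and M = M2 and S = "e' ` J" and C = "l2_norm M1 (e i)"])
    show "g \<in> closed_span M2 (e' ` J)" using g span2 by simp
    show "tensor2 (e i) b \<in> closed_span ?P ?T" if "b \<in> e' ` J" for b
      using i that by (intro closed_span_base[OF T]) auto
    show "tensor2 (e i) h \<in> L2 ?P" "l2_norm ?P (tensor2 (e i) h) \<le> l2_norm M1 (e i) * l2_norm M2 h"
      if "h \<in> L2 M2" for h
      using tensor2_L2[OF e1[OF i] that] l2_norm_tensor2[OF e1[OF i] that] by auto
  qed (use e2 T in \<open>auto simp: tensor2_def fun_eq_iff right_diff_distrib sum_distrib_left mult_ac\<close>)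
  have both: "tensor2 f g \<in> closed_span ?P ?T" if f: "f \<in> L2 M1" and g: "g \<in> L2 M2" for f g
  proof (rule closed_span_linear_image[where A = "\<lambda>f. tensor2 f g" and M = M1 and S = "e ` I" and C = "l2_norm M2 g"])
    show "f \<in> closed_span M1 (e ` I)" using f span1 by simp
    show "tensor2 b g \<in> closed_span ?P ?T" if "b \<in> e ` I" for b
      using that left g by auto
    show "tensor2 h g \<in> L2 ?P" "l2_norm ?P (tensor2 h g) \<le> l2_norm M2 g * l2_norm M1 h"
      if "h \<in> L2 M1" for h
      using tensor2_L2[OF that g] l2_norm_tensor2[OF that g] by auto
  qed (use e1 T in \<open>auto simp: tensor2_def fun_eq_iff left_diff_distrib sum_distrib_right mult.assoc\<close>)
  show ?thesis
    unfolding orthonormal_basis_def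
  proof (intro conjI ballI)
    fix a b assume "a \<in> I \<times> J" "b \<in> I \<times> J"
    then obtain i j i' j' where ij: "a = (i, j)" "b = (i', j')" "i \<in> I" "j \<in> J" "i' \<in> I" "j' \<in> J" by auto
    have "l2_inner M1 (e i) (e i') = (if i = i' then 1 else 0)" "l2_inner M2 (e' j) (e' j') = (if j = j' then 1 else 0)"
      using e e' ij by (auto simp: orthonormal_basis_def)
    then show "l2_inner ?P (?e a) (?e b) = (if a = b then 1 else 0)"
      using ij e1 e2 by (simp add: l2_inner_tensor2)
  next
    \<comment> \<open>Only rectangles with sides of finite measure, since their indicators must be
      square-integrable; sigma-finiteness shows that they still generate.\<close>
    let ?E = "{A \<times> B | A B. A \<in> sets M1 \<and> B \<in> sets M2 \<and> emeasure M1 A < \<infinity> \<and> emeasure M2 B < \<infinity>}"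
    obtain F1 :: "nat \<Rightarrow> 'a set" where F1: "range F1 \<subseteq> sets M1" "(\<Union>i. F1 i) = space M1" "\<And>i. emeasure M1 (F1 i) \<noteq> \<infinity>"
      using M1.sigma_finite by metis
    obtain F2 :: "nat \<Rightarrow> 'b set" where F2: "range F2 \<subseteq> sets M2" "(\<Union>i. F2 i) = space M2" "\<And>i. emeasure M2 (F2 i) \<noteq> \<infinity>"
      using M2.sigma_finite by metis
    have em: "emeasure ?P (A \<times> B) = emeasure M1 A * emeasure M2 B" if "A \<in> sets M1" "B \<in> sets M2" for A B
      using that by (rule M2.emeasure_pair_measure_Times)
    show "closed_span ?P ?T = L2 ?P"
    proof (rule closed_span_eq_L2[OF T, where E = ?E and C = "(\<lambda>(i, j). F1 i \<times> F2 j) ` (UNIV :: (nat \<times> nat) set)"])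
      show "Int_stable ?E"
        unfolding Int_stable_def
      proof (intro ballI)
        fix X Y assume "X \<in> ?E" "Y \<in> ?E"
        then obtain A B A' B' where AB: "X = A \<times> B" "Y = A' \<times> B'" "A \<in> sets M1" "B \<in> sets M2" "A' \<in> sets M1" "B' \<in> sets M2"
          "emeasure M1 A < \<infinity>" "emeasure M2 B < \<infinity>" by blast
        have "emeasure M1 (A \<inter> A') < \<infinity>" "emeasure M2 (B \<inter> B') < \<infinity>"
          using AB by (auto intro: le_less_trans[OF emeasure_mono])
        then show "X \<inter> Y \<in> ?E"
          unfolding AB Times_Int_Times using AB by blast
      qed
      show "?E \<subseteq> Pow (space ?P)"
        using sets.sets_into_space[of _ M1] sets.sets_into_space[of _ M2] by (auto simp: space_pair_measure)
      show "sets ?P = sigma_sets (space ?P) ?E"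
      proof
        show "sigma_sets (space ?P) ?E \<subseteq> sets ?P"
          by (rule sets.sigma_sets_subset) auto
        show "sets ?P \<subseteq> sigma_sets (space ?P) ?E"
          unfolding sets_pair_measure space_pair_measure[symmetric]
        proof (rule sigma_sets_mono, rule subsetI)
          fix X assume "X \<in> {a \<times> b |a b. a \<in> sets M1 \<and> b \<in> sets M2}"
          then obtain A B where AB: "X = A \<times> B" "A \<in> sets M1" "B \<in> sets M2" by blast
          \<comment> \<open>An arbitrary measurable rectangle is cut along the two exhaustions, with
            pairs of indices coded by single numbers.\<close>
          have "X = (\<Union>n. (A \<inter> F1 (fst (prod_decode n))) \<times> (B \<inter> F2 (snd (prod_decode n))))"
          proof (intro equalityI subsetI)
            fix z assume z: "z \<in> X"
            then have "fst z \<in> space M1" "snd z \<in> space M2"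
              using AB sets.sets_into_space[OF AB(2)] sets.sets_into_space[OF AB(3)] by auto
            then obtain i j where "fst z \<in> F1 i" "snd z \<in> F2 j" using F1(2) F2(2) by blast
            then show "z \<in> (\<Union>n. (A \<inter> F1 (fst (prod_decode n))) \<times> (B \<inter> F2 (snd (prod_decode n))))"
              using z AB(1) by (intro UN_I[of "prod_encode (i, j)"]) auto
          qed (auto simp: AB(1))
          also have "\<dots> \<in> sigma_sets (space ?P) ?E"
          proof (rule sigma_sets.Union, rule sigma_sets.Basic)
            fix n
            let ?A = "A \<inter> F1 (fst (prod_decode n))" and ?B = "B \<inter> F2 (snd (prod_decode n))"
            have "?A \<in> sets M1" "?B \<in> sets M2" using AB F1(1) F2(1) by auto
            moreover have "emeasure M1 ?A < \<infinity>"
              using F1 by (intro le_less_trans[OF emeasure_mono[of ?A "F1 (fst (prod_decode n))"]]) (auto simp: less_top)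
            moreover have "emeasure M2 ?B < \<infinity>"
              using F2 by (intro le_less_trans[OF emeasure_mono[of ?B "F2 (snd (prod_decode n))"]]) (auto simp: less_top)
            ultimately show "?A \<times> ?B \<in> ?E" by blast
          qed
          finally show "X \<in> sigma_sets (space ?P) ?E" .
        qed
      qed
      show "countable ((\<lambda>(i, j). F1 i \<times> F2 j) ` (UNIV :: (nat \<times> nat) set))" by simp
      show "(\<lambda>(i, j). F1 i \<times> F2 j) ` (UNIV :: (nat \<times> nat) set) \<subseteq> ?E"
      proof
        fix X assume "X \<in> (\<lambda>(i, j). F1 i \<times> F2 j) ` (UNIV :: (nat \<times> nat) set)"
        then obtain i j where X: "X = F1 i \<times> F2 j" by auto
        have "F1 i \<in> sets M1" "F2 j \<in> sets M2" using F1(1) F2(1) by auto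
        moreover have "emeasure M1 (F1 i) < \<infinity>" "emeasure M2 (F2 j) < \<infinity>"
          using F1(3)[of i] F2(3)[of j] by (auto simp: less_top)
        ultimately show "X \<in> ?E" unfolding X by blast
      qed
      show "\<Union>((\<lambda>(i, j). F1 i \<times> F2 j) ` (UNIV :: (nat \<times> nat) set)) = space ?P"
        unfolding space_pair_measure F1(2)[symmetric] F2(2)[symmetric] by auto
    next
      fix X assume "X \<in> ?E"
      then obtain A B where AB: "X = A \<times> B" "A \<in> sets M1" "B \<in> sets M2" "emeasure M1 A < \<infinity>" "emeasure M2 B < \<infinity>" by blast
      have "(indicator X :: _ \<Rightarrow> complex) = tensor2 (indicator A) (indicator B)"
        by (auto simp: AB(1) fun_eq_iff tensor2_def indicator_def)
      then show "(indicator X :: _ \<Rightarrow> complex) \<in> closed_span ?P ?T"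
        using both AB by (simp add: L2_indicator)
      show "emeasure ?P X < \<infinity>"
        using AB by (simp add: em ennreal_mult_less_top)
    qed
  qed (use e1 e2 tensor2_L2 in auto)
qed

end

text \<open>Uniqueness relative to \<open>N\<close>: both sides are determined by the same product
  of local volumes. It will be applied to the volume of a product with a fixed real
  interval.\<close>

lemma (in finite_adele_haar) box_function_eq:
  fixes G :: "(nat \<Rightarrow> padic) set \<Rightarrow> ennreal"
  assumes trans: "\<And>g B. g \<in> carrier finite_adele_ring \<Longrightarrow> B \<in> adele_boxes \<Longrightarrow>
      G ((\<lambda>x. g \<oplus>\<^bsub>finite_adele_ring\<^esub> x) ` B) = G B"
    and add: "\<And>n B. (\<And>i. i < n \<Longrightarrow> B i \<in> adele_boxes) \<Longrightarrow> disjoint_family_on B {..<n} \<Longrightarrow>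
      G (\<Union>i<(n::nat). B i) = (\<Sum>i<n. G (B i))"
    and B: "B \<in> adele_boxes"
  shows "G B = G Z_hat * emeasure N B"
proof -
  obtain U where U: "B = Pi\<^sub>E primes U" "\<forall>q\<in>primes. U q \<in> padic_balls q" "finite {q. prime q \<and> U q \<noteq> Zp q}"
    using B by (auto simp: adele_boxes_def)
  let ?S = "{q. prime q \<and> U q \<noteq> Zp q}"
  have "G B = G Z_hat * (\<Prod>q\<in>?S. emeasure (\<mu> q) (U q))"
    unfolding U(1)
  proof (rule adele_box_function_unique[OF trans add])
    show "emeasure (\<mu> q) (padic_ball q c k) = ennreal (real q powi (- k))"
      if "prime q" "c \<in> carrier (Qp q)" for q c k
      using padic_haar.emeasure_ball[OF local_haar] that by blast
  qed (use U in auto)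
  also have "(\<Prod>q\<in>?S. emeasure (\<mu> q) (U q)) = emeasure N B"
    unfolding U(1) using U by (intro emeasure_box[symmetric]) auto
  finally show ?thesis .
qed

lemma adele_translate:
  "(\<lambda>x. (t, g) \<oplus>\<^bsub>adele_ring\<^esub> x) ` (D \<times> B) = ((+) t ` D) \<times> ((\<lambda>x. g \<oplus>\<^bsub>finite_adele_ring\<^esub> x) ` B)"
  by (force simp: adele_ring_def)

text \<open>Lets the real coordinate be translated alone, by adding the zero finite adele.\<close>

lemma finite_adele_zero:
  "\<zero>\<^bsub>finite_adele_ring\<^esub> \<in> carrier finite_adele_ring"
  "x \<in> carrier finite_adele_ring \<Longrightarrow> \<zero>\<^bsub>finite_adele_ring\<^esub> \<oplus>\<^bsub>finite_adele_ring\<^esub> x = x"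
proof -
  have zero: "\<zero>\<^bsub>Qp r\<^esub> \<in> carrier (Qp r)" "\<zero>\<^bsub>Qp r\<^esub> \<in> Zp r" if "prime r" for r
    using cring.cring_simprules(2)[OF Qp_cring[OF that]] padic_ball_self[OF that] by (auto simp: Zp_eq_ball[OF that])
  have z: "\<zero>\<^bsub>finite_adele_ring\<^esub> = (\<lambda>q\<in>primes. \<zero>\<^bsub>Qp q\<^esub>)"
    by (simp add: finite_adele_ring_def)
  have "{q. prime q \<and> (\<lambda>q\<in>primes. \<zero>\<^bsub>Qp q\<^esub>) q \<notin> Zp q} = {}" using zero by auto
  then show "\<zero>\<^bsub>finite_adele_ring\<^esub> \<in> carrier finite_adele_ring"
    unfolding z finite_adele_ring_simps using zero by auto
  show "\<zero>\<^bsub>finite_adele_ring\<^esub> \<oplus>\<^bsub>finite_adele_ring\<^esub> x = x" if x: "x \<in> carrier finite_adele_ring"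
  proof
    fix q
    show "(\<zero>\<^bsub>finite_adele_ring\<^esub> \<oplus>\<^bsub>finite_adele_ring\<^esub> x) q = x q"
    proof (cases "prime q")
      case True
      interpret K: cring "Qp q" by (rule Qp_cring[OF True])
      show ?thesis using True x by (auto simp: z finite_adele_ring_simps PiE_iff)
    next
      case False
      then show ?thesis using x by (auto simp: finite_adele_ring_simps PiE_iff extensional_def)
    qed
  qed
qed

lemma dyadic_translate: "(+) (of_int n * 2 powi (- j)) ` dyadic j 0 = dyadic j n"
proof -
  have "(+) (of_int n * 2 powi (- j)) ` {0 ..< (2 powi (- j) :: real)} = {of_int n * 2 powi (- j) ..< of_int n * 2 powi (- j) + 2 powi (- j)}"
    by (simp add: image_add_atLeastLessThan' add.commute)
  then show ?thesis by (simp add: dyadic_eq_interval distrib_right add.commute)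
qed

section \<open>Haar measure of the full adele ring\<close>

locale adele_haar = finite_adele_haar +
  fixes A :: "(real \<times> (nat \<Rightarrow> padic)) measure"
  assumes haar_A: "haar_measure adele_ring adele_topology A"
    and normalized_A: "emeasure A ({0..1} \<times> Z_hat) = 1"
begin

lemma space_A: "space A = UNIV \<times> carrier finite_adele_ring"
  using haar_A by (simp add: haar_measure_def adele_ring_def)

lemma open_in_sets_A: "openin adele_topology U \<Longrightarrow> U \<in> sets A"
  using haar_A by (auto simp: haar_measure_def)

lemma openin_finite_adele_carrier: "openin finite_adele_topology (carrier finite_adele_ring)"
  unfolding Union_adele_boxes[symmetric] using openin_adele_box by (intro openin_Union) auto

lemma fst_measurable_A: "fst \<in> borel_measurable A"
proof (rule borel_measurableI)
  fix U :: "real set" assume "open U"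
  then have "openin adele_topology (U \<times> carrier finite_adele_ring)"
    unfolding adele_topology_def by (simp add: openin_prod_Times_iff openin_finite_adele_carrier)
  moreover have "fst -` U \<inter> space A = U \<times> carrier finite_adele_ring"
    by (auto simp: space_A)
  ultimately show "fst -` U \<inter> space A \<in> sets A" using open_in_sets_A by simp
qed

lemma snd_measurable_A: "snd \<in> A \<rightarrow>\<^sub>M N"
proof (rule measurable_sigma_sets[OF sets_N])
  show "adele_boxes \<subseteq> Pow (carrier finite_adele_ring)" using adele_box_subset by blast
  show "snd \<in> space A \<rightarrow> carrier finite_adele_ring" by (auto simp: space_A)
  fix B assume B: "B \<in> adele_boxes"
  then have "openin adele_topology (UNIV \<times> B)"
    unfolding adele_topology_def using openin_adele_box by (simp add: openin_prod_Times_iff)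
  moreover have "snd -` B \<inter> space A = UNIV \<times> B"
    using adele_box_subset[OF B] by (auto simp: space_A)
  ultimately show "snd -` B \<inter> space A \<in> sets A" using open_in_sets_A by simp
qed

lemma Times_in_sets_A:
  assumes "D \<in> sets borel" "B \<in> sets N"
  shows "D \<times> B \<in> sets A"
proof -
  have "D \<times> B = (fst -` D \<inter> space A) \<inter> (snd -` B \<inter> space A)"
    using sets.sets_into_space[OF assms(2)] by (auto simp: space_A space_N)
  then show ?thesis
    using measurable_sets[OF fst_measurable_A assms(1)] measurable_sets[OF snd_measurable_A assms(2)] by auto
qed

definition dyadic_boxes :: "(real \<times> (nat \<Rightarrow> padic)) set set" where
  "dyadic_boxes = {D \<times> B | D B. D \<in> insert {} dyadic_intervals \<and> B \<in> insert {} adele_boxes}"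

lemma dyadic_intervals_borel: "D \<in> insert {} dyadic_intervals \<Longrightarrow> D \<in> sets borel"
  by (auto simp: dyadic_intervals_def)

lemma boxes_sets: "B \<in> insert {} adele_boxes \<Longrightarrow> B \<in> sets N"
  using box_in_sets by auto

lemma countable_dyadic_boxes: "countable dyadic_boxes"
proof -
  have eq: "dyadic_boxes = (\<lambda>(D, B). D \<times> B) ` (insert {} dyadic_intervals \<times> insert {} adele_boxes)"
    unfolding dyadic_boxes_def by auto
  show ?thesis
    unfolding eq using countable_dyadic_intervals countable_adele_boxes by (intro countable_image countable_SIGMA) auto
qed

lemma dyadic_boxes_Pow: "dyadic_boxes \<subseteq> Pow (UNIV \<times> carrier finite_adele_ring)"
  using adele_box_subset by (auto simp: dyadic_boxes_def)

lemma dyadic_boxes_measurable: "X \<in> dyadic_boxes \<Longrightarrow> X \<in> sets A" "X \<in> dyadic_boxes \<Longrightarrow> X \<in> sets (lborel \<Otimes>\<^sub>M N)"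
  unfolding dyadic_boxes_def using Times_in_sets_A dyadic_intervals_borel boxes_sets by auto

lemma Union_dyadic_boxes: "\<Union>dyadic_boxes = UNIV \<times> carrier finite_adele_ring"
proof (intro equalityI subsetI)
  fix z :: "real \<times> (nat \<Rightarrow> padic)" assume "z \<in> UNIV \<times> carrier finite_adele_ring"
  then have "fst z \<in> \<Union>dyadic_intervals" "snd z \<in> \<Union>adele_boxes"
    unfolding Union_dyadic_intervals Union_adele_boxes by auto
  then obtain D B where "D \<in> dyadic_intervals" "fst z \<in> D" "B \<in> adele_boxes" "snd z \<in> B" by blast
  then show "z \<in> \<Union>dyadic_boxes"
    unfolding dyadic_boxes_def by (intro UnionI[of "D \<times> B"]) (auto simp: mem_Times_iff)
qed (use dyadic_boxes_Pow in blast)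

text \<open>Products of dyadic intervals and adelic boxes are countable in number and refine every
  open set. They generate the product sigma-algebra too, so the two measures live on the same
  sets.\<close>

lemma sets_A: "sets A = sigma_sets (UNIV \<times> carrier finite_adele_ring) dyadic_boxes"
proof
  have "sets A = sigma_sets (UNIV \<times> carrier finite_adele_ring) {U. openin adele_topology U}"
    using haar_A by (simp add: haar_measure_def adele_ring_def)
  also have "\<dots> \<subseteq> sigma_sets (UNIV \<times> carrier finite_adele_ring) dyadic_boxes"
  proof (rule sigma_sets_mono, rule subsetI)
    fix W assume "W \<in> {U. openin adele_topology U}"
    then have W: "openin (prod_topology euclidean finite_adele_topology) W"
      by (simp add: adele_topology_def)
    have "\<exists>G\<in>dyadic_boxes. z \<in> G \<and> G \<subseteq> W" if zW: "z \<in> W" for z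
    proof -
      obtain x y where z: "z = (x, y)" by fastforce
      have "\<exists>U V. openin euclidean U \<and> openin finite_adele_topology V \<and> x \<in> U \<and> y \<in> V \<and> U \<times> V \<subseteq> W"
        using W[unfolded openin_prod_topology_alt, rule_format] zW[unfolded z] by simp
      then obtain U V where UV: "open U" "openin finite_adele_topology V" "x \<in> U" "y \<in> V" "U \<times> V \<subseteq> W"
        by (simp only: open_openin[symmetric]) (elim exE conjE)
      obtain D where "D \<in> dyadic_intervals" "x \<in> D" "D \<subseteq> U" using dyadic_neighbourhood[OF UV(1,3)] by blast
      moreover obtain B where "B \<in> adele_boxes" "y \<in> B" "B \<subseteq> V" using adele_box_neighbourhood[OF UV(2,4)] by blast
      ultimately show ?thesis
        using UV(5) unfolding z dyadic_boxes_def by (intro bexI[of _ "D \<times> B"]) auto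
    qed
    then have "W = \<Union>{G \<in> dyadic_boxes. G \<subseteq> W}" by blast
    moreover have "\<Union>{G \<in> dyadic_boxes. G \<subseteq> W} \<in> sigma_sets (UNIV \<times> carrier finite_adele_ring) dyadic_boxes"
      by (rule sigma_sets_UNION) (auto intro: countable_subset[OF _ countable_dyadic_boxes])
    ultimately show "W \<in> sigma_sets (UNIV \<times> carrier finite_adele_ring) dyadic_boxes" by simp
  qed
  finally show "sets A \<subseteq> sigma_sets (UNIV \<times> carrier finite_adele_ring) dyadic_boxes" .
  show "sigma_sets (UNIV \<times> carrier finite_adele_ring) dyadic_boxes \<subseteq> sets A"
    using sets.sigma_sets_subset[of dyadic_boxes A] dyadic_boxes_measurable by (auto simp: space_A)
qed

lemma sets_pair_A: "sets (lborel \<Otimes>\<^sub>M N) = sigma_sets (UNIV \<times> carrier finite_adele_ring) dyadic_boxes"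
proof
  show "sets (lborel \<Otimes>\<^sub>M N) \<subseteq> sigma_sets (UNIV \<times> carrier finite_adele_ring) dyadic_boxes"
    unfolding sets_A[symmetric] by (rule sets_pair_in_sets) (simp add: Times_in_sets_A)
  show "sigma_sets (UNIV \<times> carrier finite_adele_ring) dyadic_boxes \<subseteq> sets (lborel \<Otimes>\<^sub>M N)"
    using sets.sigma_sets_subset[of dyadic_boxes "lborel \<Otimes>\<^sub>M N"] dyadic_boxes_measurable by (auto simp: space_pair_measure space_N)
qed

lemma translation_invariant_A:
  assumes "g \<in> carrier finite_adele_ring" "D \<in> sets borel" "B \<in> sets N"
  shows "emeasure A (((+) t ` D) \<times> ((\<lambda>x. g \<oplus>\<^bsub>finite_adele_ring\<^esub> x) ` B)) = emeasure A (D \<times> B)"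
proof -
  have "(t, g) \<in> carrier adele_ring" using assms(1) by (simp add: adele_ring_def)
  then show ?thesis
    unfolding adele_translate[symmetric] using haar_A Times_in_sets_A[OF assms(2,3)]
    by (simp add: haar_measure_def)
qed

lemma translation_invariant_real:
  assumes "D \<in> sets borel"
  shows "emeasure A (((+) t ` D) \<times> Z_hat) = emeasure A (D \<times> Z_hat)"
proof -
  have "(\<lambda>x. \<zero>\<^bsub>finite_adele_ring\<^esub> \<oplus>\<^bsub>finite_adele_ring\<^esub> x) ` Z_hat = (\<lambda>x. x) ` Z_hat"
    using adele_box_subset[OF Z_hat_box] finite_adele_zero(2) by (intro image_cong) auto
  then show ?thesis
    using translation_invariant_A[OF finite_adele_zero(1) assms box_in_sets[OF Z_hat_box], of t] by simp
qed

text \<open>Halving and translation determine all values up to the one of [0,1). The normalization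
  concerns the closed interval, so the slice over the endpoint 1 must be shown to be null.\<close>

lemma emeasure_A_dyadic: "emeasure A (dyadic j n \<times> Z_hat) = emeasure lborel (dyadic j n)"
proof -
  define h where "h j = emeasure A (dyadic j 0 \<times> Z_hat)" for j
  have Z: "Z_hat \<in> sets N" by (rule box_in_sets[OF Z_hat_box])
  have h: "emeasure A (dyadic j n \<times> Z_hat) = h j" for j n
    unfolding h_def dyadic_translate[of n j, symmetric] by (rule translation_invariant_real) simp
  have step: "h j = ennreal 2 * h (j + 1)" for j
  proof -
    have "dyadic j 0 \<times> Z_hat = dyadic (j + 1) 0 \<times> Z_hat \<union> dyadic (j + 1) 1 \<times> Z_hat"
      using dyadic_children[of j 0] by auto
    moreover have "emeasure A \<dots> = emeasure A (dyadic (j + 1) 0 \<times> Z_hat) + emeasure A (dyadic (j + 1) 1 \<times> Z_hat)"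
      using dyadic_disjoint[of 0 1 "j + 1"] Z by (intro plus_emeasure[symmetric] Times_in_sets_A) auto
    ultimately show ?thesis using h[of "j + 1" 1] by (simp add: h_def mult_2)
  qed
  have hj: "h j = h 0 * ennreal (2 powi (- j))" for j
    by (rule ennreal_geometric_recursion[of _ h, OF _ step]) simp
  have unit: "dyadic 0 0 = {0..<1}" by (simp add: dyadic_eq_interval)
  have split: "{0..1} \<times> Z_hat = dyadic 0 0 \<times> Z_hat \<union> {1} \<times> Z_hat" by (auto simp: unit)
  have eq1: "h 0 + emeasure A ({1} \<times> Z_hat) = 1"
    unfolding h_def normalized_A[symmetric] split
    using Z by (intro plus_emeasure Times_in_sets_A) (auto simp: unit)
  then have h1: "h 0 \<le> 1" by (metis le_iff_add)
  \<comment> \<open>The point 1 lies in the interval of level k with index 2^k, whose slice has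
    volume at most 2^(-k) because that over [0,1) has volume at most 1.\<close>
  have le: "emeasure A ({1} \<times> Z_hat) \<le> ennreal ((1 / 2) ^ k)" for k
  proof -
    have "{1} \<times> Z_hat \<subseteq> dyadic (int k) (2 ^ k) \<times> Z_hat" by (auto simp: dyadic_def)
    then have "emeasure A ({1} \<times> Z_hat) \<le> h (int k)"
      unfolding h[of "int k" "2 ^ k", symmetric] using Z by (intro emeasure_mono Times_in_sets_A) auto
    also have "\<dots> \<le> 1 * ennreal (2 powi (- int k))"
      unfolding hj[of "int k"] by (intro mult_right_mono h1) simp
    finally show ?thesis by (simp add: power_int_minus power_one_over inverse_eq_divide)
  qed
  have "(\<lambda>k. ennreal ((1 / 2) ^ k)) \<longlonglongrightarrow> ennreal 0"
    by (intro tendsto_ennrealI LIMSEQ_power_zero) simp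
  then have "emeasure A ({1} \<times> Z_hat) \<le> ennreal 0"
    by (rule LIMSEQ_le_const) (use le in blast)
  then have "h 0 = 1" using eq1 by simp
  then show ?thesis using h[of j n] hj[of j] by (simp add: emeasure_dyadic)
qed

text \<open>One variable at a time: for a fixed interval the volume is an invariant function of the
  box, hence proportional to \<open>N\<close>, and the factor is the volume of the slice over
  \<open>Z_hat\<close>, already known to be the length.\<close>

theorem A_eq_pair: "A = lborel \<Otimes>\<^sub>M N"
proof (rule measure_eqI_generator_eq_countable[where A = dyadic_boxes and E = dyadic_boxes])
  interpret sigma_finite_measure N by (rule sigma_finite_N)
  have pair: "emeasure (lborel \<Otimes>\<^sub>M N) (D \<times> B) = emeasure lborel D * emeasure N B"
    if "D \<in> insert {} dyadic_intervals" "B \<in> insert {} adele_boxes" for D B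
    using dyadic_intervals_borel[OF that(1)] boxes_sets[OF that(2)] by (intro emeasure_pair_measure_Times) auto
  show eq: "emeasure A X = emeasure (lborel \<Otimes>\<^sub>M N) X" if "X \<in> dyadic_boxes" for X
  proof -
    obtain D B where DB: "X = D \<times> B" "D \<in> insert {} dyadic_intervals" "B \<in> insert {} adele_boxes"
      using \<open>X \<in> dyadic_boxes\<close> unfolding dyadic_boxes_def by blast
    show ?thesis
    proof (cases "D = {} \<or> B = {}")
      case False
      then have D: "D \<in> dyadic_intervals" and B: "B \<in> adele_boxes" using DB by auto
      note Db = dyadic_intervals_borel[OF DB(2)]
      have "emeasure A (D \<times> B) = emeasure A (D \<times> Z_hat) * emeasure N B"
      proof (rule box_function_eq[OF _ _ B])
        fix g B assume "g \<in> carrier finite_adele_ring" "B \<in> adele_boxes"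
        then show "emeasure A (D \<times> (\<lambda>x. g \<oplus>\<^bsub>finite_adele_ring\<^esub> x) ` B) = emeasure A (D \<times> B)"
          using translation_invariant_A[of g D B 0] Db box_in_sets by simp
      next
        fix n :: nat and B assume B: "\<And>i. i < n \<Longrightarrow> B i \<in> adele_boxes" "disjoint_family_on B {..<n}"
        have "D \<times> (\<Union>i<n. B i) = (\<Union>i<n. D \<times> B i)" by auto
        moreover have "emeasure A (\<Union>i<n. D \<times> B i) = (\<Sum>i<n. emeasure A (D \<times> B i))"
          using B Db box_in_sets by (intro sum_emeasure[symmetric]) (auto simp: disjoint_family_on_def intro!: Times_in_sets_A)
        ultimately show "emeasure A (D \<times> (\<Union>i<n. B i)) = (\<Sum>i<n. emeasure A (D \<times> B i))" by simp
      qed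
      moreover have "emeasure A (D \<times> Z_hat) = emeasure lborel D"
        using D emeasure_A_dyadic by (auto simp: dyadic_intervals_def)
      ultimately show ?thesis using pair[OF DB(2,3)] DB(1) by simp
    qed (use DB(1) in auto)
  qed
  show "Int_stable dyadic_boxes"
    unfolding Int_stable_def
  proof (intro ballI)
    fix X Y assume "X \<in> dyadic_boxes" "Y \<in> dyadic_boxes"
    then obtain D B D' B' where X: "X = D \<times> B" "Y = D' \<times> B'" "D \<in> insert {} dyadic_intervals" "B \<in> insert {} adele_boxes"
      "D' \<in> insert {} dyadic_intervals" "B' \<in> insert {} adele_boxes" unfolding dyadic_boxes_def by blast
    have "D \<inter> D' \<in> insert {} dyadic_intervals" "B \<inter> B' \<in> insert {} adele_boxes"
      using X(3-6) Int_stable_dyadic_intervals Int_stable_adele_boxes unfolding Int_stable_def by blast+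
    then show "X \<inter> Y \<in> dyadic_boxes" unfolding X(1,2) Times_Int_Times dyadic_boxes_def by blast
  qed
  show "emeasure A X \<noteq> \<infinity>" if X: "X \<in> dyadic_boxes" for X
  proof -
    obtain D B where DB: "X = D \<times> B" "D \<in> insert {} dyadic_intervals" "B \<in> insert {} adele_boxes"
      using X unfolding dyadic_boxes_def by blast
    have "emeasure lborel D < \<infinity>" using DB(2) by (auto simp: dyadic_intervals_def emeasure_dyadic)
    moreover have "emeasure N B < \<infinity>" using DB(3) emeasure_box_finite by auto
    moreover have "emeasure A X = emeasure lborel D * emeasure N B"
      using eq[OF X] pair[OF DB(2,3)] DB(1) by simp
    ultimately show ?thesis by (auto simp: ennreal_mult_eq_top_iff)
  qed
qed (use dyadic_boxes_Pow sets_A sets_pair_A Union_dyadic_boxes countable_dyadic_boxes in auto)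

end

theorem mainTheorem2:
  fixes \<psi> :: "nat \<Rightarrow> nat \<Rightarrow> padic \<Rightarrow> complex"
    and \<mu> :: "nat \<Rightarrow> padic measure"
    and \<mu>A :: "(real \<times> (nat \<Rightarrow> padic)) measure"
    and \<mu>F :: "(nat \<Rightarrow> padic) measure"
  assumes "\<And>p. prime p \<Longrightarrow> haar_measure (Qp p) (Qp_topology p) (\<mu> p)"
    and "\<And>p. prime p \<Longrightarrow> emeasure (\<mu> p) (Zp p) = 1"
    and "haar_measure adele_ring adele_topology \<mu>A"
    and "emeasure \<mu>A ({0..1} \<times> Z_hat) = 1"
    and "haar_measure finite_adele_ring finite_adele_topology \<mu>F"
    and "emeasure \<mu>F Z_hat = 1"
    and "\<And>p. prime p \<Longrightarrow> compactly_supported_wavelets p (\<mu> p) (\<psi> p)"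
  shows "orthonormal_basis \<mu>A (L2 \<mu>A) (UNIV \<times> finite_adelic_indices \<psi>) (adelic_wavelet \<psi>) \<and>
         orthonormal_basis \<mu>F (L2 \<mu>F) (finite_adelic_indices \<psi>) (finite_adelic_wavelet \<psi>)"
proof -
  have local: "padic_haar p (\<mu> p)" if "prime p" for p
    using that assms(1,2) by (intro padic_haar.intro)
  have wav: "padic_wavelets p (\<mu> p) (\<psi> p)" if "prime p" for p
    using assms(7)[OF that] local[OF that]
    by (intro padic_wavelets.intro padic_wavelets_axioms.intro) (auto simp: compactly_supported_wavelets_def)
  interpret F: finite_adele_wavelets \<mu> \<mu>F \<psi>
    by (intro finite_adele_wavelets.intro finite_adele_haar.intro finite_adele_wavelets_axioms.intro local wav assms)
  interpret A: adele_haar \<mu> \<mu>F \<mu>A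
    by (intro adele_haar.intro adele_haar_axioms.intro F.finite_adele_haar_axioms assms)
  interpret pair_sigma_finite lborel \<mu>F
    by (intro pair_sigma_finite.intro F.sigma_finite_N lborel.sigma_finite_measure_axioms)
  \<comment> \<open>With the coercion to complex numbers absorbed into \<open>complex_haar\<close>,
    the adelic wavelet is literally a tensor product of two basis functions.\<close>
  have "adelic_wavelet \<psi> = (\<lambda>(i, \<alpha>). tensor2 (complex_haar i) (finite_adelic_wavelet \<psi> \<alpha>))"
    by (auto simp: fun_eq_iff adelic_wavelet_def tensor2_def complex_haar_def)
  then have "orthonormal_basis \<mu>A (L2 \<mu>A) (UNIV \<times> finite_adelic_indices \<psi>) (adelic_wavelet \<psi>)"
    using orthonormal_basis_tensor2[OF complex_haar_basis F.finite_adelic_wavelet_basis] A.A_eq_pair by simp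
  then show ?thesis using F.finite_adelic_wavelet_basis by blast
qed

end
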